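(* There exists no totally umbilical proper STCR lightlike submanifold of an indefinite complex space form $\bar M(c)$ with $c\neq0$.
   Context: Indefinite Kähler manifold $(\bar M,\bar J,\bar g)$: a semi-Riemannian manifold of constant index $q$, $0<q<\dim\bar M$, with an almost complex structure $\bar J$ ($\bar J^2=-I$) satisfying $\bar g(\bar JX,\bar JY)=\bar g(X,Y)$ and $\bar\nabla\bar J=0$, where $\bar\nabla$ is the Levi-Civita connection of $\bar g$. An indefinite complex space form $\bar M(c)$ is a connected indefinite Kähler manifold of constant holomorphic sectional curvature $c$; its curvature tensor is $$\bar R(X,Y)Z=\tfrac c4\{\bar g(Y,Z)X-\bar g(X,Z)Y+\bar g(\bar JY,Z)\bar JX-\bar g(\bar JX,Z)\bar JY+2\bar g(X,\bar JY)\bar JZ\}.$$ Lightlike submanifold: a submanifold $M$ of dimension $m$ of $\bar M$ (of dimension $m+n$), with induced metric $g$, such that $Rad(TM)=TM\cap TM^\perp$ has constant rank $r$, $1\le r\le m$. One fixes non-degenerate complements: a screen distribution $S(TM)$ with $TM=S(TM)\perp Rad(TM)$ and a screen transversal bundle $S(TM^\perp)$ with $TM^\perp=S(TM^\perp)\perp Rad(TM)$. The lightlike transversal bundle $ltr(TM)$ is a rank $r$ complement of $Rad(TM)$ in the orthogonal complement of $S(TM)\perp S(TM^\perp)$ in $T\bar M|_M$, locally spanned by $N_1,\dots,N_r$ with $\bar g(\xi_i,N_j)=\delta_{ij}$, $\bar g(N_i,N_j)=0$ for a local basis $\{\xi_i\}$ of $Rad(TM)$. Put $tr(TM)=ltr(TM)\perp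 S(TM^\perp)$; then $T\bar M|_M=TM\oplus tr(TM)$. STCR (screen transversal Cauchy Riemann) lightlike submanifold: a real lightlike submanifold $M$ of $\bar M$ such that (A) there are subbundles $D_1,D_2$ of $Rad(TM)$ with $Rad(TM)=D_1\oplus D_2$, $\bar J(D_1)\subset S(TM)$, $\bar J(D_2)\subset S(TM^\perp)$; (B) there are subbundles $D_0,D'$ of $S(TM)$ with $S(TM)=\{\bar JD_1\oplus D'\}\perp D_0$, $\bar J(D_0)=D_0$, $\bar J(D')=L_1\perp S$, where $D_0$ is non-degenerate and $L_1$, $S$ are vector subbundles of $ltr(TM)$ and $S(TM^\perp)$ respectively. Moreover $ltr(TM)=L_1\oplus L_2$ with $\bar J(L_1)\subset S(TM)$, $\bar J(L_2)\subset S(TM^\perp)$, and $S(TM^\perp)=\{\bar J(D_2)\oplus\bar J(L_2)\}\perp S$. $M$ is proper if $D_1\ne\{0\}$, $D_2\neq\{0\}$, $D_0\ne\{0\}$ and $S\neq\{0\}$. Second fundamental form: $\bar\nabla_XY=\nabla_XY+h(X,Y)$ for $X,Y\in\Gamma(TM)$, with $\nabla_XY\in\Gamma(TM)$, $h(X,Y)\in\Gamma(tr(TM))$. $M$ is totally umbilical if there is a smooth transversal vector field $H\in\Gamma(tr(TM))$ with $h(X,Y)=g(X,Y)H$ for all $X,Y\in\Gamma(TM)$. *)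

theory Defs
  imports "HOL-Analysis.Analysis"
begin

section \<open>Smooth maps and manifolds\<close>

primrec Ck_on :: "nat \<Rightarrow> 'a::real_normed_vector set \<Rightarrow> ('a \<Rightarrow> 'b::real_normed_vector) \<Rightarrow> bool" where
  "Ck_on 0 U f \<longleftrightarrow> continuous_on U f"
| "Ck_on (Suc k) U f \<longleftrightarrow>
     (\<forall>x\<in>U. f differentiable (at x)) \<and> (\<forall>v. Ck_on k U (\<lambda>x. frechet_derivative f (at x) v))"

text \<open>Only used for open \<open>U\<close> in a finite-dimensional space, where it is the usual notion.\<close>

definition smooth_on :: "'a::real_normed_vector set \<Rightarrow> ('a \<Rightarrow> 'b::real_normed_vector) \<Rightarrow> bool" where
  "smooth_on U f \<longleftrightarrow> (\<forall>k. Ck_on k U f)"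

type_synonym ('p, 'e) chart = "'p set \<times> ('p \<Rightarrow> 'e)"

abbreviation cdom :: "('p, 'e) chart \<Rightarrow> 'p set" where "cdom \<equiv> fst"
abbreviation cmap :: "('p, 'e) chart \<Rightarrow> 'p \<Rightarrow> 'e" where "cmap \<equiv> snd"

definition cinv :: "('p, 'e) chart \<Rightarrow> 'e \<Rightarrow> 'p" where
  "cinv c = inv_into (cdom c) (cmap c)"

definition is_chart :: "('p::topological_space, 'e::euclidean_space) chart \<Rightarrow> bool" where
  "is_chart c \<longleftrightarrow> open (cdom c) \<and> open (cmap c ` cdom c) \<and>
     homeomorphism (cdom c) (cmap c ` cdom c) (cmap c) (cinv c)"

text \<open>A manifold of dimension \<open>DIM('e)\<close> is a Hausdorff, second countable type \<open>'p\<close> of points with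
  a smooth atlas. The atlas need not be maximal.\<close>

definition smooth_manifold ::
  "('p::{t2_space,second_countable_topology}, 'e::euclidean_space) chart set \<Rightarrow> bool" where
  "smooth_manifold A \<longleftrightarrow> (\<forall>c\<in>A. is_chart c) \<and> (\<Union>c\<in>A. cdom c) = UNIV \<and>
     (\<forall>c\<in>A. \<forall>d\<in>A. smooth_on (cmap c ` (cdom c \<inter> cdom d)) (cmap d \<circ> cinv c))"

section \<open>Tangent vectors, vector fields, sections along a map\<close>

text \<open>The tangent space at \<open>p\<close> is identified with \<open>'e\<close> by means of one selected chart
  \<open>chart_at A p\<close> around \<open>p\<close>: a tangent vector is the vector of its coordinates in that chart.
  Its coordinates in another chart \<open>c\<close> around \<open>p\<close> are given by \<open>tcoord A c p\<close>. As the selected chart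
  varies with the point, smoothness and derivatives of vector fields always refer to their coordinates
  in a chart that is kept fixed.\<close>

definition chart_at :: "('p, 'e) chart set \<Rightarrow> 'p \<Rightarrow> ('p, 'e) chart" where
  "chart_at A p = (SOME c. c \<in> A \<and> p \<in> cdom c)"

definition tcoord ::
  "('p, 'e::euclidean_space) chart set \<Rightarrow> ('p, 'e) chart \<Rightarrow> 'p \<Rightarrow> 'e \<Rightarrow> 'e" where
  "tcoord A c p v =
     frechet_derivative (cmap c \<circ> cinv (chart_at A p)) (at (cmap (chart_at A p) p)) v"

definition smooth_fun_on ::
  "('p, 'e::euclidean_space) chart set \<Rightarrow> 'p set \<Rightarrow> ('p \<Rightarrow> real) \<Rightarrow> bool" where
  "smooth_fun_on A U \<phi> \<longleftrightarrow> (\<forall>c\<in>A. smooth_on (cmap c ` (cdom c \<inter> U)) (\<phi> \<circ> cinv c))"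

definition dir_deriv ::
  "('p, 'e::euclidean_space) chart set \<Rightarrow> ('p \<Rightarrow> real) \<Rightarrow> 'p \<Rightarrow> 'e \<Rightarrow> real" where
  "dir_deriv A \<phi> p v =
     frechet_derivative (\<phi> \<circ> cinv (chart_at A p)) (at (cmap (chart_at A p) p)) v"

text \<open>In what follows \<open>B\<close> is the atlas of the source and \<open>A\<close> that of the target of a map \<open>f\<close>.\<close>

definition smooth_map ::
  "('q::topological_space, 'd::euclidean_space) chart set \<Rightarrow>
   ('p::topological_space, 'e::euclidean_space) chart set \<Rightarrow> ('q \<Rightarrow> 'p) \<Rightarrow> bool" where
  "smooth_map B A f \<longleftrightarrow> continuous_on UNIV f \<and>
     (\<forall>c\<in>B. \<forall>d\<in>A. smooth_on (cmap c ` (cdom c \<inter> f -` cdom d)) (cmap d \<circ> f \<circ> cinv c))"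

definition differential ::
  "('q, 'd::euclidean_space) chart set \<Rightarrow> ('p, 'e::euclidean_space) chart set \<Rightarrow>
   ('q \<Rightarrow> 'p) \<Rightarrow> 'q \<Rightarrow> 'd \<Rightarrow> 'e" where
  "differential B A f q v =
     frechet_derivative (cmap (chart_at A (f q)) \<circ> f \<circ> cinv (chart_at B q))
       (at (cmap (chart_at B q) q)) v"

text \<open>A section along \<open>f\<close> assigns to \<open>q\<close> a vector \<open>V q\<close> tangent to the target manifold at \<open>f q\<close>,
  i.e. it is a section of the pulled back tangent bundle.\<close>

definition smooth_section_on ::
  "('q, 'd::euclidean_space) chart set \<Rightarrow> ('p, 'e::euclidean_space) chart set \<Rightarrow>
   ('q \<Rightarrow> 'p) \<Rightarrow> 'q set \<Rightarrow> ('q \<Rightarrow> 'e) \<Rightarrow> bool" where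
  "smooth_section_on B A f U V \<longleftrightarrow>
     (\<forall>c\<in>B. \<forall>d\<in>A. smooth_on (cmap c ` (cdom c \<inter> U \<inter> f -` cdom d))
        (\<lambda>x. tcoord A d (f (cinv c x)) (V (cinv c x))))"

definition smooth_field_on ::
  "('p, 'e::euclidean_space) chart set \<Rightarrow> 'p set \<Rightarrow> ('p \<Rightarrow> 'e) \<Rightarrow> bool" where
  "smooth_field_on A U X \<longleftrightarrow> smooth_section_on A A id U X"

definition lie_bracket ::
  "('p, 'e::euclidean_space) chart set \<Rightarrow> ('p \<Rightarrow> 'e) \<Rightarrow> ('p \<Rightarrow> 'e) \<Rightarrow> 'p \<Rightarrow> 'e" where
  "lie_bracket A X Y p =
     (let c = chart_at A p;
          coords = (\<lambda>Z x. tcoord A c (cinv c x) (Z (cinv c x)))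
      in frechet_derivative (coords Y) (at (cmap c p)) (X p)
         - frechet_derivative (coords X) (at (cmap c p)) (Y p))"

section \<open>Connections and curvature\<close>

text \<open>A linear connection is given by its Christoffel symbols: \<open>\<Gamma> c p u v\<close> are the coordinates in
  the chart \<open>c\<close> of the covariant derivative at \<open>p\<close> of the field with constant coordinates \<open>v\<close> in
  direction \<open>u\<close>. The last condition is the transformation law under a change of charts \<open>\<tau>\<close>.\<close>

type_synonym ('p, 'e) connection = "('p, 'e) chart \<Rightarrow> 'p \<Rightarrow> 'e \<Rightarrow> 'e \<Rightarrow> 'e"

definition linear_connection ::
  "('p, 'e::euclidean_space) chart set \<Rightarrow> ('p, 'e) connection \<Rightarrow> bool" where
  "linear_connection A \<Gamma> \<longleftrightarrow>
     (\<forall>c\<in>A. (\<forall>p\<in>cdom c. bilinear (\<Gamma> c p)) \<and>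
             (\<forall>u v. smooth_on (cmap c ` cdom c) (\<lambda>x. \<Gamma> c (cinv c x) u v))) \<and>
     (\<forall>c\<in>A. \<forall>d\<in>A. \<forall>p\<in>cdom c \<inter> cdom d. \<forall>u v.
        let \<tau> = cmap d \<circ> cinv c; x = cmap c p; D = frechet_derivative \<tau> (at x)
        in \<Gamma> d p (D u) (D v)
             + frechet_derivative (\<lambda>y. frechet_derivative \<tau> (at y) v) (at x) u
           = D (\<Gamma> c p u v))"

text \<open>Covariant derivative at \<open>q\<close>, in direction \<open>v\<close>, of a section \<open>V\<close> along \<open>f\<close>
  (the pulled back connection).\<close>

definition cov_deriv ::
  "('q, 'd::euclidean_space) chart set \<Rightarrow> ('p, 'e::euclidean_space) chart set \<Rightarrow>
   ('p, 'e) connection \<Rightarrow> ('q \<Rightarrow> 'p) \<Rightarrow> ('q \<Rightarrow> 'e) \<Rightarrow> 'q \<Rightarrow> 'd \<Rightarrow> 'e" where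
  "cov_deriv B A \<Gamma> f V q v =
     (let c = chart_at B q; d = chart_at A (f q)
      in frechet_derivative (\<lambda>x. tcoord A d (f (cinv c x)) (V (cinv c x))) (at (cmap c q)) v
         + \<Gamma> d (f q) (differential B A f q v) (V q))"

definition nabla ::
  "('p, 'e::euclidean_space) chart set \<Rightarrow> ('p, 'e) connection \<Rightarrow>
   ('p \<Rightarrow> 'e) \<Rightarrow> ('p \<Rightarrow> 'e) \<Rightarrow> 'p \<Rightarrow> 'e" where
  "nabla A \<Gamma> X Y p = cov_deriv A A \<Gamma> id Y p (X p)"

definition curvature ::
  "('p, 'e::euclidean_space) chart set \<Rightarrow> ('p, 'e) connection \<Rightarrow>
   ('p \<Rightarrow> 'e) \<Rightarrow> ('p \<Rightarrow> 'e) \<Rightarrow> ('p \<Rightarrow> 'e) \<Rightarrow> 'p \<Rightarrow> 'e" where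
  "curvature A \<Gamma> X Y Z p =
     nabla A \<Gamma> X (nabla A \<Gamma> Y Z) p - nabla A \<Gamma> Y (nabla A \<Gamma> X Z) p
     - nabla A \<Gamma> (lie_bracket A X Y) Z p"

section \<open>Semi-Riemannian metrics\<close>

definition nondegenerate_on :: "('e::euclidean_space \<Rightarrow> 'e \<Rightarrow> real) \<Rightarrow> 'e set \<Rightarrow> bool" where
  "nondegenerate_on b W \<longleftrightarrow> (\<forall>v\<in>W. (\<forall>w\<in>W. b v w = 0) \<longrightarrow> v = 0)"

definition form_index :: "('e::euclidean_space \<Rightarrow> 'e \<Rightarrow> real) \<Rightarrow> nat" where
  "form_index b = Max {dim W | W. subspace W \<and> (\<forall>w\<in>W. w \<noteq> 0 \<longrightarrow> b w w < 0)}"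

text \<open>Here and below, \<open>X \<in> \<Gamma>(TM)\<close> is read as: \<open>X\<close> is a smooth section over an arbitrary
  open subset \<open>U\<close>. All the notions concerned are local, so this agrees with the use of
  globally defined sections.\<close>

definition semi_riemannian_metric ::
  "('p::topological_space, 'e::euclidean_space) chart set \<Rightarrow> ('p \<Rightarrow> 'e \<Rightarrow> 'e \<Rightarrow> real) \<Rightarrow> nat \<Rightarrow> bool" where
  "semi_riemannian_metric A g \<nu> \<longleftrightarrow>
     (\<forall>p. bilinear (g p) \<and> (\<forall>v w. g p v w = g p w v) \<and> nondegenerate_on (g p) UNIV \<and>
          form_index (g p) = \<nu>) \<and>
     (\<forall>U X Y. open U \<longrightarrow> smooth_field_on A U X \<longrightarrow> smooth_field_on A U Y \<longrightarrow>
        smooth_fun_on A U (\<lambda>p. g p (X p) (Y p)))"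

definition levi_civita ::
  "('p::topological_space, 'e::euclidean_space) chart set \<Rightarrow> ('p \<Rightarrow> 'e \<Rightarrow> 'e \<Rightarrow> real) \<Rightarrow>
   ('p, 'e) connection \<Rightarrow> bool" where
  "levi_civita A g \<Gamma> \<longleftrightarrow> linear_connection A \<Gamma> \<and>
     (\<forall>U X Y. open U \<longrightarrow> smooth_field_on A U X \<longrightarrow> smooth_field_on A U Y \<longrightarrow>
        (\<forall>p\<in>U. nabla A \<Gamma> X Y p - nabla A \<Gamma> Y X p = lie_bracket A X Y p)) \<and>
     (\<forall>U X Y Z. open U \<longrightarrow> smooth_field_on A U X \<longrightarrow> smooth_field_on A U Y \<longrightarrow> smooth_field_on A U Z \<longrightarrow>
        (\<forall>p\<in>U. dir_deriv A (\<lambda>p. g p (Y p) (Z p)) p (X p)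
                = g p (nabla A \<Gamma> X Y p) (Z p) + g p (Y p) (nabla A \<Gamma> X Z p)))"

section \<open>Indefinite complex space forms\<close>

definition almost_complex_structure ::
  "('p::topological_space, 'e::euclidean_space) chart set \<Rightarrow> ('p \<Rightarrow> 'e \<Rightarrow> 'e) \<Rightarrow> bool" where
  "almost_complex_structure A J \<longleftrightarrow>
     (\<forall>p. linear (J p) \<and> (\<forall>v. J p (J p v) = - v)) \<and>
     (\<forall>U X. open U \<longrightarrow> smooth_field_on A U X \<longrightarrow> smooth_field_on A U (\<lambda>p. J p (X p)))"

definition indefinite_kaehler_manifold ::
  "('p::{t2_space,second_countable_topology}, 'e::euclidean_space) chart set \<Rightarrow>
   ('p \<Rightarrow> 'e \<Rightarrow> 'e \<Rightarrow> real) \<Rightarrow> ('p \<Rightarrow> 'e \<Rightarrow> 'e) \<Rightarrow> ('p, 'e) connection \<Rightarrow> bool" where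
  "indefinite_kaehler_manifold A g J \<Gamma> \<longleftrightarrow>
     smooth_manifold A \<and>
     (\<exists>\<nu>. 0 < \<nu> \<and> \<nu> < DIM('e) \<and> semi_riemannian_metric A g \<nu>) \<and>
     levi_civita A g \<Gamma> \<and>
     almost_complex_structure A J \<and>
     (\<forall>p v w. g p (J p v) (J p w) = g p v w) \<and>
     (\<forall>U X Y. open U \<longrightarrow> smooth_field_on A U X \<longrightarrow> smooth_field_on A U Y \<longrightarrow>
        (\<forall>p\<in>U. nabla A \<Gamma> X (\<lambda>p. J p (Y p)) p = J p (nabla A \<Gamma> X Y p)))"

definition sectional_curvature ::
  "('p, 'e::euclidean_space) chart set \<Rightarrow> ('p \<Rightarrow> 'e \<Rightarrow> 'e \<Rightarrow> real) \<Rightarrow> ('p, 'e) connection \<Rightarrow>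
   ('p \<Rightarrow> 'e) \<Rightarrow> ('p \<Rightarrow> 'e) \<Rightarrow> 'p \<Rightarrow> real" where
  "sectional_curvature A g \<Gamma> X Y p =
     g p (curvature A \<Gamma> X Y Y p) (X p) /
     (g p (X p) (X p) * g p (Y p) (Y p) - (g p (X p) (Y p))\<^sup>2)"

text \<open>The holomorphic plane spanned by \<open>X p\<close> and \<open>J p (X p)\<close> is non-degenerate if and only if
  \<open>X p\<close> is not null.\<close>

definition constant_holomorphic_sectional_curvature ::
  "('p::topological_space, 'e::euclidean_space) chart set \<Rightarrow> ('p \<Rightarrow> 'e \<Rightarrow> 'e \<Rightarrow> real) \<Rightarrow>
   ('p \<Rightarrow> 'e \<Rightarrow> 'e) \<Rightarrow> ('p, 'e) connection \<Rightarrow> real \<Rightarrow> bool" where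
  "constant_holomorphic_sectional_curvature A g J \<Gamma> c \<longleftrightarrow>
     (\<forall>U X. open U \<longrightarrow> smooth_field_on A U X \<longrightarrow>
        (\<forall>p\<in>U. g p (X p) (X p) \<noteq> 0 \<longrightarrow>
           sectional_curvature A g \<Gamma> X (\<lambda>p. J p (X p)) p = c))"

definition indefinite_complex_space_form ::
  "('p::{t2_space,second_countable_topology}, 'e::euclidean_space) chart set \<Rightarrow>
   ('p \<Rightarrow> 'e \<Rightarrow> 'e \<Rightarrow> real) \<Rightarrow> ('p \<Rightarrow> 'e \<Rightarrow> 'e) \<Rightarrow> ('p, 'e) connection \<Rightarrow> real \<Rightarrow> bool" where
  "indefinite_complex_space_form A g J \<Gamma> c \<longleftrightarrow>
     connected (UNIV :: 'p set) \<and>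
     indefinite_kaehler_manifold A g J \<Gamma> \<and>
     constant_holomorphic_sectional_curvature A g J \<Gamma> c"

section \<open>Subbundles along an immersion\<close>

definition immersed_submanifold ::
  "('q::{t2_space,second_countable_topology}, 'd::euclidean_space) chart set \<Rightarrow>
   ('p::{t2_space,second_countable_topology}, 'e::euclidean_space) chart set \<Rightarrow> ('q \<Rightarrow> 'p) \<Rightarrow> bool" where
  "immersed_submanifold B A f \<longleftrightarrow>
     smooth_manifold B \<and> smooth_map B A f \<and> inj f \<and> (\<forall>q. inj (differential B A f q))"

text \<open>Bundles over the submanifold are families of subspaces of the ambient tangent spaces
  at the points \<open>f q\<close>.\<close>

type_synonym ('q, 'e) vbundle = "'q \<Rightarrow> 'e set"

definition local_frame ::
  "('q, 'd::euclidean_space) chart set \<Rightarrow> ('p, 'e::euclidean_space) chart set \<Rightarrow> ('q \<Rightarrow> 'p) \<Rightarrow>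
   'q set \<Rightarrow> nat \<Rightarrow> (nat \<Rightarrow> 'q \<Rightarrow> 'e) \<Rightarrow> ('q, 'e) vbundle \<Rightarrow> bool" where
  "local_frame B A f U k s E \<longleftrightarrow>
     (\<forall>i<k. smooth_section_on B A f U (s i)) \<and>
     (\<forall>q\<in>U. inj_on (\<lambda>i. s i q) {..<k} \<and> independent ((\<lambda>i. s i q) ` {..<k}) \<and>
             span ((\<lambda>i. s i q) ` {..<k}) = E q)"

definition subbundle_rank ::
  "('q::topological_space, 'd::euclidean_space) chart set \<Rightarrow>
   ('p, 'e::euclidean_space) chart set \<Rightarrow> ('q \<Rightarrow> 'p) \<Rightarrow> nat \<Rightarrow> ('q, 'e) vbundle \<Rightarrow> bool" where
  "subbundle_rank B A f k E \<longleftrightarrow>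
     (\<forall>q. \<exists>U s. open U \<and> q \<in> U \<and> local_frame B A f U k s E)"

definition subbundle ::
  "('q::topological_space, 'd::euclidean_space) chart set \<Rightarrow>
   ('p, 'e::euclidean_space) chart set \<Rightarrow> ('q \<Rightarrow> 'p) \<Rightarrow> ('q, 'e) vbundle \<Rightarrow> bool" where
  "subbundle B A f E \<longleftrightarrow> (\<exists>k. subbundle_rank B A f k E)"

definition direct_sum :: "'e::euclidean_space set \<Rightarrow> 'e set \<Rightarrow> 'e set \<Rightarrow> bool" where
  "direct_sum V W Z \<longleftrightarrow> V = W + Z \<and> W \<inter> Z = {0}"

definition orth_direct_sum ::
  "('e::euclidean_space \<Rightarrow> 'e \<Rightarrow> real) \<Rightarrow> 'e set \<Rightarrow> 'e set \<Rightarrow> 'e set \<Rightarrow> bool" where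
  "orth_direct_sum b V W Z \<longleftrightarrow> direct_sum V W Z \<and> (\<forall>w\<in>W. \<forall>z\<in>Z. b w z = 0)"

definition orth :: "('e::euclidean_space \<Rightarrow> 'e \<Rightarrow> real) \<Rightarrow> 'e set \<Rightarrow> 'e set" where
  "orth b W = {v. \<forall>w\<in>W. b v w = 0}"

definition tangent_bundle ::
  "('q, 'd::euclidean_space) chart set \<Rightarrow> ('p, 'e::euclidean_space) chart set \<Rightarrow>
   ('q \<Rightarrow> 'p) \<Rightarrow> ('q, 'e) vbundle" where
  "tangent_bundle B A f q = range (differential B A f q)"

definition normal_bundle ::
  "('q, 'd::euclidean_space) chart set \<Rightarrow> ('p, 'e::euclidean_space) chart set \<Rightarrow>
   ('p \<Rightarrow> 'e \<Rightarrow> 'e \<Rightarrow> real) \<Rightarrow> ('q \<Rightarrow> 'p) \<Rightarrow> ('q, 'e) vbundle" where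
  "normal_bundle B A g f q = orth (g (f q)) (tangent_bundle B A f q)"

definition radical ::
  "('q, 'd::euclidean_space) chart set \<Rightarrow> ('p, 'e::euclidean_space) chart set \<Rightarrow>
   ('p \<Rightarrow> 'e \<Rightarrow> 'e \<Rightarrow> real) \<Rightarrow> ('q \<Rightarrow> 'p) \<Rightarrow> ('q, 'e) vbundle" where
  "radical B A g f q = tangent_bundle B A f q \<inter> normal_bundle B A g f q"

section \<open>Lightlike submanifolds\<close>

text \<open>\<open>ST\<close>, \<open>STp\<close> and \<open>ltr\<close> are the screen distribution, the screen transversal bundle and the
  lightlike transversal bundle.\<close>

definition lightlike_submanifold ::
  "('q::{t2_space,second_countable_topology}, 'd::euclidean_space) chart set \<Rightarrow>
   ('p::{t2_space,second_countable_topology}, 'e::euclidean_space) chart set \<Rightarrow>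
   ('p \<Rightarrow> 'e \<Rightarrow> 'e \<Rightarrow> real) \<Rightarrow> ('q \<Rightarrow> 'p) \<Rightarrow>
   ('q, 'e) vbundle \<Rightarrow> ('q, 'e) vbundle \<Rightarrow> ('q, 'e) vbundle \<Rightarrow> bool" where
  "lightlike_submanifold B A g f ST STp ltr \<longleftrightarrow>
     immersed_submanifold B A f \<and>
     subbundle B A f ST \<and> subbundle B A f STp \<and>
     (\<forall>q. nondegenerate_on (g (f q)) (ST q) \<and> nondegenerate_on (g (f q)) (STp q) \<and>
          orth_direct_sum (g (f q)) (tangent_bundle B A f q) (ST q) (radical B A g f q) \<and>
          orth_direct_sum (g (f q)) (normal_bundle B A g f q) (STp q) (radical B A g f q) \<and>
          direct_sum (orth (g (f q)) (ST q + STp q)) (radical B A g f q) (ltr q)) \<and>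
     (\<exists>r. 1 \<le> r \<and> r \<le> DIM('d) \<and> (\<forall>q. dim (radical B A g f q) = r) \<and>
          subbundle_rank B A f r ltr \<and>
          (\<forall>q. \<exists>U \<xi> N. open U \<and> q \<in> U \<and>
             local_frame B A f U r \<xi> (radical B A g f) \<and> local_frame B A f U r N ltr \<and>
             (\<forall>q'\<in>U. \<forall>i<r. \<forall>j<r.
                g (f q') (\<xi> i q') (N j q') = (if i = j then 1 else 0) \<and>
                g (f q') (N i q') (N j q') = 0)))"

text \<open>The transversal bundle is \<open>tr q = ltr q + STp q\<close>. The second fundamental form is
  the transversal component of the ambient covariant derivative with respect to the decomposition
  of the ambient tangent space into the tangent space of the submanifold and \<open>tr q\<close>. Its arguments
  are vector fields on the submanifold.\<close>

definition second_fundamental_form ::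
  "('q, 'd::euclidean_space) chart set \<Rightarrow> ('p, 'e::euclidean_space) chart set \<Rightarrow>
   ('p, 'e) connection \<Rightarrow> ('q \<Rightarrow> 'p) \<Rightarrow> ('q, 'e) vbundle \<Rightarrow>
   ('q \<Rightarrow> 'd) \<Rightarrow> ('q \<Rightarrow> 'd) \<Rightarrow> 'q \<Rightarrow> 'e" where
  "second_fundamental_form B A \<Gamma> f tr X Y q =
     (THE t. t \<in> tr q \<and>
        cov_deriv B A \<Gamma> f (\<lambda>q'. differential B A f q' (Y q')) q (X q) - t \<in> tangent_bundle B A f q)"

definition totally_umbilical ::
  "('q::topological_space, 'd::euclidean_space) chart set \<Rightarrow>
   ('p, 'e::euclidean_space) chart set \<Rightarrow> ('p \<Rightarrow> 'e \<Rightarrow> 'e \<Rightarrow> real) \<Rightarrow>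
   ('p, 'e) connection \<Rightarrow> ('q \<Rightarrow> 'p) \<Rightarrow> ('q, 'e) vbundle \<Rightarrow> ('q, 'e) vbundle \<Rightarrow> bool" where
  "totally_umbilical B A g \<Gamma> f STp ltr \<longleftrightarrow>
     (let tr = (\<lambda>q. ltr q + STp q) in
      \<exists>H. smooth_section_on B A f UNIV H \<and> (\<forall>q. H q \<in> tr q) \<and>
        (\<forall>U X Y. open U \<longrightarrow> smooth_field_on B U X \<longrightarrow> smooth_field_on B U Y \<longrightarrow>
           (\<forall>q\<in>U. second_fundamental_form B A \<Gamma> f tr X Y q =
              g (f q) (differential B A f q (X q)) (differential B A f q (Y q)) *\<^sub>R H q)))"

section \<open>Screen transversal Cauchy--Riemann lightlike submanifolds\<close>

definition STCR_lightlike_submanifold ::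
  "('q::{t2_space,second_countable_topology}, 'd::euclidean_space) chart set \<Rightarrow>
   ('p::{t2_space,second_countable_topology}, 'e::euclidean_space) chart set \<Rightarrow>
   ('p \<Rightarrow> 'e \<Rightarrow> 'e \<Rightarrow> real) \<Rightarrow> ('p \<Rightarrow> 'e \<Rightarrow> 'e) \<Rightarrow> ('q \<Rightarrow> 'p) \<Rightarrow>
   ('q, 'e) vbundle \<Rightarrow> ('q, 'e) vbundle \<Rightarrow> ('q, 'e) vbundle \<Rightarrow>
   ('q, 'e) vbundle \<Rightarrow> ('q, 'e) vbundle \<Rightarrow> ('q, 'e) vbundle \<Rightarrow> ('q, 'e) vbundle \<Rightarrow>
   ('q, 'e) vbundle \<Rightarrow> ('q, 'e) vbundle \<Rightarrow> ('q, 'e) vbundle \<Rightarrow> bool" where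
  "STCR_lightlike_submanifold B A g J f ST STp ltr D1 D2 D0 D' L1 L2 S \<longleftrightarrow>
     lightlike_submanifold B A g f ST STp ltr \<and>
     (\<forall>E\<in>{D1, D2, D0, D', L1, L2, S}. subbundle B A f E) \<and>
     (\<forall>q. let b = g (f q); j = J (f q) in
        direct_sum (radical B A g f q) (D1 q) (D2 q) \<and>
        j ` D1 q \<subseteq> ST q \<and> j ` D2 q \<subseteq> STp q \<and>
        j ` D1 q \<inter> D' q = {0} \<and> orth_direct_sum b (ST q) (j ` D1 q + D' q) (D0 q) \<and>
        j ` D0 q = D0 q \<and> nondegenerate_on b (D0 q) \<and>
        L1 q \<subseteq> ltr q \<and> S q \<subseteq> STp q \<and> orth_direct_sum b (j ` D' q) (L1 q) (S q) \<and>
        direct_sum (ltr q) (L1 q) (L2 q) \<and> j ` L1 q \<subseteq> ST q \<and> j ` L2 q \<subseteq> STp q \<and>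
        j ` D2 q \<inter> j ` L2 q = {0} \<and> orth_direct_sum b (STp q) (j ` D2 q + j ` L2 q) (S q))"

text \<open>Subbundles have constant rank, so a subbundle is nonzero as soon as one fibre is.\<close>

definition proper_STCR_lightlike_submanifold ::
  "('q::{t2_space,second_countable_topology}, 'd::euclidean_space) chart set \<Rightarrow>
   ('p::{t2_space,second_countable_topology}, 'e::euclidean_space) chart set \<Rightarrow>
   ('p \<Rightarrow> 'e \<Rightarrow> 'e \<Rightarrow> real) \<Rightarrow> ('p \<Rightarrow> 'e \<Rightarrow> 'e) \<Rightarrow> ('q \<Rightarrow> 'p) \<Rightarrow>
   ('q, 'e) vbundle \<Rightarrow> ('q, 'e) vbundle \<Rightarrow> ('q, 'e) vbundle \<Rightarrow>
   ('q, 'e) vbundle \<Rightarrow> ('q, 'e) vbundle \<Rightarrow> ('q, 'e) vbundle \<Rightarrow> ('q, 'e) vbundle \<Rightarrow>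
   ('q, 'e) vbundle \<Rightarrow> ('q, 'e) vbundle \<Rightarrow> ('q, 'e) vbundle \<Rightarrow> bool" where
  "proper_STCR_lightlike_submanifold B A g J f ST STp ltr D1 D2 D0 D' L1 L2 S \<longleftrightarrow>
     STCR_lightlike_submanifold B A g J f ST STp ltr D1 D2 D0 D' L1 L2 S \<and>
     (\<forall>E\<in>{D1, D2, D0, S}. \<exists>q. E q \<noteq> {0})"

end

theory Submission
  imports Defs
begin

text \<open>Let \<open>Z\<close> be a local section of \<open>D2 \<subseteq> Rad(TM)\<close>. Umbilicity gives \<open>h(v, Z) = g(v, Z) H = 0\<close>, and
  together with metric compatibility it makes the transversal part of \<open>\<nabla>\<^sub>u \<nabla>\<^sub>v Z\<close> symmetric
  in \<open>u, v\<close>; hence \<open>R(u, v) Z\<close> is tangent to the submanifold for all tangent \<open>u, v\<close>.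
  On the other hand, for a non-null \<open>X \<in> D0\<close> the curvature of a complex space form
  yields \<open>R(X, J X) Z = - (c/2) g(X, X) J Z\<close>. As \<open>J Z\<close> lies in the nondegenerate bundle \<open>S(TM\<^sup>\<bottom>)\<close>, it pairs
  non-trivially with some normal vector, which forces \<open>c = 0\<close>.\<close>

section \<open>Smooth calculus\<close>

text \<open>The constant c/2 comes from the term 2 g(X, JY) JZ of the space form tensor, which at Y
  = JX is -2 g(X, X) JZ; every other term contains g(X, Z) or g(JX, Z) and vanishes because Z is
  radical. That tensor is not part of the definition of a space form, which prescribes only the
  holomorphic sectional curvature of non-null vectors, so it is derived by polarization. Transversal
  components are detected by pairing with normal vectors: as the ambient metric is nondegenerate, a
  vector orthogonal to the whole normal space is tangent. Two obstacles shape the rest. The tangent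
  space at p is read in the chart selected at p, which jumps with p, so every derivative is moved to
  a chart that is held fixed. And the ambient curvature is defined through ambient vector fields,
  whereas Z and its derivatives live only along the submanifold; both sides are therefore reduced to
  the pointwise coordinate tensor \<open>curv\<close>, which is also the curvature of the pulled
  back connection.\<close>

abbreviation fd :: "('a::real_normed_vector \<Rightarrow> 'b::real_normed_vector) \<Rightarrow> 'a \<Rightarrow> 'a \<Rightarrow> 'b" where
  "fd f x \<equiv> frechet_derivative f (at x)"

lemma has_derivative_fd: "f differentiable (at x) \<Longrightarrow> (f has_derivative fd f x) (at x)"
  by (simp add: frechet_derivative_works[symmetric])

lemma fd_eqI: "(f has_derivative f') (at x) \<Longrightarrow> fd f x = f'"
  by (simp add: frechet_derivative_at[symmetric])

lemma has_derivative_cong_open: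
  assumes "open U" "x \<in> U" "\<And>y. y \<in> U \<Longrightarrow> f y = h y"
  shows "(f has_derivative f') (at x) \<longleftrightarrow> (h has_derivative f') (at x)"
  by (metis assms has_derivative_transform_within_open)

text \<open>Differentiability is not at issue: \<open>frechet_derivative\<close> is a choice among
  all derivatives, and locally equal functions have the same ones, so the choices coincide.\<close>

lemma fd_cong_open:
  assumes "open U" "x \<in> U" "\<And>y. y \<in> U \<Longrightarrow> f y = h y"
  shows "fd f x = fd h x"
  unfolding frechet_derivative_def using has_derivative_cong_open[OF assms] by simp

lemma differentiable_cong_open:
  assumes "open U" "x \<in> U" "\<And>y. y \<in> U \<Longrightarrow> f y = h y"
  shows "f differentiable (at x) \<longleftrightarrow> h differentiable (at x)"
  unfolding differentiable_def using has_derivative_cong_open[OF assms] by simp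

lemma fd_compose:
  assumes "g differentiable (at x)" "f differentiable (at (g x))"
  shows "fd (\<lambda>y. f (g y)) x = (\<lambda>v. fd f (g x) (fd g x v))"
  by (rule fd_eqI) (rule has_derivative_compose[OF assms[THEN has_derivative_fd]])

section \<open>Closure properties of C^k and smooth functions\<close>

lemma Ck_on_cong:
  assumes "open U" "\<And>y. y \<in> U \<Longrightarrow> f y = h y"
  shows "Ck_on k U f \<longleftrightarrow> Ck_on k U h"
  using assms(2)
proof (induction k arbitrary: f h)
  case 0
  then show ?case by (simp cong: continuous_on_cong)
next
  case (Suc k)
  have "Ck_on k U (\<lambda>x. fd f x v) \<longleftrightarrow> Ck_on k U (\<lambda>x. fd h x v)" for v
    by (rule Suc.IH) (use fd_cong_open[OF assms(1)] Suc.prems in metis)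
  moreover have "f differentiable (at x) \<longleftrightarrow> h differentiable (at x)" if "x \<in> U" for x
    using differentiable_cong_open[OF assms(1) that] Suc.prems by blast
  ultimately show ?case by simp
qed

lemma Ck_on_subset: "Ck_on k U f \<Longrightarrow> V \<subseteq> U \<Longrightarrow> Ck_on k V f"
  by (induction k arbitrary: f) (auto intro: continuous_on_subset)

lemma Ck_on_Suc_imp: "Ck_on (Suc k) U f \<Longrightarrow> Ck_on k U f"
proof (induction k arbitrary: f)
  case 0
  then show ?case
    by (auto intro!: continuous_at_imp_continuous_on differentiable_imp_continuous_within)
next
  case (Suc k)
  then show ?case using Ck_on.simps(2) by blast
qed

lemma Ck_on_const: "Ck_on k U (\<lambda>x. a)"
  by (induction k arbitrary: a) auto

lemma Ck_on_bounded_linear: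
  assumes "bounded_linear f" "open U" shows "Ck_on k U f"
proof (cases k)
  case 0
  then show ?thesis using assms by (simp add: linear_continuous_on)
next
  case (Suc k')
  have "fd f x v = f v" for x v
    using assms(1) bounded_linear_imp_has_derivative fd_eqI by metis
  then show ?thesis
    using Suc assms Ck_on_const bounded_linear_imp_differentiable by auto
qed

lemma Ck_on_add:
  assumes "open U" "Ck_on k U f" "Ck_on k U h"
  shows "Ck_on k U (\<lambda>x. f x + h x)"
  using assms(2,3)
proof (induction k arbitrary: f h)
  case 0
  then show ?case by (auto intro: continuous_on_add)
next
  case (Suc k)
  have "Ck_on k U (\<lambda>x. fd (\<lambda>x. f x + h x) x v) \<longleftrightarrow> Ck_on k U (\<lambda>x. fd f x v + fd h x v)" for v
  proof (rule Ck_on_cong[OF assms(1)])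
    fix y assume "y \<in> U"
    then show "fd (\<lambda>x. f x + h x) y v = fd f y v + fd h y v"
      using Suc.prems by (subst fd_eqI[OF has_derivative_add]) (auto intro: has_derivative_fd)
  qed
  then show ?case using Suc by (auto intro: differentiable_add)
qed

lemma Ck_on_bounded_bilinear:
  assumes "bounded_bilinear p" "open U" "Ck_on k U f" "Ck_on k U h"
  shows "Ck_on k U (\<lambda>x. p (f x) (h x))"
  using assms(3,4)
proof (induction k arbitrary: f h)
  case 0
  then show ?case by (auto intro: bounded_bilinear.continuous_on[OF assms(1)])
next
  case (Suc k)
  have *: "((\<lambda>x. p (f x) (h x)) has_derivative (\<lambda>v. p (f x) (fd h x v) + p (fd f x v) (h x))) (at x)"
    if "x \<in> U" for x
    using that Suc.prems by (intro bounded_bilinear.FDERIV[OF assms(1)] has_derivative_fd) auto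
  have "Ck_on k U (\<lambda>x. fd (\<lambda>x. p (f x) (h x)) x v) \<longleftrightarrow> Ck_on k U (\<lambda>x. p (f x) (fd h x v) + p (fd f x v) (h x))" for v
    by (rule Ck_on_cong[OF assms(2)]) (simp add: fd_eqI[OF *])
  moreover have "Ck_on k U (\<lambda>x. p (f x) (fd h x v) + p (fd f x v) (h x))" for v
    using Suc.prems Ck_on_Suc_imp[OF Suc.prems(1)] Ck_on_Suc_imp[OF Suc.prems(2)]
    by (intro Ck_on_add[OF assms(2)] Suc.IH) auto
  ultimately show ?case using * by (auto simp: differentiable_def)
qed

lemma Ck_on_sum:
  assumes "open U" "finite I" "\<And>i. i \<in> I \<Longrightarrow> Ck_on k U (f i)"
  shows "Ck_on k U (\<lambda>x. \<Sum>i\<in>I. f i x)"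
  using assms(2,3) by (induction I) (auto intro: Ck_on_const Ck_on_add[OF assms(1)])

lemma linear_basis_expansion:
  fixes f :: "'a::euclidean_space \<Rightarrow> 'b::real_vector"
  assumes "linear f" shows "f v = (\<Sum>b\<in>Basis. (v \<bullet> b) *\<^sub>R f b)"
  using assms by (metis (no_types, lifting) euclidean_representation linear_scale linear_sum sum.cong)

lemma Ck_on_inner_right:
  assumes "open U" "Ck_on k U f" shows "Ck_on k U (\<lambda>x. f x \<bullet> b)"
  using Ck_on_bounded_bilinear[OF bounded_bilinear_inner assms Ck_on_const] .

text \<open>\<open>Ck_on\<close> only speaks about derivatives in a fixed direction, so a family of
  linear maps is known to be regular one vector at a time. Expanding \<open>h x\<close> in the
  finite basis turns the application into a finite sum of products.\<close>

lemma Ck_on_linear_app: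
  fixes L :: "'a::real_normed_vector \<Rightarrow> 'b::euclidean_space \<Rightarrow> 'c::real_normed_vector"
  assumes "open U" "\<And>x. x \<in> U \<Longrightarrow> linear (L x)" "\<And>a. Ck_on k U (\<lambda>x. L x a)" "Ck_on k U h"
  shows "Ck_on k U (\<lambda>x. L x (h x))"
proof -
  have "Ck_on k U (\<lambda>x. L x (h x)) \<longleftrightarrow> Ck_on k U (\<lambda>x. \<Sum>b\<in>Basis. (h x \<bullet> b) *\<^sub>R L x b)"
    by (rule Ck_on_cong[OF assms(1)]) (rule linear_basis_expansion[OF assms(2)])
  then show ?thesis
    using assms(1,3,4)
    by (auto intro!: Ck_on_sum Ck_on_bounded_bilinear[OF bounded_bilinear_scaleR] Ck_on_inner_right)
qed

text \<open>By the chain rule the derivative is the family \<open>fd f (g x)\<close> applied to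
  \<open>fd g x v\<close>. The induction hypothesis is used for the map
  \<open>\<lambda>y. fd f y a\<close> composed with the same \<open>g\<close>, and
  \<open>Ck_on_linear_app\<close> combines the two factors.\<close>

lemma Ck_on_compose:
  fixes g :: "'a::real_normed_vector \<Rightarrow> 'b::euclidean_space" and f :: "'b \<Rightarrow> 'c::real_normed_vector"
  assumes "open U" "g ` U \<subseteq> V" "Ck_on k U g" "Ck_on k V f"
  shows "Ck_on k U (\<lambda>x. f (g x))"
  using assms(3,4)
proof (induction k arbitrary: f)
  case 0
  then show ?case using assms(2) continuous_on_compose2 by auto
next
  case (Suc k)
  have dg: "g differentiable (at x)" and df: "f differentiable (at (g x))" if "x \<in> U" for x
    using that Suc.prems assms(2) by auto
  have "Ck_on k U (\<lambda>x. fd (\<lambda>x. f (g x)) x v) \<longleftrightarrow> Ck_on k U (\<lambda>x. fd f (g x) (fd g x v))" for v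
    by (rule Ck_on_cong[OF assms(1)]) (simp add: fd_compose dg df)
  moreover have "Ck_on k U (\<lambda>x. fd f (g x) (fd g x v))" for v
  proof (rule Ck_on_linear_app[OF assms(1), where L = "\<lambda>x. fd f (g x)"])
    show "linear (fd f (g x))" if "x \<in> U" for x
      by (rule linear_frechet_derivative[OF df[OF that]])
    show "Ck_on k U (\<lambda>x. fd f (g x) a)" for a
      by (rule Suc.IH[OF Ck_on_Suc_imp[OF Suc.prems(1)]]) (use Suc.prems(2) in simp)
    show "Ck_on k U (\<lambda>x. fd g x v)"
      using Suc.prems(1) by simp
  qed
  moreover have "(\<lambda>x. f (g x)) differentiable (at x)" if "x \<in> U" for x
    using differentiable_chain_at[OF dg[OF that] df[OF that]] by (simp add: o_def)
  ultimately show ?case by simp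
qed

lemma smooth_on_cong:
  "open U \<Longrightarrow> (\<And>y. y \<in> U \<Longrightarrow> f y = h y) \<Longrightarrow> smooth_on U f \<longleftrightarrow> smooth_on U h"
  unfolding smooth_on_def using Ck_on_cong by blast

lemma smooth_on_subset: "smooth_on U f \<Longrightarrow> V \<subseteq> U \<Longrightarrow> smooth_on V f"
  unfolding smooth_on_def using Ck_on_subset by blast

lemma smooth_on_differentiable: "smooth_on U f \<Longrightarrow> x \<in> U \<Longrightarrow> f differentiable (at x)"
  unfolding smooth_on_def using Ck_on.simps(2) by blast

lemma smooth_on_has_derivative: "smooth_on U f \<Longrightarrow> x \<in> U \<Longrightarrow> (f has_derivative fd f x) (at x)"
  by (intro has_derivative_fd smooth_on_differentiable)

lemma smooth_on_linear_fd: "smooth_on U f \<Longrightarrow> x \<in> U \<Longrightarrow> linear (fd f x)"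
  by (intro linear_frechet_derivative smooth_on_differentiable)

lemma smooth_on_fd: "smooth_on U f \<Longrightarrow> smooth_on U (\<lambda>x. fd f x v)"
  unfolding smooth_on_def using Ck_on.simps(2) by blast

lemma smooth_on_const: "smooth_on U (\<lambda>x. a)"
  unfolding smooth_on_def using Ck_on_const by blast

lemma smooth_on_ident: "open U \<Longrightarrow> smooth_on U (\<lambda>x. x)"
  unfolding smooth_on_def using Ck_on_bounded_linear bounded_linear_ident by blast

lemma smooth_on_add: "open U \<Longrightarrow> smooth_on U f \<Longrightarrow> smooth_on U h \<Longrightarrow> smooth_on U (\<lambda>x. f x + h x)"
  unfolding smooth_on_def using Ck_on_add by blast

lemma smooth_on_scaleR: "open U \<Longrightarrow> smooth_on U f \<Longrightarrow> smooth_on U (\<lambda>x. a *\<^sub>R f x)"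
  unfolding smooth_on_def
  using Ck_on_bounded_bilinear[OF bounded_bilinear_scaleR _ Ck_on_const, of U _ f a] by blast

lemma smooth_on_sum:
  "open U \<Longrightarrow> finite I \<Longrightarrow> (\<And>i. i \<in> I \<Longrightarrow> smooth_on U (f i)) \<Longrightarrow> smooth_on U (\<lambda>x. \<Sum>i\<in>I. f i x)"
  unfolding smooth_on_def by (blast intro: Ck_on_sum)

lemma smooth_on_inner_right: "open U \<Longrightarrow> smooth_on U f \<Longrightarrow> smooth_on U (\<lambda>x. f x \<bullet> b)"
  unfolding smooth_on_def using Ck_on_inner_right by blast

lemma smooth_on_linear_app:
  fixes L :: "'a::real_normed_vector \<Rightarrow> 'b::euclidean_space \<Rightarrow> 'c::real_normed_vector"
  assumes "open U" "\<And>x. x \<in> U \<Longrightarrow> linear (L x)" "\<And>a. smooth_on U (\<lambda>x. L x a)" "smooth_on U h"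
  shows "smooth_on U (\<lambda>x. L x (h x))"
  using assms Ck_on_linear_app[of U L _ h] unfolding smooth_on_def by blast

lemma smooth_on_bilinear_app:
  fixes L :: "'a::real_normed_vector \<Rightarrow> 'b::euclidean_space \<Rightarrow> 'c::euclidean_space \<Rightarrow> 'd::real_normed_vector"
  assumes "open U" "\<And>x. x \<in> U \<Longrightarrow> bilinear (L x)" "\<And>a b. smooth_on U (\<lambda>x. L x a b)"
    "smooth_on U h" "smooth_on U k"
  shows "smooth_on U (\<lambda>x. L x (h x) (k x))"
proof (rule smooth_on_linear_app[OF assms(1) _ _ assms(5)])
  show "linear (L x (h x))" if "x \<in> U" for x
    using assms(2)[OF that] by (simp add: bilinear_def)
  show "smooth_on U (\<lambda>x. L x (h x) b)" for b
    by (rule smooth_on_linear_app[OF assms(1) _ _ assms(4), where L = "\<lambda>x a. L x a b"])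
       (use assms(2,3) in \<open>auto simp: bilinear_def\<close>)
qed

lemma smooth_on_compose:
  fixes g :: "'a::real_normed_vector \<Rightarrow> 'b::euclidean_space" and f :: "'b \<Rightarrow> 'c::real_normed_vector"
  assumes "open U" "g ` U \<subseteq> V" "smooth_on U g" "smooth_on V f"
  shows "smooth_on U (\<lambda>x. f (g x))"
  using assms Ck_on_compose unfolding smooth_on_def by blast

lemma smooth_on_fd_app:
  fixes f :: "'a::euclidean_space \<Rightarrow> 'b::real_normed_vector"
  assumes "open U" "smooth_on U f" "smooth_on U h"
  shows "smooth_on U (\<lambda>x. fd f x (h x))"
  by (rule smooth_on_linear_app[OF assms(1) smooth_on_linear_fd[OF assms(2)] smooth_on_fd[OF assms(2)] assms(3)])

text \<open>A product rule for a family of linear maps whose derivative is known only vector by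
  vector, again through a basis expansion. It later differentiates metrics, Christoffel symbols and
  transition derivatives applied to varying vectors.\<close>

lemma has_derivative_linear_app:
  fixes L :: "'a::real_normed_vector \<Rightarrow> 'b::euclidean_space \<Rightarrow> 'c::real_normed_vector"
  assumes "open U" "x \<in> U" "\<And>y. y \<in> U \<Longrightarrow> linear (L y)"
    and L: "\<And>a. ((\<lambda>y. L y a) has_derivative L' a) (at x)" and h: "(h has_derivative h') (at x)"
  shows "((\<lambda>y. L y (h y)) has_derivative (\<lambda>v. L' (h x) v + L x (h' v))) (at x)"
proof -
  have expand: "L y v = (\<Sum>b\<in>Basis. (v \<bullet> b) *\<^sub>R L y b)" if "y \<in> U" for y v
    by (rule linear_basis_expansion[OF assms(3)[OF that]])
  \<comment> \<open>\<open>L'\<close> is given separately for each \<open>a\<close>; uniqueness of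
    derivatives forces it to depend linearly on \<open>a\<close>.\<close>
  have L': "L' a v = (\<Sum>b\<in>Basis. (a \<bullet> b) *\<^sub>R L' b v)" for a v
  proof -
    have "((\<lambda>y. \<Sum>b\<in>Basis. (a \<bullet> b) *\<^sub>R L y b) has_derivative (\<lambda>v. \<Sum>b\<in>Basis. (a \<bullet> b) *\<^sub>R L' b v)) (at x)"
      by (intro has_derivative_sum has_derivative_scaleR_right L)
    then have "((\<lambda>y. L y a) has_derivative (\<lambda>v. \<Sum>b\<in>Basis. (a \<bullet> b) *\<^sub>R L' b v)) (at x)"
      using has_derivative_cong_open[OF assms(1,2) expand] by (rule iffD2[rotated])
    then show ?thesis using has_derivative_unique[OF L] by metis
  qed
  have "((\<lambda>y. \<Sum>b\<in>Basis. (h y \<bullet> b) *\<^sub>R L y b) has_derivative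
     (\<lambda>v. \<Sum>b\<in>Basis. (h x \<bullet> b) *\<^sub>R L' b v + (h' v \<bullet> b) *\<^sub>R L x b)) (at x)"
    by (intro has_derivative_sum has_derivative_scaleR has_derivative_inner_left L h)
  moreover have "(\<Sum>b\<in>Basis. (h x \<bullet> b) *\<^sub>R L' b v + (h' v \<bullet> b) *\<^sub>R L x b) = L' (h x) v + L x (h' v)" for v
    using linear_basis_expansion[OF assms(3)[OF assms(2)], of "h' v"] L'[of "h x" v]
    by (simp add: sum.distrib)
  ultimately have "((\<lambda>y. \<Sum>b\<in>Basis. (h y \<bullet> b) *\<^sub>R L y b) has_derivative (\<lambda>v. L' (h x) v + L x (h' v))) (at x)"
    by simp
  then show ?thesis
    using has_derivative_cong_open[OF assms(1,2) expand] by (rule iffD2[rotated])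
qed

lemma has_derivative_bilinear_app:
  fixes L :: "'a::real_normed_vector \<Rightarrow> 'b::euclidean_space \<Rightarrow> 'c::euclidean_space \<Rightarrow> 'd::real_normed_vector"
  assumes "open U" "x \<in> U" "\<And>y. y \<in> U \<Longrightarrow> bilinear (L y)"
    and L: "\<And>a b. ((\<lambda>y. L y a b) has_derivative L' a b) (at x)"
    and h: "(h has_derivative h') (at x)" and k: "(k has_derivative k') (at x)"
  shows "((\<lambda>y. L y (h y) (k y)) has_derivative
    (\<lambda>v. L' (h x) (k x) v + L x (h' v) (k x) + L x (h x) (k' v))) (at x)"
proof (rule has_derivative_linear_app[OF assms(1,2) _ _ k, where L = "\<lambda>y. L y (h y)"])
  show "linear (L y (h y))" if "y \<in> U" for y
    using assms(3)[OF that] by (simp add: bilinear_def)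
  show "((\<lambda>y. L y (h y) b) has_derivative (\<lambda>v. L' (h x) b v + L x (h' v) b)) (at x)" for b
    by (rule has_derivative_linear_app[OF assms(1,2) _ _ h, where L = "\<lambda>y a. L y a b"])
      (use L assms(3) in \<open>auto simp: bilinear_def\<close>)
qed

section \<open>Symmetry of second derivatives\<close>

lemma double_difference_mvt:
  fixes f :: "'a::euclidean_space \<Rightarrow> real"
  assumes "open U" "smooth_on U f" "0 < h"
    and in_U: "\<And>s t. 0 \<le> s \<Longrightarrow> s \<le> h \<Longrightarrow> 0 \<le> t \<Longrightarrow> t \<le> h \<Longrightarrow> x + s *\<^sub>R u + t *\<^sub>R v \<in> U"
  shows "\<exists>s t. 0 \<le> s \<and> s \<le> h \<and> 0 \<le> t \<and> t \<le> h \<and>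
    f (x + h *\<^sub>R u + h *\<^sub>R v) - f (x + h *\<^sub>R u) - f (x + h *\<^sub>R v) + f x
      = h * (h * fd (\<lambda>y. fd f y u) (x + s *\<^sub>R u + t *\<^sub>R v) v)"
proof -
  have deriv_line: "((\<lambda>s. k (a + s *\<^sub>R w)) has_real_derivative fd k (a + s *\<^sub>R w) w) (at s)"
    if "smooth_on U k" "a + s *\<^sub>R w \<in> U" for k :: "'a \<Rightarrow> real" and a w s
  proof -
    have "((\<lambda>s. k (a + s *\<^sub>R w)) has_derivative (\<lambda>r. fd k (a + s *\<^sub>R w) (r *\<^sub>R w))) (at s)"
      by (rule has_derivative_compose[where f = "\<lambda>s. a + s *\<^sub>R w"])
        (auto intro!: derivative_eq_intros smooth_on_has_derivative[OF that])
    then show ?thesis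
      using linear_scale[OF smooth_on_linear_fd[OF that]]
      by (simp add: has_field_derivative_def mult_commute_abs)
  qed
  \<comment> \<open>The difference across the side \<open>v\<close>, as a function of the step along
    \<open>u\<close>. The mean value theorem for it yields a derivative along \<open>u\<close>, and
    a second application along \<open>v\<close> the mixed one.\<close>
  define \<phi> where "\<phi> s = f (x + h *\<^sub>R v + s *\<^sub>R u) - f (x + s *\<^sub>R u)" for s
  have "DERIV \<phi> s :> fd f (x + h *\<^sub>R v + s *\<^sub>R u) u - fd f (x + s *\<^sub>R u) u" if "0 \<le> s" "s \<le> h" for s
    unfolding \<phi>_def using that assms(2,3) in_U[of s h] in_U[of s 0]
    by (intro DERIV_diff deriv_line) (auto simp: algebra_simps)
  then obtain s where s: "0 < s" "s < h"
    and "\<phi> h - \<phi> 0 = (h - 0) * (fd f (x + h *\<^sub>R v + s *\<^sub>R u) u - fd f (x + s *\<^sub>R u) u)"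
    using MVT2[OF assms(3), of \<phi> "\<lambda>s. fd f (x + h *\<^sub>R v + s *\<^sub>R u) u - fd f (x + s *\<^sub>R u) u"] by blast
  moreover have "DERIV (\<lambda>t. fd f (x + s *\<^sub>R u + t *\<^sub>R v) u) t :> fd (\<lambda>y. fd f y u) (x + s *\<^sub>R u + t *\<^sub>R v) v"
    if "0 \<le> t" "t \<le> h" for t
    using that s in_U[of s t] deriv_line[OF smooth_on_fd[OF assms(2)]] by auto
  then obtain t where t: "0 < t" "t < h"
    and "fd f (x + s *\<^sub>R u + h *\<^sub>R v) u - fd f (x + s *\<^sub>R u + 0 *\<^sub>R v) u
      = (h - 0) * fd (\<lambda>y. fd f y u) (x + s *\<^sub>R u + t *\<^sub>R v) v"
    using MVT2[OF assms(3), of "\<lambda>t. fd f (x + s *\<^sub>R u + t *\<^sub>R v) u"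
      "\<lambda>t. fd (\<lambda>y. fd f y u) (x + s *\<^sub>R u + t *\<^sub>R v) v"] by blast
  ultimately show ?thesis
    unfolding \<phi>_def by (intro exI[of _ s] exI[of _ t]) (simp add: algebra_simps)
qed

text \<open>The second difference over a parallelogram is symmetric in its sides, and it equals h^2
  times either mixed derivative at some point of the parallelogram. Were the two derivatives
  different at \<open>x\<close>, continuity would separate them on a small parallelogram.\<close>

lemma fd_commute_real:
  fixes f :: "'a::euclidean_space \<Rightarrow> real"
  assumes "open U" "smooth_on U f" "x \<in> U"
  shows "fd (\<lambda>y. fd f y u) x v = fd (\<lambda>y. fd f y v) x u"
proof (rule ccontr)
  define P where "P = (\<lambda>y. fd (\<lambda>y. fd f y u) y v)"
  define Q where "Q = (\<lambda>y. fd (\<lambda>y. fd f y v) y u)"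
  assume "\<not> ?thesis"
  then have e: "\<bar>P x - Q x\<bar> / 2 > 0" by (simp add: P_def Q_def)
  have sm: "smooth_on U P" "smooth_on U Q"
    unfolding P_def Q_def using assms by (auto intro: smooth_on_fd)
  then have "isCont P x" "isCont Q x"
    using assms smooth_on_differentiable differentiable_imp_continuous_within by blast+
  then obtain d1 d2 where d1: "d1 > 0" "\<And>y. dist y x < d1 \<Longrightarrow> dist (P y) (P x) < \<bar>P x - Q x\<bar> / 2"
    and d2: "d2 > 0" "\<And>y. dist y x < d2 \<Longrightarrow> dist (Q y) (Q x) < \<bar>P x - Q x\<bar> / 2"
    using e unfolding continuous_at_eps_delta by (metis dist_commute)
  obtain d3 where d3: "d3 > 0" "\<And>y. dist y x < d3 \<Longrightarrow> y \<in> U"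
    using assms(1,3) by (metis open_dist)
  define d where "d = min d1 (min d2 d3)"
  \<comment> \<open>This keeps the whole parallelogram within distance d/2 of \<open>x\<close>; the
    summand 1 keeps the denominator positive when \<open>u\<close> and \<open>v\<close> both
    vanish.\<close>
  define h where "h = d / (2 * (norm u + norm v + 1))"
  have pos: "norm u + norm v + 1 > 0" by (simp add: add_nonneg_pos)
  have d: "d > 0" and h: "h > 0" using d1 d2 d3 pos by (auto simp: d_def h_def)
  have near: "dist (x + s *\<^sub>R u + t *\<^sub>R v) x < d"
    if "0 \<le> s" "s \<le> h" "0 \<le> t" "t \<le> h" for s t
  proof -
    have "norm (s *\<^sub>R u + t *\<^sub>R v) \<le> s * norm u + t * norm v"
      using norm_triangle_ineq[of "s *\<^sub>R u" "t *\<^sub>R v"] that by simp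
    also have "\<dots> \<le> h * norm u + h * norm v"
      using that by (intro add_mono mult_right_mono) auto
    also have "\<dots> \<le> h * (norm u + norm v + 1)" using h by (simp add: algebra_simps)
    also have "\<dots> = d / 2" using pos nonzero_mult_divide_mult_cancel_right[of "norm u + norm v + 1" d 2]
      unfolding h_def times_divide_eq_left by linarith
    also have "\<dots> < d" using d by simp
    finally show ?thesis by (simp add: dist_norm add.assoc)
  qed
  have near': "dist (x + s *\<^sub>R v + t *\<^sub>R u) x < d"
    if "0 \<le> s" "s \<le> h" "0 \<le> t" "t \<le> h" for s t
    using near[of t s] that by (simp add: algebra_simps)
  obtain s t where st: "0 \<le> s" "s \<le> h" "0 \<le> t" "t \<le> h"
    "f (x + h *\<^sub>R u + h *\<^sub>R v) - f (x + h *\<^sub>R u) - f (x + h *\<^sub>R v) + f x = h * (h * P (x + s *\<^sub>R u + t *\<^sub>R v))"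
    using double_difference_mvt[OF assms(1,2) h, of x u v] near d3 unfolding P_def d_def by fastforce
  obtain s' t' where st': "0 \<le> s'" "s' \<le> h" "0 \<le> t'" "t' \<le> h"
    "f (x + h *\<^sub>R v + h *\<^sub>R u) - f (x + h *\<^sub>R v) - f (x + h *\<^sub>R u) + f x = h * (h * Q (x + s' *\<^sub>R v + t' *\<^sub>R u))"
    using double_difference_mvt[OF assms(1,2) h, of x v u] near' d3 unfolding Q_def d_def by fastforce
  have "h * (h * P (x + s *\<^sub>R u + t *\<^sub>R v)) = h * (h * Q (x + s' *\<^sub>R v + t' *\<^sub>R u))"
    using st(5) st'(5) by (simp add: algebra_simps)
  then have "P (x + s *\<^sub>R u + t *\<^sub>R v) = Q (x + s' *\<^sub>R v + t' *\<^sub>R u)" using h by simp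
  moreover have "dist (P (x + s *\<^sub>R u + t *\<^sub>R v)) (P x) < \<bar>P x - Q x\<bar> / 2"
    using d1 near[OF st(1-4)] by (simp add: d_def)
  moreover have "dist (Q (x + s' *\<^sub>R v + t' *\<^sub>R u)) (Q x) < \<bar>P x - Q x\<bar> / 2"
    using d2 near'[OF st'(1-4)] by (simp add: d_def)
  moreover have "\<bar>p - q\<bar> \<le> \<bar>a - p\<bar> + \<bar>a - q\<bar>" for a p q :: real by linarith
  ultimately show False unfolding dist_real_def by (metis add_less_le_mono field_sum_of_halves leD less_imp_le)
qed

lemma fd_commute:
  fixes f :: "'a::euclidean_space \<Rightarrow> 'b::euclidean_space"
  assumes "open U" "smooth_on U f" "x \<in> U"
  shows "fd (\<lambda>y. fd f y u) x v = fd (\<lambda>y. fd f y v) x u"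
proof (rule euclidean_eqI)
  fix b :: 'b assume "b \<in> Basis"
  have comp: "fd (\<lambda>y. k y \<bullet> b) y w = fd k y w \<bullet> b" if "smooth_on U k" "y \<in> U" for k :: "'a \<Rightarrow> 'b" and y w
    by (subst fd_eqI[OF has_derivative_inner_left[OF smooth_on_has_derivative[OF that]]]) simp
  have comp2: "fd (\<lambda>y. fd (\<lambda>y. f y \<bullet> b) y u) x v = fd (\<lambda>y. fd f y u) x v \<bullet> b" for u v
  proof -
    have "fd (\<lambda>y. fd (\<lambda>y. f y \<bullet> b) y u) x = fd (\<lambda>y. fd f y u \<bullet> b) x"
      by (rule fd_cong_open[OF assms(1,3)]) (rule comp[OF assms(2)])
    then show ?thesis using comp[OF smooth_on_fd[OF assms(2)] assms(3)] by simp
  qed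
  show "fd (\<lambda>y. fd f y u) x v \<bullet> b = fd (\<lambda>y. fd f y v) x u \<bullet> b"
    using fd_commute_real[OF assms(1) smooth_on_inner_right[OF assms(1,2)] assms(3), of b u v]
    by (simp add: comp2)
qed

section \<open>Covariant differentiation in coordinates\<close>

text \<open>Smoothness is asked for fixed arguments, as in \<open>linear_connection\<close>; in
  finite dimension this controls the whole family. The instances are the Christoffel symbols and the
  metric in a chart.\<close>

definition smooth_bilinear ::
  "'e::euclidean_space set \<Rightarrow> ('e \<Rightarrow> 'a::euclidean_space \<Rightarrow> 'b::euclidean_space \<Rightarrow> 'c::euclidean_space) \<Rightarrow> bool" where
  "smooth_bilinear Q C \<longleftrightarrow> open Q \<and> (\<forall>y\<in>Q. bilinear (C y)) \<and> (\<forall>a b. smooth_on Q (\<lambda>y. C y a b))"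

lemma smooth_on_bilinear_along:
  fixes F :: "'d::euclidean_space \<Rightarrow> 'e::euclidean_space"
  assumes "smooth_bilinear Q C" "open W" "smooth_on W F" "F ` W \<subseteq> Q" "smooth_on W h" "smooth_on W k"
  shows "smooth_on W (\<lambda>y. C (F y) (h y) (k y))"
proof (rule smooth_on_bilinear_app[OF assms(2) _ _ assms(5,6), where L = "\<lambda>y. C (F y)"])
  show "bilinear (C (F y))" if "y \<in> W" for y
    using that assms(1,4) by (auto simp: smooth_bilinear_def)
  show "smooth_on W (\<lambda>y. C (F y) a b)" for a b
    by (rule smooth_on_compose[OF assms(2,4,3)]) (use assms(1) in \<open>simp add: smooth_bilinear_def\<close>)
qed

lemma has_derivative_bilinear_along:
  fixes F :: "'d::euclidean_space \<Rightarrow> 'e::euclidean_space"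
  assumes C: "smooth_bilinear Q C" and W: "open W" "x \<in> W" and F: "smooth_on W F" "F ` W \<subseteq> Q"
    and "smooth_on W h" "smooth_on W k"
  shows "((\<lambda>y. C (F y) (h y) (k y)) has_derivative
    (\<lambda>v. fd (\<lambda>z. C z (h x) (k x)) (F x) (fd F x v) + C (F x) (fd h x v) (k x) + C (F x) (h x) (fd k x v))) (at x)"
proof (rule has_derivative_bilinear_app[OF W, where L = "\<lambda>y. C (F y)"])
  show "bilinear (C (F y))" if "y \<in> W" for y
    using that C F by (auto simp: smooth_bilinear_def)
  show "((\<lambda>y. C (F y) a b) has_derivative (\<lambda>v. fd (\<lambda>z. C z a b) (F x) (fd F x v))) (at x)" for a b
  proof (rule has_derivative_compose[where f = F])
    show "(F has_derivative fd F x) (at x)" by (rule smooth_on_has_derivative[OF F(1) W(2)])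
    show "((\<lambda>z. C z a b) has_derivative fd (\<lambda>z. C z a b) (F x)) (at (F x))"
      by (rule smooth_on_has_derivative[of Q]) (use C F W in \<open>auto simp: smooth_bilinear_def\<close>)
  qed
qed (use assms in \<open>auto intro: smooth_on_has_derivative\<close>)

lemma has_derivative_fd_app:
  fixes V :: "'d::euclidean_space \<Rightarrow> 'e::euclidean_space"
  assumes "open W" "x \<in> W" "smooth_on W V" "smooth_on W Y"
  shows "((\<lambda>y. fd V y (Y y)) has_derivative (\<lambda>v. fd (\<lambda>y. fd V y (Y x)) x v + fd V x (fd Y x v))) (at x)"
  by (rule has_derivative_linear_app[OF assms(1,2), where L = "\<lambda>y. fd V y"])
    (use assms in \<open>auto intro: smooth_on_has_derivative smooth_on_fd smooth_on_linear_fd\<close>)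

text \<open>\<open>C y u v\<close> stands for the Christoffel symbols of a connection at the coordinate point \<open>y\<close>;
  \<open>cd\<close> is the induced covariant derivative of a section \<open>V\<close> along \<open>F\<close>.\<close>

definition cd ::
  "('e \<Rightarrow> 'e \<Rightarrow> 'e \<Rightarrow> 'e) \<Rightarrow> ('d::euclidean_space \<Rightarrow> 'e::euclidean_space) \<Rightarrow> ('d \<Rightarrow> 'e) \<Rightarrow> 'd \<Rightarrow> 'd \<Rightarrow> 'e" where
  "cd C F V x v = fd V x v + C (F x) (fd F x v) (V x)"

text \<open>The classical expression of the Riemann tensor R(u, v) w by Christoffel symbols: the
  commutator of covariant derivatives on fields with constant coordinates, whose bracket
  vanishes.\<close>

definition curv :: "('e \<Rightarrow> 'e \<Rightarrow> 'e \<Rightarrow> 'e) \<Rightarrow> 'e \<Rightarrow> 'e \<Rightarrow> 'e \<Rightarrow> 'e \<Rightarrow> 'e::euclidean_space" where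
  "curv C y u v w = fd (\<lambda>z. C z v w) y u - fd (\<lambda>z. C z u w) y v + C y u (C y v w) - C y v (C y u w)"

lemma cd_cong:
  assumes "open W" "x \<in> W" "\<And>y. y \<in> W \<Longrightarrow> F y = F' y" "\<And>y. y \<in> W \<Longrightarrow> V y = V' y"
  shows "cd C F V x = cd C F' V' x"
  using assms fd_cong_open[OF assms(1,2), of F F'] fd_cong_open[OF assms(1,2), of V V']
  by (auto simp: cd_def)

lemma linear_cd:
  assumes "smooth_bilinear Q C" "F ` W \<subseteq> Q" "smooth_on W F" "smooth_on W V" "x \<in> W"
  shows "linear (cd C F V x)"
proof -
  have "bilinear (C (F x))" using assms by (auto simp: smooth_bilinear_def)
  then have "linear (\<lambda>v. C (F x) (fd F x v) (V x))"
    using linear_compose[OF smooth_on_linear_fd[OF assms(3,5)]] by (auto simp: bilinear_def o_def)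
  then show ?thesis unfolding cd_def
    by (intro linear_compose_add smooth_on_linear_fd[OF assms(4,5)])
qed

lemma smooth_on_cd:
  assumes "smooth_bilinear Q C" "F ` W \<subseteq> Q" "open W" "smooth_on W F" "smooth_on W V" "smooth_on W Y"
  shows "smooth_on W (\<lambda>y. cd C F V y (Y y))"
  unfolding cd_def using assms
  by (intro smooth_on_add smooth_on_fd_app smooth_on_bilinear_along[OF assms(1)])

text \<open>Freezing \<open>Y x\<close> inside the inner derivatives leaves the second derivatives
  of \<open>V\<close> and \<open>F\<close> in the form to which \<open>fd_commute\<close>
  applies.\<close>

lemma fd_cd:
  assumes C: "smooth_bilinear Q C" "F ` W \<subseteq> Q" and W: "open W" "x \<in> W"
    and sm: "smooth_on W F" "smooth_on W V" "smooth_on W Y"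
  shows "fd (\<lambda>y. cd C F V y (Y y)) x v =
    fd (\<lambda>y. fd V y (Y x)) x v + fd V x (fd Y x v)
    + fd (\<lambda>z. C z (fd F x (Y x)) (V x)) (F x) (fd F x v)
    + C (F x) (fd (\<lambda>y. fd F y (Y x)) x v + fd F x (fd Y x v)) (V x)
    + C (F x) (fd F x (Y x)) (fd V x v)"
proof -
  have "fd (\<lambda>y. fd F y (Y y)) x v = fd (\<lambda>y. fd F y (Y x)) x v + fd F x (fd Y x v)"
    by (simp add: fd_eqI[OF has_derivative_fd_app[OF W sm(1,3)]])
  then show ?thesis
    unfolding cd_def
    using fd_eqI[OF has_derivative_add[OF has_derivative_fd_app[OF W sm(2,3)]
        has_derivative_bilinear_along[OF C(1) W sm(1) C(2) smooth_on_fd_app[OF W(1) sm(1,3)] sm(2)]]]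
    by (simp add: add.assoc)
qed

text \<open>The curvature of a pulled back connection is the pullback of the curvature tensor.
  Second derivatives of \<open>F\<close> and \<open>V\<close> are symmetric and cancel, and the
  derivatives of \<open>X\<close> and \<open>Y\<close> make up the bracket term. With
  \<open>F\<close> the identity this computes the ambient curvature, with \<open>F\<close> an
  immersion in coordinates the curvature along a submanifold.\<close>

lemma curv_along:
  assumes C: "smooth_bilinear Q C" "F ` W \<subseteq> Q" and W: "open W" "x \<in> W"
    and sm: "smooth_on W F" "smooth_on W V" "smooth_on W X" "smooth_on W Y"
  shows "cd C F (\<lambda>y. cd C F V y (Y y)) x (X x) - cd C F (\<lambda>y. cd C F V y (X y)) x (Y x)
      - cd C F V x (fd Y x (X x) - fd X x (Y x))
    = curv C (F x) (fd F x (X x)) (fd F x (Y x)) (V x)"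
proof -
  note bil = C(1)[unfolded smooth_bilinear_def, THEN conjunct2, THEN conjunct1, rule_format, of "F x"]
  have "bilinear (C (F x))" using bil C(2) W(2) by auto
  note simps = bilinear_ladd[OF this] bilinear_radd[OF this] bilinear_lsub[OF this]
  note lin = linear_diff[OF smooth_on_linear_fd[OF sm(1) W(2)]] linear_diff[OF smooth_on_linear_fd[OF sm(2) W(2)]]
  show ?thesis
    using fd_commute[OF W(1) sm(1) W(2), of "X x" "Y x"] fd_commute[OF W(1) sm(2) W(2), of "X x" "Y x"]
    unfolding cd_def[of C F "\<lambda>y. cd C F V y (Y y)" x] cd_def[of C F "\<lambda>y. cd C F V y (X y)" x]
      fd_cd[OF C W sm(1,2,3)] fd_cd[OF C W sm(1,2,4)] cd_def[of C F V x] curv_def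
    by (simp add: simps lin algebra_simps)
qed

section \<open>Symmetries of the coordinate curvature tensor\<close>

lemma curv_swap: "curv C y u v w = - curv C y v u w"
  by (simp add: curv_def)

lemma bilinear_fd_smooth_bilinear:
  assumes C: "smooth_bilinear Q C" "y \<in> Q"
  shows "bilinear (\<lambda>a b. fd (\<lambda>z. C z a b) y u)"
proof -
  have bil: "bilinear (C z)" if "z \<in> Q" for z
    using C(1) that by (simp add: smooth_bilinear_def)
  have Q: "open Q" using C(1) by (simp add: smooth_bilinear_def)
  have der: "((\<lambda>z. C z a b) has_derivative fd (\<lambda>z. C z a b) y) (at y)" for a b
    by (rule smooth_on_has_derivative[OF _ C(2)]) (use C(1) in \<open>simp add: smooth_bilinear_def\<close>)
  have "fd (\<lambda>z. C z (a + a') b) y = (\<lambda>u. fd (\<lambda>z. C z a b) y u + fd (\<lambda>z. C z a' b) y u)" for a a' b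
    by (rule trans[OF fd_cong_open[OF Q C(2) bilinear_ladd[OF bil]] fd_eqI[OF has_derivative_add[OF der der]]])
  moreover have "fd (\<lambda>z. C z a (b + b')) y = (\<lambda>u. fd (\<lambda>z. C z a b) y u + fd (\<lambda>z. C z a b') y u)" for a b b'
    by (rule trans[OF fd_cong_open[OF Q C(2) bilinear_radd[OF bil]] fd_eqI[OF has_derivative_add[OF der der]]])
  moreover have "fd (\<lambda>z. C z (r *\<^sub>R a) b) y = (\<lambda>u. r *\<^sub>R fd (\<lambda>z. C z a b) y u)" for a b r
    by (rule trans[OF fd_cong_open[OF Q C(2) bilinear_lmul[OF bil]] fd_eqI[OF has_derivative_scaleR_right[OF der]]])
  moreover have "fd (\<lambda>z. C z a (r *\<^sub>R b)) y = (\<lambda>u. r *\<^sub>R fd (\<lambda>z. C z a b) y u)" for a b r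
    by (rule trans[OF fd_cong_open[OF Q C(2) bilinear_rmul[OF bil]] fd_eqI[OF has_derivative_scaleR_right[OF der]]])
  ultimately show ?thesis by (simp add: bilinear_def linear_iff)
qed

lemma linear_curv:
  assumes C: "smooth_bilinear Q C" "y \<in> Q"
  shows "linear (\<lambda>u. curv C y u v w)" "linear (\<lambda>v. curv C y u v w)" "linear (\<lambda>w. curv C y u v w)"
proof -
  have bil: "bilinear (C y)" using C by (simp add: smooth_bilinear_def)
  have lin: "linear (fd (\<lambda>z. C z a b) y)" for a b
    by (rule smooth_on_linear_fd[OF _ C(2)]) (use C(1) in \<open>simp add: smooth_bilinear_def\<close>)
  note bil' = bilinear_fd_smooth_bilinear[OF C]
  note simps = curv_def algebra_simps scaleR_right_diff_distrib
    bilinear_ladd[OF bil] bilinear_radd[OF bil] bilinear_lmul[OF bil] bilinear_rmul[OF bil]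
    bilinear_ladd[OF bil'] bilinear_radd[OF bil'] bilinear_lmul[OF bil'] bilinear_rmul[OF bil']
    linear_add[OF lin] linear_scale[OF lin]
  show "linear (\<lambda>u. curv C y u v w)" "linear (\<lambda>v. curv C y u v w)" "linear (\<lambda>w. curv C y u v w)"
    by (rule linearI; simp add: simps)+
qed

text \<open>Symmetry of the Christoffel symbols, that is vanishing torsion, pairs each term of the
  cyclic sum with an opposite one.\<close>

lemma curv_bianchi:
  assumes C: "smooth_bilinear Q C" "y \<in> Q" and sym: "\<And>z a b. z \<in> Q \<Longrightarrow> C z a b = C z b a"
  shows "curv C y u v w + curv C y v w u + curv C y w u v = 0"
proof -
  have fd_sym: "fd (\<lambda>z. C z a b) y = fd (\<lambda>z. C z b a) y" for a b
    by (rule fd_cong_open[of Q]) (use C sym in \<open>auto simp: smooth_bilinear_def\<close>)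
  then show ?thesis
    unfolding curv_def sym[OF C(2), of v w] sym[OF C(2), of w u] sym[OF C(2), of u v]
      fd_sym[of v w] fd_sym[of w u] fd_sym[of u v] by simp
qed

text \<open>By the chain rule the metric is differentiated at \<open>F x\<close> in direction
  \<open>fd F x v\<close>, where \<open>compat\<close> supplies exactly the Christoffel terms of the
  two covariant derivatives.\<close>

lemma metric_along:
  assumes C: "smooth_bilinear Q C" "F ` W \<subseteq> Q" and G: "smooth_bilinear Q G"
    and compat: "\<And>y a b w. y \<in> Q \<Longrightarrow> fd (\<lambda>z. G z a b) y w = G y (C y w a) b + G y a (C y w b)"
    and W: "open W" "x \<in> W" and sm: "smooth_on W F" "smooth_on W V" "smooth_on W N"
  shows "fd (\<lambda>y. G (F y) (V y) (N y)) x v = G (F x) (cd C F V x v) (N x) + G (F x) (V x) (cd C F N x v)"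
proof -
  have F: "F x \<in> Q" using C(2) W(2) by auto
  have "bilinear (G (F x))" using G F by (simp add: smooth_bilinear_def)
  then show ?thesis
    by (simp add: fd_eqI[OF has_derivative_bilinear_along[OF G W sm(1) C(2) sm(2,3)]] compat[OF F] cd_def
      bilinear_ladd bilinear_radd)
qed

text \<open>The second derivative of \<open>G\<close> on constant vectors is symmetric in
  \<open>u\<close> and \<open>v\<close>. Computed by applying \<open>compat\<close> twice, it
  contains the products \<open>G y (C y v a) (C y u b)\<close> and
  \<open>G y (C y u a) (C y v b)\<close>, whose sum is symmetric already; what remains of the
  antisymmetric part is the claim.\<close>

lemma curv_skew_adjoint:
  assumes C: "smooth_bilinear Q C" and G: "smooth_bilinear Q G"
    and compat: "\<And>y a b w. y \<in> Q \<Longrightarrow> fd (\<lambda>z. G z a b) y w = G y (C y w a) b + G y a (C y w b)"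
    and y: "y \<in> Q"
  shows "G y (curv C y u v a) b + G y a (curv C y u v b) = 0"
proof -
  have Q: "open Q" and bil: "bilinear (G y)" and smC: "\<And>a b. smooth_on Q (\<lambda>y. C y a b)"
    and smG: "smooth_on Q (\<lambda>y. G y a b)"
    using C G y by (auto simp: smooth_bilinear_def)
  have second: "fd (\<lambda>z. fd (\<lambda>z. G z a b) z v) y u =
     G y (fd (\<lambda>z. C z v a) y u + C y u (C y v a)) b + G y (C y v a) (C y u b)
     + (G y (C y u a) (C y v b) + G y a (fd (\<lambda>z. C z v b) y u + C y u (C y v b)))" for u v
  proof -
    have *: "fd (\<lambda>z. G z (P z) (R z)) y u =
        G y (fd P y u + C y u (P y)) (R y) + G y (P y) (fd R y u + C y u (R y))"
      "(\<lambda>z. G z (P z) (R z)) differentiable (at y)"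
      if "smooth_on Q P" "smooth_on Q R" for P R
    proof -
      note id = smooth_on_ident[OF Q]
      show "fd (\<lambda>z. G z (P z) (R z)) y u =
        G y (fd P y u + C y u (P y)) (R y) + G y (P y) (fd R y u + C y u (R y))"
        using metric_along[OF C _ G compat Q y id that, of u] by (simp add: cd_def)
      show "(\<lambda>z. G z (P z) (R z)) differentiable (at y)"
        using has_derivative_bilinear_along[OF G Q y id _ that] by (auto simp: differentiable_def)
    qed
    have "fd (\<lambda>z. fd (\<lambda>z. G z a b) z v) y u = fd (\<lambda>z. G z (C z v a) b + G z a (C z v b)) y u"
      by (simp add: fd_cong_open[OF Q y compat])
    also have "\<dots> = fd (\<lambda>z. G z (C z v a) b) y u + fd (\<lambda>z. G z a (C z v b)) y u"
      using *(2)[OF smC[of v a] smooth_on_const[of _ b]] *(2)[OF smooth_on_const[of _ a] smC[of v b]]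
      by (subst fd_eqI[OF has_derivative_add[OF has_derivative_fd has_derivative_fd]]) auto
    also have "\<dots> = G y (fd (\<lambda>z. C z v a) y u + C y u (C y v a)) b + G y (C y v a) (C y u b)
     + (G y (C y u a) (C y v b) + G y a (fd (\<lambda>z. C z v b) y u + C y u (C y v b)))"
      using *(1)[OF smC[of v a] smooth_on_const[of _ b]] *(1)[OF smooth_on_const[of _ a] smC[of v b]]
      by simp
    finally show ?thesis .
  qed
  show ?thesis
    using fd_commute[OF Q smG y, of u v] unfolding second curv_def
    by (simp add: bilinear_ladd[OF bil] bilinear_radd[OF bil] bilinear_lsub[OF bil] bilinear_rsub[OF bil] algebra_simps)
qed

text \<open>Curvature is the commutator of covariant derivatives in constant directions, and a
  parallel \<open>J\<close> commutes with each of them.\<close>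

lemma curv_commute:
  assumes C: "smooth_bilinear Q C" and lin: "\<And>y. y \<in> Q \<Longrightarrow> linear (J y)"
    and smJ: "\<And>a. smooth_on Q (\<lambda>y. J y a)"
    and parallel: "\<And>y a w. y \<in> Q \<Longrightarrow> fd (\<lambda>z. J z a) y w + C y w (J y a) = J y (C y w a)"
    and y: "y \<in> Q"
  shows "curv C y u v (J y a) = J y (curv C y u v a)"
proof -
  have Q: "open Q" and smC: "\<And>a b. smooth_on Q (\<lambda>y. C y a b)"
    using C by (auto simp: smooth_bilinear_def)
  have J_cd: "cd C (\<lambda>x. x) (\<lambda>z. J z (V z)) z w = J z (cd C (\<lambda>x. x) V z w)"
    if "smooth_on Q V" "z \<in> Q" for V z w
  proof -
    have "((\<lambda>z. J z (V z)) has_derivative (\<lambda>w. fd (\<lambda>y. J y (V z)) z w + J z (fd V z w))) (at z)"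
      by (rule has_derivative_linear_app[OF Q that(2) lin])
        (use that smJ in \<open>auto intro: smooth_on_has_derivative\<close>)
    then show ?thesis
      using parallel[OF that(2), of "V z" w]
      by (simp add: cd_def fd_eqI linear_add[OF lin[OF that(2)]])
  qed
  define D where "D w V = (\<lambda>z. cd C (\<lambda>x. x) V z w)" for w V
  have smD: "smooth_on Q (D w V)" if "smooth_on Q V" for w V
    unfolding D_def using smooth_on_cd[OF C _ Q smooth_on_ident[OF Q] that smooth_on_const] by simp
  have curv_D: "curv C y u v (V y) = D u (D v V) y - D v (D u V) y" if "smooth_on Q V" for V
    using curv_along[OF C _ Q y smooth_on_ident[OF Q] that smooth_on_const smooth_on_const, of v u]
      linear_0[OF linear_cd[OF C _ smooth_on_ident[OF Q] that y]]
    by (simp add: D_def)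
  have DD: "D w (D w' (\<lambda>z. J z a)) y = J y (D w (D w' (\<lambda>z. a)) y)" for w w'
  proof -
    have "D w (D w' (\<lambda>z. J z a)) y = D w (\<lambda>z. J z (D w' (\<lambda>z. a) z)) y"
      unfolding D_def
      by (rule cd_cong[THEN fun_cong, OF Q y]) (use J_cd[OF smooth_on_const] in auto)
    then show ?thesis using J_cd[OF smD[OF smooth_on_const] y] by (simp add: D_def)
  qed
  show ?thesis
    using curv_D[OF smJ, of a] curv_D[OF smooth_on_const, of a]
    by (simp add: DD linear_diff[OF lin[OF y]])
qed

section \<open>Linear algebra of indefinite metrics and of curvature\<close>

text \<open>The biorthogonal of a subspace is the subspace itself. The Gram operator
  \<open>L\<close>, which represents \<open>b\<close> by the Euclidean inner product, is injective
  and turns orthogonality to \<open>W\<close> under \<open>b\<close> into Euclidean orthogonality to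
  the image of \<open>W\<close>, where the statement is known.\<close>

lemma nondegenerate_double_orth:
  fixes b :: "'e::euclidean_space \<Rightarrow> 'e \<Rightarrow> real"
  assumes b: "bilinear b" "\<And>v w. b v w = b w v" "nondegenerate_on b UNIV" and "subspace W"
    and v: "\<And>n. n \<in> orth b W \<Longrightarrow> b v n = 0"
  shows "v \<in> W"
proof -
  define L where "L v = (\<Sum>i\<in>Basis. b v i *\<^sub>R i)" for v
  have L_inner: "L v \<bullet> w = b v w" for v w
  proof -
    have "b v w = (\<Sum>i\<in>Basis. (w \<bullet> i) *\<^sub>R b v i)"
      using b(1) by (intro linear_basis_expansion) (simp add: bilinear_def)
    then show ?thesis by (simp add: L_def inner_sum_left inner_commute[of w] mult.commute)
  qed
  have "linear L"
    by (rule linearI; rule vector_eq_ldot[THEN iffD1])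
      (simp_all add: L_inner inner_left_distrib inner_commute[of _ "L _"]
        inner_right_distrib bilinear_ladd[OF b(1)] bilinear_lmul[OF b(1)])
  have "inj L"
    using \<open>linear L\<close> b(3) L_inner unfolding linear_injective_0[OF \<open>linear L\<close>] nondegenerate_on_def
    by (metis UNIV_I inner_zero_left)
  have sub: "subspace (L ` W)" using \<open>linear L\<close> assms(4) by (rule linear_subspace_image)
  have "n \<in> orth b W" if "n \<in> (L ` W)\<^sup>\<bottom>" for n
    using that L_inner b(2) by (auto simp: orth_def orthogonal_comp_def orthogonal_def)
  then have "L v \<in> ((L ` W)\<^sup>\<bottom>)\<^sup>\<bottom>"
    using v L_inner by (auto simp: orthogonal_comp_def orthogonal_def inner_commute)
  then have "L v \<in> L ` W" using orthogonal_comp_self[OF sub] by simp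
  then show ?thesis using \<open>inj L\<close> by (auto dest: injD)
qed

lemma subspace_set_plus:
  assumes "subspace V" "subspace W" shows "subspace (V + W)"
proof -
  have "V + W = {x + y |x y. x \<in> V \<and> y \<in> W}" by (auto simp: set_plus_def)
  then show ?thesis using subspace_sums[OF assms] by simp
qed

lemma subspace_orth: "bilinear b \<Longrightarrow> subspace (orth b W)"
  by (simp add: subspace_def orth_def bilinear_lzero bilinear_ladd bilinear_lmul)

text \<open>A vector orthogonal to the sum lies in \<open>orth b V\<close> and in its orthogonal,
  which is \<open>V\<close>, hence is zero by nondegeneracy on \<open>V\<close>. So the sum is the
  orthogonal of zero.\<close>

lemma nondegenerate_split:
  fixes b :: "'e::euclidean_space \<Rightarrow> 'e \<Rightarrow> real"
  assumes b: "bilinear b" "\<And>v w. b v w = b w v" "nondegenerate_on b UNIV"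
    and V: "subspace V" "nondegenerate_on b V"
  shows "V + orth b V = UNIV"
proof -
  have S: "subspace (V + orth b V)"
    by (intro subspace_set_plus V(1) subspace_orth b(1))
  have "n = 0" if n: "n \<in> orth b (V + orth b V)" for n
  proof -
    have 0: "0 \<in> V" "0 \<in> orth b V"
      using V(1) subspace_orth[OF b(1)] subspace_0 by blast+
    have "n \<in> orth b V" using n set_plus_intro[OF _ 0(2)] by (auto simp: orth_def)
    moreover have "b n m = 0" if "m \<in> orth b V" for m
      using n set_plus_intro[OF 0(1) that] by (auto simp: orth_def)
    then have "n \<in> V" by (rule nondegenerate_double_orth[OF b V(1)])
    ultimately show "n = 0" using V(2) by (auto simp: orth_def nondegenerate_on_def)
  qed
  then have "b v n = 0" if "n \<in> orth b (V + orth b V)" for v n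
    using that bilinear_rzero[OF b(1)] by blast
  then show ?thesis using nondegenerate_double_orth[OF b S] by blast
qed

lemma direct_sum_subset:
  assumes "direct_sum V W Z" shows "0 \<in> Z \<Longrightarrow> W \<subseteq> V" "0 \<in> W \<Longrightarrow> Z \<subseteq> V"
  using assms set_plus_intro[of _ W 0 Z] set_plus_intro[of 0 W _ Z] by (auto simp: direct_sum_def)

text \<open>It makes the \<open>THE\<close> in \<open>second_fundamental_form\<close> meaningful.
  For existence, split off the nondegenerate space \<open>ST + STp\<close>; the rest is radical plus
  \<open>ltr\<close>.\<close>

lemma lightlike_transversal_decomposition:
  fixes b :: "'e::euclidean_space \<Rightarrow> 'e \<Rightarrow> real"
  assumes b: "bilinear b" "\<And>v w. b v w = b w v" "nondegenerate_on b UNIV"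
    and sub: "subspace ST" "subspace STp" "subspace ltr" "subspace T"
    and nd: "nondegenerate_on b ST" "nondegenerate_on b STp"
    and T: "orth_direct_sum b T ST (T \<inter> orth b T)"
    and N: "orth_direct_sum b (orth b T) STp (T \<inter> orth b T)"
    and ltr: "direct_sum (orth b (ST + STp)) (T \<inter> orth b T) ltr"
  shows "\<exists>!t. t \<in> ltr + STp \<and> v - t \<in> T"
proof -
  have bil: "b (x + y) z = b x z + b y z" "b z (x + y) = b z x + b z y"
    "b (x - y) z = b x z - b y z" "b z (x - y) = b z x - b z y" for x y z
    using b(1) by (simp_all add: bilinear_ladd bilinear_radd bilinear_lsub bilinear_rsub)
  have R: "subspace (T \<inter> orth b T)"
    using sub(4) subspace_orth[OF b(1)] by (rule subspace_inter)
  have ST_T: "ST \<subseteq> T" and STp_N: "STp \<subseteq> orth b T" and ltr_orth: "ltr \<subseteq> orth b (ST + STp)"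
    using T N ltr direct_sum_subset subspace_0[OF R] unfolding orth_direct_sum_def by blast+
  have orthog: "b s s' = 0" if "s \<in> ST" "s' \<in> STp" for s s'
    using that ST_T STp_N b(2)[of s s'] by (auto simp: orth_def)
  have ltr0: "b l s = 0" if "l \<in> ltr" "s \<in> ST \<union> STp" for l s
    using that ltr_orth set_plus_intro[of s ST 0 STp] set_plus_intro[of 0 ST s STp]
      subspace_0[OF sub(1)] subspace_0[OF sub(2)]
    by (auto simp: orth_def)
  have nd': "nondegenerate_on b (ST + STp)"
    unfolding nondegenerate_on_def
  proof (intro ballI impI)
    fix w assume "w \<in> ST + STp" and 0: "\<forall>z\<in>ST + STp. b w z = 0"
    then obtain s s' where w: "w = s + s'" "s \<in> ST" "s' \<in> STp" by (auto elim: set_plus_elim)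
    have "b s z = 0" if "z \<in> ST" for z
    proof -
      have "b w z = 0" using 0 set_plus_intro[OF that subspace_0[OF sub(2)]] by auto
      then show ?thesis using w that orthog[OF that w(3)] b(2)[of s' z] by (simp add: bil)
    qed
    moreover have "b s' z = 0" if "z \<in> STp" for z
    proof -
      have "b w z = 0" using 0 set_plus_intro[OF subspace_0[OF sub(1)] that] by auto
      then show ?thesis using w that orthog[OF w(2) that] by (simp add: bil)
    qed
    ultimately have "s = 0" "s' = 0" using nd w unfolding nondegenerate_on_def by blast+
    then show "w = 0" using w by simp
  qed
  have S: "subspace (ST + STp)"
    using sub(1,2) by (rule subspace_set_plus)
  obtain w z where v: "v = w + z" "w \<in> ST + STp" "z \<in> orth b (ST + STp)"
    using nondegenerate_split[OF b S nd'] by (metis UNIV_I set_plus_elim)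
  obtain s s' where w: "w = s + s'" "s \<in> ST" "s' \<in> STp" using v(2) by (auto elim: set_plus_elim)
  obtain r l where z: "z = r + l" "r \<in> T \<inter> orth b T" "l \<in> ltr"
    using v(3) ltr by (auto simp: direct_sum_def elim: set_plus_elim)
  have "l + s' \<in> ltr + STp \<and> v - (l + s') \<in> T"
  proof
    show "l + s' \<in> ltr + STp" using z w by (auto intro: set_plus_intro)
    have "s + r \<in> T" using w(2) z(2) ST_T subspace_add[OF sub(4)] by auto
    then show "v - (l + s') \<in> T" by (simp add: v(1) w(1) z(1) algebra_simps)
  qed
  moreover have "t1 = t2"
    if t1: "t1 \<in> ltr + STp" "v - t1 \<in> T" and t2: "t2 \<in> ltr + STp" "v - t2 \<in> T" for t1 t2
  proof -
    have tr: "subspace (ltr + STp)" using sub(3,2) by (rule subspace_set_plus)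
    have "(v - t2) - (v - t1) \<in> T" using subspace_diff[OF sub(4) t2(2) t1(2)] .
    then have "t1 - t2 \<in> T" by simp
    moreover have "t1 - t2 \<in> ltr + STp" using subspace_diff[OF tr t1(1) t2(1)] .
    \<comment> \<open>Pairing with \<open>ST\<close> kills the screen part of \<open>t\<close> and
      pairing with \<open>STp\<close> its screen transversal part; what is left lies in the radical
      and in \<open>ltr\<close>.\<close>
    moreover have "t = 0" if tT: "t \<in> T" and ttr: "t \<in> ltr + STp" for t
    proof -
      have "t \<in> ST + T \<inter> orth b T"
        using tT equalityD1[OF conjunct1[OF T[unfolded orth_direct_sum_def direct_sum_def, THEN conjunct1]]]
        by (rule set_mp[rotated])
      then obtain s r where 1: "t = s + r" "s \<in> ST" "r \<in> T \<inter> orth b T"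
        by (rule set_plus_elim)
      obtain l s' where 2: "t = l + s'" "l \<in> ltr" "s' \<in> STp"
        using ttr by (auto elim: set_plus_elim)
      have "b s z = 0" if "z \<in> ST" for z
      proof -
        have "b t z = b s z" using 1 that ST_T by (auto simp: bil orth_def)
        moreover have "b t z = 0" using 2 that ltr0 orthog[OF that 2(3)] b(2)[of s' z] by (simp add: bil)
        ultimately show ?thesis by simp
      qed
      then have s: "s = 0" using nd(1) 1(2) by (auto simp: nondegenerate_on_def)
      have "b s' z = 0" if "z \<in> STp" for z
      proof -
        have "b z r = 0" using that STp_N 1(3) by (auto simp: orth_def)
        then have "b t z = 0" using 1 s b(2)[of r z] by (simp add: bil)
        then show ?thesis using 2 that ltr0[of l z] by (simp add: bil)
      qed
      then have "s' = 0" using nd(2) 2(3) by (auto simp: nondegenerate_on_def)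
      then have "r = l" using 1 2 s by simp
      then have "r \<in> (T \<inter> orth b T) \<inter> ltr" using 1 2 by blast
      then show "t = 0" using ltr 1 s by (auto simp: direct_sum_def)
    qed
    ultimately show "t1 = t2" by fastforce
  qed
  ultimately show ?thesis by blast
qed

text \<open>If all vectors of \<open>V\<close> were null, polarization would make \<open>b\<close>
  vanish on \<open>V\<close>.\<close>

lemma nondegenerate_nonnull:
  fixes b :: "'e::euclidean_space \<Rightarrow> 'e \<Rightarrow> real"
  assumes b: "bilinear b" "\<And>v w. b v w = b w v" and V: "subspace V" "nondegenerate_on b V" "V \<noteq> {0}"
  shows "\<exists>v\<in>V. b v v \<noteq> 0"
proof (rule ccontr)
  assume *: "\<not> ?thesis"
  obtain v where v: "v \<in> V" "v \<noteq> 0" using V(1,3) subspace_0 by blast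
  have "b v w = 0" if "w \<in> V" for w
  proof -
    have "b (v + w) (v + w) = 0" "b v v = 0" "b w w = 0" using * v that subspace_add[OF V(1)] by auto
    then show ?thesis using b(2)[of v w] by (simp add: bilinear_ladd[OF b(1)] bilinear_radd[OF b(1)])
  qed
  then show False using V(2) v by (auto simp: nondegenerate_on_def)
qed

section \<open>Algebraic curvature tensors of Kaehler type\<close>

text \<open>\<open>K u v w z\<close> stands for g(R(u, v) w, z). Only the linear symmetries are
  kept, so that the difference of an actual curvature tensor and the model tensor is again an
  instance.\<close>

locale kaehler_form =
  fixes J :: "'e::euclidean_space \<Rightarrow> 'e" and K :: "'e \<Rightarrow> 'e \<Rightarrow> 'e \<Rightarrow> 'e \<Rightarrow> real"
  assumes J: "linear J" "\<And>v. J (J v) = - v"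
    and lin: "\<And>v w z. linear (\<lambda>u. K u v w z)" "\<And>u w z. linear (\<lambda>v. K u v w z)"
      "\<And>u v z. linear (\<lambda>w. K u v w z)" "\<And>u v w. linear (\<lambda>z. K u v w z)"
    and skew12: "\<And>u v w z. K u v w z = - K v u w z"
    and skew34: "\<And>u v w z. K u v w z = - K u v z w"
    and bianchi: "\<And>u v w z. K u v w z + K v w u z + K w u v z = 0"
    and J34: "\<And>u v w z. K u v (J w) (J z) = K u v w z"
begin

lemmas K_simps = linear_add[OF lin(1)] linear_add[OF lin(2)] linear_add[OF lin(3)] linear_add[OF lin(4)]
  linear_diff[OF lin(1)] linear_diff[OF lin(2)] linear_diff[OF lin(3)] linear_diff[OF lin(4)]
  linear_neg[OF lin(1)] linear_neg[OF lin(2)] linear_neg[OF lin(3)] linear_neg[OF lin(4)]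
  linear_add[OF J(1)] linear_diff[OF J(1)] linear_neg[OF J(1)]

text \<open>The octahedron argument: take the Bianchi identity once with each of the four vectors in
  the last slot and combine them.\<close>

lemma pair_symmetric: "K u v w z = K w z u v"
proof -
  have "K u v w z + K v w u z + K w u v z = 0" "K v w z u + K w z v u + K z v w u = 0"
    "K w z u v + K z u w v + K u w z v = 0" "K z u v w + K u v z w + K v z u w = 0"
    by (rule bianchi)+
  moreover have "K u v z w = - K u v w z" "K v w z u = - K v w u z" "K u w z v = K w u v z"
    "K w z v u = - K w z u v" "K z v w u = K v z u w" "K z u v w = - K z u w v"
    using skew12 skew34 by (metis minus_minus)+
  ultimately show ?thesis by linarith
qed

lemma J12: "K (J u) (J v) w z = K u v w z"
  using pair_symmetric J34 by metis

lemma J_swap: "K u (J v) w z = K v (J u) w z"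
  using J12[of u "J v" w z] skew12[of "J u" v w z] by (simp add: J K_simps)

lemma J_swap': "K w z u (J v) = K w z v (J u)"
  using J_swap pair_symmetric by metis

text \<open>Holomorphic sectional curvature determines the tensor. Polarization and the Bianchi
  identity give two linear relations between K(x, y, x, y) and K(x, Jy, x, Jy) that have only the
  zero solution.\<close>

lemma holomorphic_sectional_zero:
  assumes 0: "\<And>u. K u (J u) (J u) u = 0"
  shows "K u (J u) w z = 0"
proof -
  have f0: "K u (J u) u (J u) = 0" for u
    using 0[of u] skew34[of u "J u" "J u" u] by simp
  \<comment> \<open>the quadratic terms in \<open>y\<close> of the vanishing quartic form at \<open>x + y\<close>\<close>
  have E1: "K x (J x) y (J y) + 2 * K x (J y) x (J y) = 0" for x y
  proof -
    have "0 = K (x + y) (J (x + y)) (x + y) (J (x + y)) + K (x - y) (J (x - y)) (x - y) (J (x - y))"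
      by (simp add: f0)
    also have "\<dots> = 2 * (K x (J x) y (J y) + K y (J y) x (J x) + K x (J y) x (J y) + K x (J y) y (J x)
        + K y (J x) x (J y) + K y (J x) y (J x))"
      using f0[of x] f0[of y] by (simp add: K_simps)
    also have "\<dots> = 4 * (K x (J x) y (J y) + 2 * K x (J y) x (J y))"
      using pair_symmetric[of y "J y" x "J x"] J_swap'[of _ _ y x] J_swap[of y x] by simp
    finally show ?thesis by simp
  qed
  have E2: "K x (J x) y (J y) = K x (J y) x (J y) + K x y x y" for x y
    using bianchi[of x "J x" y "J y"] J34[of y x x y] skew12[of y x x y] skew12[of "J x" y x "J y"] J_swap[of y x]
    by simp
  have E3: "3 * K x (J y) x (J y) + K x y x y = 0" for x y
    using E1[of x y] E2[of x y] by simp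
  \<comment> \<open>\<open>E3\<close> at \<open>y\<close> and at \<open>J y\<close>: the two
    unknowns a and b satisfy 3a + b = 0 and 3b + a = 0.\<close>
  have "K x y x y = 0" "K x (J y) x (J y) = 0" for x y
    using E3[of x y] E3[of x "J y"] by (simp_all add: J K_simps)
  then have E4: "K x (J x) y (J y) = 0" for x y using E1[of x y] by simp
  \<comment> \<open>This form is symmetric in \<open>w\<close> and \<open>z\<close> by
    \<open>J_swap'\<close>, and \<open>E4\<close> says that its diagonal vanishes.\<close>
  have "K u (J u) w (J z) = 0" for z
    using E4[of u "w + z"] E4[of u w] E4[of u z] J_swap'[of u "J u" z w] by (simp add: K_simps)
  from this[of "- J z"] show ?thesis by (simp add: J K_simps)
qed

end

text \<open>Subtracting the model tensor of constant holomorphic sectional curvature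
  \<open>c\<close> leaves a tensor of Kaehler type with vanishing holomorphic curvature. The
  right-hand side is the model tensor at the pair \<open>u\<close>, \<open>J u\<close>, before like
  terms are collected.\<close>

lemma constant_holomorphic_curvature:
  fixes G :: "'e::euclidean_space \<Rightarrow> 'e \<Rightarrow> real"
  assumes K: "kaehler_form J K"
    and G: "bilinear G" "\<And>u v. G u v = G v u" "\<And>u v. G (J u) (J v) = G u v" "nondegenerate_on G UNIV"
    and c: "\<And>u. G u u \<noteq> 0 \<Longrightarrow> K u (J u) (J u) u = c * (G u u)\<^sup>2"
  shows "K u (J u) w z = c / 4 * (G (J u) w * G u z - G u w * G (J u) z
    - G u w * G (J u) z + G (J u) w * G u z - 2 * G u u * G (J w) z)"
proof -
  interpret K: kaehler_form J K by (rule K)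
  note J = K.J
  have bil: "G (x + y) z = G x z + G y z" "G z (x + y) = G z x + G z y"
    "G (r *\<^sub>R x) z = r * G x z" "G z (r *\<^sub>R x) = r * G z x"
    "G (- x) z = - G x z" "G z (- x) = - G z x" for x y z r
    using G(1) by (simp_all add: bilinear_ladd bilinear_radd bilinear_lmul bilinear_rmul bilinear_lneg bilinear_rneg)
  have GJ: "G (J x) y = - G x (J y)" for x y
    using G(3)[of "J x" y] by (simp add: J bil)
  have GJ0: "G x (J x) = 0" for x
    using GJ[of x x] G(2)[of x "J x"] by simp
  \<comment> \<open>extended to null vectors by continuity along a line in a non-null direction\<close>
  have c': "K x (J x) (J x) x = c * (G x x)\<^sup>2" for x
  proof (cases "UNIV = {0::'e}")
    case True
    then have "x = 0" by blast
    then show ?thesis using linear_0[OF K.lin(1), of "J x" "J x" x] bil(3)[of 0 0 0] by simp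
  next
    case False
    then obtain b where b: "G b b \<noteq> 0"
      using nondegenerate_nonnull[OF G(1,2) subspace_UNIV G(4)] by blast
    define p where "p t = K (x + t *\<^sub>R b) (J (x + t *\<^sub>R b)) (J (x + t *\<^sub>R b)) (x + t *\<^sub>R b)
      - c * (G (x + t *\<^sub>R b) (x + t *\<^sub>R b))\<^sup>2" for t
    \<comment> \<open>The two excluded parameters are the zeros of the quadratic polynomial giving
      the square of \<open>x + t *\<^sub>R b\<close> under \<open>G\<close> when \<open>x\<close> is
      null; elsewhere the hypothesis on non-null vectors applies.\<close>
    have "p t = 0" if "t \<noteq> 0" "t \<noteq> - 2 * G x b / G b b" "G x x = 0" for t
    proof -
      have "G (x + t *\<^sub>R b) (x + t *\<^sub>R b) = t * (2 * G x b + t * G b b)"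
        using that(3) G(2)[of b x] by (simp add: bil algebra_simps)
      moreover have "2 * G x b + t * G b b \<noteq> 0" using that(2) b by (auto simp: field_simps)
      ultimately show ?thesis using that(1) c unfolding p_def by simp
    qed
    then have "\<forall>\<^sub>F t in at 0. p t = 0" if "G x x = 0"
      using that eventually_conj[OF eventually_neq_at_within[of 0 0 UNIV]
          eventually_neq_at_within[of "- 2 * G x b / G b b" 0 UNIV]]
      by (elim eventually_mono) blast
    moreover have "isCont p 0"
      unfolding p_def
      by (simp add: K.K_simps bil linear_scale[OF K.lin(1)] linear_scale[OF K.lin(2)]
        linear_scale[OF K.lin(3)] linear_scale[OF K.lin(4)] linear_scale[OF J(1)])
    ultimately have "p 0 = 0" if "G x x = 0"
      using that tendsto_unique[of "at 0" p "p 0" 0] tendsto_eventually by (auto simp: isCont_def)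
    then show ?thesis using c[of x] by (cases "G x x = 0") (auto simp: p_def)
  qed
  \<comment> \<open>The space form curvature tensor with its last index lowered by
    \<open>G\<close>.\<close>
  define K0 where "K0 x y w z = c / 4 * (G y w * G x z - G x w * G y z + G (J y) w * G (J x) z
    - G (J x) w * G (J y) z + 2 * G x (J y) * G (J w) z)" for x y w z
  define K' where "K' x y w z = K x y w z - K0 x y w z" for x y w z
  note lins = linear_add[OF J(1)] linear_scale[OF J(1)]
  note scale = K.lin[THEN linear_scale]
  have "kaehler_form J K'"
  proof (rule kaehler_form.intro)
    show "linear (\<lambda>x. K' x y w z)" for y w z
      unfolding K'_def K0_def
      by (rule linearI; simp add: K.K_simps bil lins scale algebra_simps)
    show "linear (\<lambda>y. K' x y w z)" for x w z
      unfolding K'_def K0_def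
      by (rule linearI; simp add: K.K_simps bil lins scale algebra_simps)
    show "linear (\<lambda>w. K' x y w z)" for x y z
      unfolding K'_def K0_def
      by (rule linearI; simp add: K.K_simps bil lins scale algebra_simps)
    show "linear (\<lambda>z. K' x y w z)" for x y w
      unfolding K'_def K0_def
      by (rule linearI; simp add: K.K_simps bil lins scale algebra_simps)
    show "K' x y w z = - K' y x w z" for x y w z
      using K.skew12[of x y w z] GJ[of x y] G(2)[of "J x" y] unfolding K'_def K0_def
      by (simp add: algebra_simps)
    show "K' x y w z = - K' x y z w" for x y w z
      using K.skew34[of x y w z] GJ[of w z] G(2)[of "J z" w] unfolding K'_def K0_def
      by (simp add: algebra_simps)
    show "K' x y w z + K' y w x z + K' w x y z = 0" for x y w z
      using K.bianchi[of x y w z] GJ[of x y] GJ[of y w] GJ[of w x] GJ[of y x] GJ[of w y] GJ[of x w]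
        G(2)[of "J x" y] G(2)[of "J y" w] G(2)[of "J w" x] G(2)[of x y] G(2)[of y w] G(2)[of w x]
      unfolding K'_def K0_def by (simp add: algebra_simps)
    show "K' x y (J w) (J z) = K' x y w z" for x y w z
      using K.J34[of x y w z] GJ[of x w] GJ[of y w] GJ[of x z] GJ[of y z] GJ[of w z] GJ[of "J w" "J z"]
      unfolding K'_def K0_def by (simp add: G(3) J bil algebra_simps)
  qed (use J in auto)
  then interpret K': kaehler_form J K' .
  \<comment> \<open>At this argument the terms of \<open>K0\<close> contribute 1 + 1 + 2 times the
    square of \<open>G x x\<close>, which cancels the 4 in c/4.\<close>
  have "K' x (J x) (J x) x = 0" for x
    using c'[of x] GJ0[of x] G(2)[of x "J x"]
    by (simp add: K'_def K0_def G(3) J bil power2_eq_square)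
  then have "K' u (J u) w z = 0" by (rule K'.holomorphic_sectional_zero)
  then show ?thesis using GJ0[of u] by (simp add: K'_def K0_def J bil algebra_simps)
qed

section \<open>Umbilical maps in coordinates\<close>

text \<open>Differentiating the orthogonality of \<open>T\<close> and \<open>N\<close> gives -G(T,
  \<nabla>N), which depends on \<open>T\<close> only through its value at \<open>x\<close>. So
  \<open>T\<close> may be replaced by a field \<open>\<lambda>y. fd F y \<zeta>\<close> that agrees
  with it there, and for such fields umbilicity applies directly.\<close>

lemma umbilical_tangent_derivative:
  fixes F :: "'d::euclidean_space \<Rightarrow> 'e::euclidean_space"
  assumes C: "smooth_bilinear Q C" and G: "smooth_bilinear Q G"
    and compat: "\<And>y a b w. y \<in> Q \<Longrightarrow> fd (\<lambda>z. G z a b) y w = G y (C y w a) b + G y a (C y w b)"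
    and W: "open W" "x \<in> W" and F: "smooth_on W F" "F ` W \<subseteq> Q"
    and umbilical: "\<And>u v. cd C F (\<lambda>y. fd F y v) x u - G (F x) (fd F x u) (fd F x v) *\<^sub>R H \<in> range (fd F x)"
    and N: "smooth_on W N" "\<And>y v. y \<in> W \<Longrightarrow> G (F y) (fd F y v) (N y) = 0"
    and T: "smooth_on W T" "\<And>y. y \<in> W \<Longrightarrow> T y \<in> range (fd F y)"
  shows "G (F x) (cd C F T x u) (N x) = G (F x) (fd F x u) (T x) * G (F x) H (N x)"
proof -
  have bil: "bilinear (G (F x))" using G F W by (auto simp: smooth_bilinear_def)
  have *: "G (F x) (cd C F V x u) (N x) = - G (F x) (V x) (cd C F N x u)"
    if V: "smooth_on W V" "\<And>y. y \<in> W \<Longrightarrow> V y \<in> range (fd F y)" for V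
  proof -
    have "fd (\<lambda>y. G (F y) (V y) (N y)) x u = fd (\<lambda>y. 0 :: real) x u"
      using fd_cong_open[OF W, of "\<lambda>y. G (F y) (V y) (N y)" "\<lambda>y. 0"] V(2) N(2) by fastforce
    then show ?thesis using metric_along[OF C F(2) G compat W F(1) V(1) N(1)] by simp
  qed
  obtain \<zeta> where \<zeta>: "T x = fd F x \<zeta>" using T(2)[OF W(2)] by blast
  obtain \<eta> where \<eta>: "cd C F (\<lambda>y. fd F y \<zeta>) x u = fd F x \<eta> + G (F x) (fd F x u) (fd F x \<zeta>) *\<^sub>R H"
    using umbilical[of \<zeta> u] unfolding image_iff diff_eq_eq by blast
  have "G (F x) (cd C F T x u) (N x) = G (F x) (cd C F (\<lambda>y. fd F y \<zeta>) x u) (N x)"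
    using *[OF T] *[OF smooth_on_fd[OF F(1)], of \<zeta>] \<zeta> by simp
  then show ?thesis
    using N(2)[OF W(2)] by (simp add: \<eta> \<zeta> bilinear_ladd[OF bil] bilinear_lmul[OF bil])
qed

text \<open>Writing \<open>\<nabla>\<close> for \<open>cd C F\<close> and \<open>F\<^sub>u\<close> for \<open>\<lambda>x. fd F x u\<close>: as \<open>Z\<close> is radical and \<open>F\<close> is umbilical,
  \<open>\<nabla>\<^sub>v Z\<close> is tangent, so that the transversal part of \<open>\<nabla>\<^sub>u \<nabla>\<^sub>v Z\<close> is
  \<open>G(F\<^sub>u, \<nabla>\<^sub>v Z) H = - G(F\<^sub>u, F\<^sub>v) G(H, Z) H\<close>, which is symmetric in \<open>u\<close> and \<open>v\<close>.\<close>

lemma umbilical_radical_curvature: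
  fixes F :: "'d::euclidean_space \<Rightarrow> 'e::euclidean_space"
  assumes C: "smooth_bilinear Q C" and G: "smooth_bilinear Q G"
    and G_sym: "\<And>y a b. y \<in> Q \<Longrightarrow> G y a b = G y b a"
    and G_nd: "\<And>y. y \<in> Q \<Longrightarrow> nondegenerate_on (G y) UNIV"
    and compat: "\<And>y a b w. y \<in> Q \<Longrightarrow> fd (\<lambda>z. G z a b) y w = G y (C y w a) b + G y a (C y w b)"
    and W: "open W" and F: "smooth_on W F" "F ` W \<subseteq> Q"
    and umbilical: "\<And>x u v. x \<in> W \<Longrightarrow>
      cd C F (\<lambda>y. fd F y v) x u - G (F x) (fd F x u) (fd F x v) *\<^sub>R H x \<in> range (fd F x)"
    and extend: "\<And>x n. x \<in> W \<Longrightarrow> n \<in> orth (G (F x)) (range (fd F x)) \<Longrightarrow>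
      \<exists>W' N. open W' \<and> x \<in> W' \<and> W' \<subseteq> W \<and> smooth_on W' N \<and> N x = n \<and>
        (\<forall>y\<in>W'. N y \<in> orth (G (F y)) (range (fd F y)))"
    and Z: "smooth_on W Z" "\<And>x. x \<in> W \<Longrightarrow> Z x \<in> range (fd F x)"
      "\<And>x v. x \<in> W \<Longrightarrow> G (F x) (fd F x v) (Z x) = 0"
    and x: "x \<in> W" and n: "n \<in> orth (G (F x)) (range (fd F x))"
  shows "G (F x) (curv C (F x) (fd F x u) (fd F x v) (Z x)) n = 0"
proof -
  have bil: "bilinear (G (F x))" and Q: "F x \<in> Q" if "x \<in> W" for x
    using that G F by (auto simp: smooth_bilinear_def)
  have step1: "G (F x) (cd C F T x u) n = G (F x) (fd F x u) (T x) * G (F x) (H x) n"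
    if T: "smooth_on W T" "\<And>y. y \<in> W \<Longrightarrow> T y \<in> range (fd F y)"
      and x: "x \<in> W" and n: "n \<in> orth (G (F x)) (range (fd F x))" for T x u n
  proof -
    obtain W' N where W': "open W'" "x \<in> W'" "W' \<subseteq> W" and N: "smooth_on W' N" "N x = n"
      "\<And>y. y \<in> W' \<Longrightarrow> N y \<in> orth (G (F y)) (range (fd F y))"
      using extend[OF x n] by blast
    have "F ` W' \<subseteq> Q" using W' F by blast
    have N0: "G (F y) (fd F y v) (N y) = 0" if "y \<in> W'" for y v
      using N(3)[OF that] G_sym[OF Q, of y "N y" "fd F y v"] that W' by (auto simp: orth_def)
    show ?thesis
      using umbilical_tangent_derivative[OF C G compat W'(1,2) smooth_on_subset[OF F(1) W'(3)] \<open>F ` W' \<subseteq> Q\<close>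
          umbilical[OF x] N(1) N0 smooth_on_subset[OF T(1) W'(3)] T(2)] W'(3) N(2) by auto
  qed
  have cd_Z: "cd C F Z y w \<in> range (fd F y)" if y: "y \<in> W" for y w
  proof (rule nondegenerate_double_orth[OF bil[OF y] G_sym[OF Q[OF y]] G_nd[OF Q[OF y]]])
    show "subspace (range (fd F y))"
      by (intro linear_subspace_image smooth_on_linear_fd[OF F(1) y] subspace_UNIV)
    show "G (F y) (cd C F Z y w) n = 0" if "n \<in> orth (G (F y)) (range (fd F y))" for n
      using step1[OF Z(1,2) y that] Z(3)[OF y] by simp
  qed
  have sm: "smooth_on W (\<lambda>y. cd C F Z y w)" for w
    by (rule smooth_on_cd[OF C F(2) W F(1) Z(1) smooth_on_const])
  have first: "G (F x) (fd F x u) (cd C F Z x v) = - (G (F x) (fd F x u) (fd F x v) * G (F x) (H x) (Z x))"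
    for u v
  proof -
    have "fd (\<lambda>y. G (F y) (fd F y u) (Z y)) x v = fd (\<lambda>y. 0 :: real) x v"
      using fd_cong_open[OF W x, of "\<lambda>y. G (F y) (fd F y u) (Z y)" "\<lambda>y. 0"] Z(3) by fastforce
    then have "G (F x) (fd F x u) (cd C F Z x v) = - G (F x) (cd C F (\<lambda>y. fd F y u) x v) (Z x)"
      using metric_along[OF C F(2) G compat W x F(1) smooth_on_fd[OF F(1)] Z(1)] by simp
    moreover obtain \<eta> where "cd C F (\<lambda>y. fd F y u) x v = fd F x \<eta> + G (F x) (fd F x v) (fd F x u) *\<^sub>R H x"
      using umbilical[OF x, of u v] unfolding image_iff diff_eq_eq by blast
    ultimately show ?thesis
      using Z(3)[OF x] G_sym[OF Q[OF x], of "fd F x v" "fd F x u"]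
      by (simp add: bilinear_ladd[OF bil[OF x]] bilinear_lmul[OF bil[OF x]])
  qed
  have "G (F x) (cd C F (\<lambda>y. cd C F Z y v) x u) n = G (F x) (cd C F (\<lambda>y. cd C F Z y u) x v) n"
    using step1[OF sm cd_Z x n] first G_sym[OF Q[OF x], of "fd F x v" "fd F x u"] by simp
  \<comment> \<open>The directions \<open>u\<close> and \<open>v\<close> are constant, so the
    bracket term of \<open>curv_along\<close> is the derivative in direction zero.\<close>
  moreover have "curv C (F x) (fd F x u) (fd F x v) (Z x)
      = cd C F (\<lambda>y. cd C F Z y v) x u - cd C F (\<lambda>y. cd C F Z y u) x v"
    using curv_along[OF C F(2) W x F(1) Z(1) smooth_on_const smooth_on_const, of v u]
      linear_0[OF linear_cd[OF C F(2,1) Z(1) x]] by simp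
  ultimately show ?thesis by (simp add: bilinear_lsub[OF bil[OF x]])
qed

section \<open>Vector fields and connections in charts\<close>

definition transition :: "('p, 'e) chart \<Rightarrow> ('p, 'e) chart \<Rightarrow> 'e \<Rightarrow> 'e" where
  "transition c d = (\<lambda>x. cmap d (cinv c x))"

definition coord_map :: "('q, 'd) chart \<Rightarrow> ('p, 'e) chart \<Rightarrow> ('q \<Rightarrow> 'p) \<Rightarrow> 'd \<Rightarrow> 'e" where
  "coord_map c d f = (\<lambda>x. cmap d (f (cinv c x)))"

definition coord_section ::
  "('p, 'e::euclidean_space) chart set \<Rightarrow> ('q, 'd) chart \<Rightarrow> ('p, 'e) chart \<Rightarrow> ('q \<Rightarrow> 'p) \<Rightarrow> ('q \<Rightarrow> 'e) \<Rightarrow> 'd \<Rightarrow> 'e" where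
  "coord_section A c d f V = (\<lambda>x. tcoord A d (f (cinv c x)) (V (cinv c x)))"

text \<open>The field on \<open>cdom c\<close> whose coordinates in \<open>c\<close> are constantly \<open>a\<close>.\<close>

definition cfield :: "('p, 'e::euclidean_space) chart set \<Rightarrow> ('p, 'e) chart \<Rightarrow> 'e \<Rightarrow> 'p \<Rightarrow> 'e" where
  "cfield A c a p = fd (transition c (chart_at A p)) (cmap c p) a"

locale smooth_atlas =
  fixes A :: "('p::{t2_space,second_countable_topology}, 'e::euclidean_space) chart set"
  assumes smooth_manifold: "smooth_manifold A"
begin

lemma
  assumes "c \<in> A"
  shows open_cdom: "open (cdom c)"
    and cinv_cmap: "p \<in> cdom c \<Longrightarrow> cinv c (cmap c p) = p"
    and open_image: "open S \<Longrightarrow> open (cmap c ` (cdom c \<inter> S))"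
proof -
  have c: "open (cdom c)" "open (cmap c ` cdom c)" "homeomorphism (cdom c) (cmap c ` cdom c) (cmap c) (cinv c)"
    using assms smooth_manifold by (auto simp: smooth_manifold_def is_chart_def)
  then show "open (cdom c)" "p \<in> cdom c \<Longrightarrow> cinv c (cmap c p) = p" by (auto simp: homeomorphism_def)
  have "cmap c ` (cdom c \<inter> S) = cmap c ` cdom c \<inter> cinv c -` S"
    using c(3) by (force simp: homeomorphism_def)
  then show "open (cmap c ` (cdom c \<inter> S))" if "open S"
    using continuous_open_preimage[OF homeomorphism_cont2[OF c(3)] c(2) that] by simp
qed

lemma open_image_cdom: "c \<in> A \<Longrightarrow> open (cmap c ` cdom c)"
  using open_image[of c UNIV] by simp

lemma cinv_mem: "c \<in> A \<Longrightarrow> x \<in> cmap c ` cdom c \<Longrightarrow> cinv c x \<in> cdom c"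
  by (auto simp: cinv_cmap)

lemma cmap_cinv: "c \<in> A \<Longrightarrow> x \<in> cmap c ` cdom c \<Longrightarrow> cmap c (cinv c x) = x"
  by (auto simp: cinv_cmap)

lemma chart_at: "chart_at A p \<in> A" "p \<in> cdom (chart_at A p)"
proof -
  have "p \<in> (\<Union>c\<in>A. cdom c)" using smooth_manifold unfolding smooth_manifold_def by blast
  then have "\<exists>c. c \<in> A \<and> p \<in> cdom c" by blast
  from someI_ex[OF this] show "chart_at A p \<in> A" "p \<in> cdom (chart_at A p)"
    by (auto simp: chart_at_def)
qed

lemma smooth_transition: "c \<in> A \<Longrightarrow> d \<in> A \<Longrightarrow> smooth_on (cmap c ` (cdom c \<inter> cdom d)) (transition c d)"
  using smooth_manifold by (auto simp: smooth_manifold_def transition_def o_def)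

lemma transition_has_derivative:
  "c \<in> A \<Longrightarrow> d \<in> A \<Longrightarrow> p \<in> cdom c \<Longrightarrow> p \<in> cdom d \<Longrightarrow>
    (transition c d has_derivative fd (transition c d) (cmap c p)) (at (cmap c p))"
  by (rule smooth_on_has_derivative[OF smooth_transition]) auto

lemma linear_fd_transition:
  "c \<in> A \<Longrightarrow> d \<in> A \<Longrightarrow> p \<in> cdom c \<Longrightarrow> p \<in> cdom d \<Longrightarrow> linear (fd (transition c d) (cmap c p))"
  using transition_has_derivative has_derivative_linear by blast

lemma transition_chain:
  assumes "c \<in> A" "d \<in> A" "e \<in> A" "p \<in> cdom c" "p \<in> cdom d" "p \<in> cdom e"
  shows "fd (transition c e) (cmap c p) v = fd (transition d e) (cmap d p) (fd (transition c d) (cmap c p) v)"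
proof -
  have t: "transition c d (cmap c p) = cmap d p" using assms by (simp add: transition_def cinv_cmap)
  have "((\<lambda>x. transition d e (transition c d x)) has_derivative
      (\<lambda>v. fd (transition d e) (cmap d p) (fd (transition c d) (cmap c p) v))) (at (cmap c p))"
    by (rule has_derivative_compose)
      (use assms transition_has_derivative in \<open>auto simp: t\<close>)
  moreover have "fd (transition c e) (cmap c p) = fd (\<lambda>x. transition d e (transition c d x)) (cmap c p)"
    by (rule fd_cong_open[OF open_image[OF assms(1) open_cdom[OF assms(2)]]])
      (use assms in \<open>auto simp: transition_def cinv_cmap\<close>)
  ultimately show ?thesis by (simp add: fd_eqI)
qed

lemma transition_self: "c \<in> A \<Longrightarrow> p \<in> cdom c \<Longrightarrow> fd (transition c c) (cmap c p) v = v"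
  using fd_cong_open[OF open_image_cdom, of c "cmap c p" "transition c c" "\<lambda>x. x"]
  by (auto simp: transition_def cmap_cinv)

lemma tcoord_eq: "tcoord A c p = fd (transition (chart_at A p) c) (cmap (chart_at A p) p)"
  by (rule ext) (simp add: tcoord_def transition_def o_def)

lemma linear_tcoord: "c \<in> A \<Longrightarrow> p \<in> cdom c \<Longrightarrow> linear (tcoord A c p)"
  unfolding tcoord_eq by (intro linear_fd_transition chart_at)

lemma tcoord_change:
  assumes "c \<in> A" "d \<in> A" "p \<in> cdom c" "p \<in> cdom d"
  shows "tcoord A d p v = fd (transition c d) (cmap c p) (tcoord A c p v)"
  unfolding tcoord_eq by (rule transition_chain[OF chart_at(1) assms(1,2) chart_at(2) assms(3,4)])

lemma tcoord_chart_at [simp]: "tcoord A (chart_at A p) p v = v"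
  unfolding tcoord_eq by (rule transition_self[OF chart_at])

lemma tcoord_cfield [simp]: "c \<in> A \<Longrightarrow> p \<in> cdom c \<Longrightarrow> tcoord A c p (cfield A c a p) = a"
  unfolding tcoord_eq cfield_def
  by (simp add: transition_chain[OF _ chart_at(1) _ _ chart_at(2), symmetric] transition_self)

lemma cfield_tcoord [simp]: "c \<in> A \<Longrightarrow> p \<in> cdom c \<Longrightarrow> cfield A c (tcoord A c p v) p = v"
  unfolding cfield_def by (simp add: tcoord_change[OF _ chart_at(1) _ chart_at(2), symmetric])

lemma linear_cfield: "c \<in> A \<Longrightarrow> p \<in> cdom c \<Longrightarrow> linear (\<lambda>a. cfield A c a p)"
  unfolding cfield_def by (intro linear_fd_transition chart_at)

lemma cfield_chart_at [simp]: "cfield A (chart_at A p) a p = a"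
  using cfield_tcoord[OF chart_at, of p a] by simp

lemma coord_section_cfield:
  assumes "c \<in> A" "p \<in> cdom c" "d \<in> A" "p \<in> cdom d"
  shows "tcoord A d p (cfield A c a p) = fd (transition c d) (cmap c p) a"
  using assms by (simp add: tcoord_change[of c d])

text \<open>Coordinate fields serve as test fields: through them hypotheses about smooth fields
  become pointwise statements about Christoffel symbols, metric and complex structure. In another
  chart their coordinates are the derivative of the transition map at a constant vector.\<close>

lemma smooth_field_cfield:
  assumes c: "c \<in> A" shows "smooth_field_on A (cdom c) (cfield A c a)"
  unfolding smooth_field_on_def smooth_section_on_def
proof (intro ballI)
  fix c' d assume c': "c' \<in> A" and d: "d \<in> A"
  define W where "W = cmap c' ` (cdom c' \<inter> cdom c \<inter> id -` cdom d)"
  have W: "open W"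
    unfolding W_def Int_assoc by (simp add: open_image[OF c' open_Int[OF open_cdom[OF c] open_cdom[OF d]]])
  have sm: "smooth_on W (\<lambda>x. fd (transition c d) (transition c' c x) a)"
  proof (rule smooth_on_compose[OF W, where g = "transition c' c" and f = "\<lambda>x. fd (transition c d) x a"])
    show "smooth_on W (transition c' c)"
      by (rule smooth_on_subset[OF smooth_transition[OF c' c]]) (auto simp: W_def)
    show "smooth_on (cmap c ` (cdom c \<inter> cdom d)) (\<lambda>x. fd (transition c d) x a)"
      by (rule smooth_on_fd[OF smooth_transition[OF c d]])
    show "transition c' c ` W \<subseteq> cmap c ` (cdom c \<inter> cdom d)"
      using c' by (auto simp: W_def transition_def cinv_cmap)
  qed
  have eq: "fd (transition c d) (transition c' c x) a
      = tcoord A d (id (cinv c' x)) (cfield A c a (cinv c' x))" if "x \<in> W" for x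
    using that c c' d by (auto simp: W_def coord_section_cfield transition_def cinv_cmap)
  have "smooth_on W (\<lambda>x. tcoord A d (id (cinv c' x)) (cfield A c a (cinv c' x)))"
    by (rule iffD1[OF smooth_on_cong[OF W eq] sm])
  then show "smooth_on (cmap c' ` (cdom c' \<inter> cdom c \<inter> id -` cdom d))
      (\<lambda>x. tcoord A d (id (cinv c' x)) (cfield A c a (cinv c' x)))"
    by (simp only: W_def)
qed

lemma smooth_map_id: "smooth_map A A id"
  using smooth_manifold by (auto simp: smooth_map_def smooth_manifold_def)

end

section \<open>Smooth maps and sections along them in fixed charts\<close>

locale smooth_mapping = src: smooth_atlas B + tgt: smooth_atlas A
  for B :: "('q::{t2_space,second_countable_topology}, 'd::euclidean_space) chart set"
    and A :: "('p::{t2_space,second_countable_topology}, 'e::euclidean_space) chart set" +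
  fixes f :: "'q \<Rightarrow> 'p"
  assumes smooth_map: "smooth_map B A f"
begin

definition chart_domain :: "('q, 'd) chart \<Rightarrow> ('p, 'e) chart \<Rightarrow> 'd set" where
  "chart_domain c d = cmap c ` (cdom c \<inter> f -` cdom d)"

lemma open_vimage: "open S \<Longrightarrow> open (f -` S)"
  using smooth_map continuous_on_open_vimage[of UNIV f] by (auto simp: smooth_map_def)

lemma open_chart_domain: "c \<in> B \<Longrightarrow> d \<in> A \<Longrightarrow> open (chart_domain c d)"
  unfolding chart_domain_def by (intro src.open_image open_vimage tgt.open_cdom)

lemma smooth_coord_map: "c \<in> B \<Longrightarrow> d \<in> A \<Longrightarrow> smooth_on (chart_domain c d) (coord_map c d f)"
  using smooth_map by (auto simp: smooth_map_def chart_domain_def coord_map_def o_def)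

lemma coord_map_image: "c \<in> B \<Longrightarrow> coord_map c d f ` chart_domain c d \<subseteq> cmap d ` cdom d"
  by (auto simp: coord_map_def chart_domain_def src.cinv_cmap)

lemma coord_map_cmap: "c \<in> B \<Longrightarrow> q \<in> cdom c \<Longrightarrow> coord_map c d f (cmap c q) = cmap d (f q)"
  by (simp add: coord_map_def src.cinv_cmap)

lemma fd_coord_map_source:
  assumes "c \<in> B" "c' \<in> B" "d \<in> A" "q \<in> cdom c" "q \<in> cdom c'" "f q \<in> cdom d"
  shows "fd (coord_map c d f) (cmap c q) v = fd (coord_map c' d f) (cmap c' q) (fd (transition c c') (cmap c q) v)"
proof -
  have "((\<lambda>x. coord_map c' d f (transition c c' x)) has_derivative
      (\<lambda>v. fd (coord_map c' d f) (cmap c' q) (fd (transition c c') (cmap c q) v))) (at (cmap c q))"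
  proof (rule has_derivative_compose[where f = "transition c c'"])
    show "(transition c c' has_derivative fd (transition c c') (cmap c q)) (at (cmap c q))"
      using assms by (intro src.transition_has_derivative)
    show "(coord_map c' d f has_derivative fd (coord_map c' d f) (cmap c' q)) (at (transition c c' (cmap c q)))"
      using assms smooth_on_has_derivative[OF smooth_coord_map[of c' d], of "cmap c' q"]
      by (auto simp: transition_def src.cinv_cmap chart_domain_def)
  qed
  moreover have "fd (coord_map c d f) (cmap c q) = fd (\<lambda>x. coord_map c' d f (transition c c' x)) (cmap c q)"
    by (rule fd_cong_open[OF src.open_image[OF assms(1) src.open_cdom[OF assms(2)]]])
      (use assms in \<open>auto simp: transition_def coord_map_def src.cinv_cmap\<close>)
  ultimately show ?thesis by (simp add: fd_eqI)
qed

lemma fd_coord_map_target: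
  assumes "c \<in> B" "d \<in> A" "d' \<in> A" "q \<in> cdom c" "f q \<in> cdom d" "f q \<in> cdom d'"
  shows "fd (coord_map c d f) (cmap c q) v = fd (transition d' d) (cmap d' (f q)) (fd (coord_map c d' f) (cmap c q) v)"
proof -
  have "((\<lambda>x. transition d' d (coord_map c d' f x)) has_derivative
      (\<lambda>v. fd (transition d' d) (cmap d' (f q)) (fd (coord_map c d' f) (cmap c q) v))) (at (cmap c q))"
  proof (rule has_derivative_compose[where f = "coord_map c d' f" and g = "transition d' d"
        and f' = "fd (coord_map c d' f) (cmap c q)" and g' = "fd (transition d' d) (cmap d' (f q))"])
    show "(coord_map c d' f has_derivative fd (coord_map c d' f) (cmap c q)) (at (cmap c q))"
      using assms smooth_on_has_derivative[OF smooth_coord_map[of c d'], of "cmap c q"]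
      by (auto simp: chart_domain_def)
    show "(transition d' d has_derivative fd (transition d' d) (cmap d' (f q))) (at (coord_map c d' f (cmap c q)))"
      using assms tgt.transition_has_derivative by (simp add: coord_map_cmap)
  qed
  moreover have "fd (coord_map c d f) (cmap c q) = fd (\<lambda>x. transition d' d (coord_map c d' f x)) (cmap c q)"
    by (rule fd_cong_open[OF open_chart_domain[OF assms(1,3)]])
      (use assms in \<open>auto simp: transition_def coord_map_def chart_domain_def src.cinv_cmap tgt.cinv_cmap\<close>)
  ultimately show ?thesis by (simp add: fd_eqI)
qed

lemma differential_eq:
  "differential B A f q = fd (coord_map (chart_at B q) (chart_at A (f q)) f) (cmap (chart_at B q) q)"
  by (rule ext) (simp add: differential_def coord_map_def o_def)

lemma tcoord_differential:
  assumes "c \<in> B" "d \<in> A" "q \<in> cdom c" "f q \<in> cdom d"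
  shows "tcoord A d (f q) (differential B A f q v) = fd (coord_map c d f) (cmap c q) (tcoord B c q v)"
  unfolding tgt.tcoord_eq src.tcoord_eq differential_eq
  using assms fd_coord_map_source[OF src.chart_at(1) assms(1,2) src.chart_at(2) assms(3,4)]
    fd_coord_map_target[OF src.chart_at(1) assms(2) tgt.chart_at(1) src.chart_at(2) assms(4) tgt.chart_at(2)]
  by simp

lemma linear_differential: "linear (differential B A f q)"
  unfolding differential_eq
  by (rule smooth_on_linear_fd[OF smooth_coord_map[OF src.chart_at(1) tgt.chart_at(1)]])
    (auto simp: chart_domain_def src.chart_at tgt.chart_at)

lemma smooth_coord_section:
  assumes "smooth_section_on B A f U V" "c \<in> B" "d \<in> A"
  shows "smooth_on (cmap c ` (cdom c \<inter> U \<inter> f -` cdom d)) (coord_section A c d f V)"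
  using assms by (auto simp: smooth_section_on_def coord_section_def)

lemma open_section_domain:
  assumes "open U" "c \<in> B" "d \<in> A" shows "open (cmap c ` (cdom c \<inter> U \<inter> f -` cdom d))"
  unfolding Int_assoc using assms by (intro src.open_image open_Int open_vimage tgt.open_cdom)

text \<open>\<open>cov_deriv\<close> is defined in the charts selected at \<open>q\<close> and
  \<open>f q\<close>; this expresses it in arbitrary charts, which can stay fixed while
  \<open>q\<close> moves. Changing the target chart creates a second derivative of the transition
  map, which the transformation law of the connection cancels.\<close>

lemma tcoord_cov_deriv:
  assumes conn: "linear_connection A \<Gamma>" and cd: "c \<in> B" "d \<in> A" and U: "open U" "q \<in> U"
    and V: "smooth_section_on B A f U V" and q: "q \<in> cdom c" "f q \<in> cdom d"
  shows "tcoord A d (f q) (cov_deriv B A \<Gamma> f V q v) =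
    cd (\<lambda>y. \<Gamma> d (cinv d y)) (coord_map c d f) (coord_section A c d f V) (cmap c q) (tcoord B c q v)"
proof -
  define c' d' x w where "c' = chart_at B q" and "d' = chart_at A (f q)" and "x = cmap c q" and "w = tcoord B c q v"
  have cd': "c' \<in> B" "d' \<in> A" "q \<in> cdom c'" "f q \<in> cdom d'"
    by (simp_all add: c'_def d'_def src.chart_at tgt.chart_at)
  \<comment> \<open>In the selected chart a tangent vector is its own coordinate vector, so
    transforming \<open>w\<close> back gives \<open>v\<close>.\<close>
  have w: "fd (transition c c') x w = v"
    using src.tcoord_change[OF cd(1) cd'(1) q(1) cd'(3), of v]
    by (simp add: x_def w_def c'_def)
  define F where "F = coord_map c d' f"
  define h where "h = coord_section A c d' f V"
  define D where "D = fd (transition d' d) (cmap d' (f q))"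
  have D: "linear D" unfolding D_def using cd cd' q by (intro tgt.linear_fd_transition)
  have "((\<lambda>y. coord_section A c' d' f V (transition c c' y)) has_derivative
      (\<lambda>u. fd (coord_section A c' d' f V) (cmap c' q) (fd (transition c c') x u))) (at x)"
  proof (rule has_derivative_compose[where f = "transition c c'"])
    show "(transition c c' has_derivative fd (transition c c') x) (at x)"
      unfolding x_def by (rule src.transition_has_derivative[OF cd(1) cd'(1) q(1) cd'(3)])
    show "(coord_section A c' d' f V has_derivative fd (coord_section A c' d' f V) (cmap c' q))
        (at (transition c c' x))"
      using smooth_on_has_derivative[OF smooth_coord_section[OF V cd'(1,2)], of "cmap c' q"] cd cd' q U
      by (auto simp: x_def transition_def src.cinv_cmap)
  qed
  moreover have "fd h x = fd (\<lambda>y. coord_section A c' d' f V (transition c c' y)) x"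
    by (rule fd_cong_open[OF src.open_image[OF cd(1) src.open_cdom[OF cd'(1)]]])
      (use cd cd' q in \<open>auto simp: x_def h_def transition_def coord_section_def src.cinv_cmap\<close>)
  ultimately have fd_h: "fd h x w = fd (coord_section A c' d' f V) (cmap c' q) v"
    by (simp add: fd_eqI w)
  have fd_F: "fd F x w = differential B A f q v"
    using fd_coord_map_source[OF cd(1) cd'(1,2) q(1) cd'(3,4), of w]
    by (simp add: F_def x_def[symmetric] w differential_eq c'_def[symmetric] d'_def[symmetric])
  have hx: "h x = V q" using q cd
    by (simp add: h_def x_def coord_section_def src.cinv_cmap d'_def)
  have cov: "cov_deriv B A \<Gamma> f V q v = fd h x w + \<Gamma> d' (f q) (fd F x w) (V q)"
    by (simp add: cov_deriv_def Let_def fd_h fd_F c'_def d'_def coord_section_def)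
  define N where "N = cmap c ` (cdom c \<inter> (U \<inter> f -` (cdom d \<inter> cdom d')))"
  have N: "open N" "x \<in> N"
    using cd cd' U q unfolding N_def x_def
    by (auto intro!: src.open_image open_Int open_vimage tgt.open_cdom)
  \<comment> \<open>The section in the chart \<open>d\<close> is the transition derivative applied
    to the section in \<open>d'\<close>; the product rule yields the inhomogeneous term that
    \<open>law\<close> absorbs.\<close>
  have "((\<lambda>y. fd (transition d' d) (F y) (h y)) has_derivative
      (\<lambda>u. fd (\<lambda>z. fd (transition d' d) z (h x)) (F x) (fd F x u) + fd (transition d' d) (F x) (fd h x u))) (at x)"
  proof (rule has_derivative_linear_app[OF N, where L = "\<lambda>y. fd (transition d' d) (F y)" and h = h
        and L' = "\<lambda>a u. fd (\<lambda>z. fd (transition d' d) z a) (F x) (fd F x u)" and h' = "fd h x"])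
    fix y assume "y \<in> N"
    then obtain q' where "y = cmap c q'" "q' \<in> cdom c" "f q' \<in> cdom d" "f q' \<in> cdom d'" by (auto simp: N_def)
    then show "linear (fd (transition d' d) (F y))"
      using tgt.linear_fd_transition[OF cd'(2) cd(2), of "f q'"] cd(1) by (simp add: F_def coord_map_cmap)
  next
    show "(h has_derivative fd h x) (at x)"
      unfolding h_def
      by (rule smooth_on_has_derivative[OF smooth_coord_section[OF V cd(1) cd'(2)]])
        (use cd cd' q U in \<open>auto simp: x_def\<close>)
    show "((\<lambda>y. fd (transition d' d) (F y) a) has_derivative
       (\<lambda>u. fd (\<lambda>z. fd (transition d' d) z a) (F x) (fd F x u))) (at x)" for a
    proof (rule has_derivative_compose[where f = F and f' = "fd F x"
          and g = "\<lambda>z. fd (transition d' d) z a" and g' = "fd (\<lambda>z. fd (transition d' d) z a) (F x)"])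
      show "(F has_derivative fd F x) (at x)"
        unfolding F_def by (rule smooth_on_has_derivative[OF smooth_coord_map[OF cd(1) cd'(2)]])
          (use cd' q in \<open>auto simp: chart_domain_def x_def\<close>)
      show "((\<lambda>z. fd (transition d' d) z a) has_derivative fd (\<lambda>z. fd (transition d' d) z a) (F x)) (at (F x))"
        by (rule smooth_on_has_derivative[OF smooth_on_fd[OF tgt.smooth_transition[OF cd'(2) cd(2)]]])
          (use cd cd' q in \<open>auto simp: F_def x_def coord_map_cmap\<close>)
    qed
  qed
  moreover have "fd (coord_section A c d f V) x = fd (\<lambda>y. fd (transition d' d) (F y) (h y)) x"
  proof (rule fd_cong_open[OF N])
    fix y assume "y \<in> N"
    then obtain q' where "y = cmap c q'" "q' \<in> cdom c" "f q' \<in> cdom d" "f q' \<in> cdom d'" by (auto simp: N_def)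
    then show "coord_section A c d f V y = fd (transition d' d) (F y) (h y)"
      using cd cd' tgt.tcoord_change[of d' d "f q'"]
      by (simp add: coord_section_def F_def coord_map_def h_def src.cinv_cmap)
  qed
  ultimately have fd_V: "fd (coord_section A c d f V) x w =
      fd (\<lambda>z. fd (transition d' d) z (V q)) (cmap d' (f q)) (fd F x w) + D (fd h x w)"
    using q cd by (simp add: fd_eqI hx[unfolded x_def] D_def F_def x_def coord_map_cmap)
  have law: "\<Gamma> d (f q) (D a) (D b) + fd (\<lambda>z. fd (transition d' d) z b) (cmap d' (f q)) a = D (\<Gamma> d' (f q) a b)" for a b
    using conn cd cd' q unfolding linear_connection_def D_def transition_def o_def Let_def by blast
  have "tcoord A d (f q) (cov_deriv B A \<Gamma> f V q v) = D (fd h x w) + D (\<Gamma> d' (f q) (fd F x w) (V q))"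
    unfolding tgt.tcoord_eq cov by (simp add: D_def[symmetric] d'_def[symmetric] linear_add[OF D])
  also have "\<dots> = fd (coord_section A c d f V) x w + \<Gamma> d (f q) (D (fd F x w)) (D (V q))"
    using fd_V law[of "fd F x w" "V q"] by (simp add: algebra_simps)
  also have "D (fd F x w) = fd (coord_map c d f) x w"
    using fd_coord_map_target[OF cd cd'(2) q cd'(4), of w] by (simp add: D_def F_def x_def)
  also have "D (V q) = coord_section A c d f V x"
    using q cd tgt.tcoord_eq[of d "f q"] by (simp add: D_def x_def coord_section_def src.cinv_cmap d'_def)
  finally show ?thesis
    using q cd by (simp add: cd_def x_def w_def coord_map_cmap tgt.cinv_cmap)
qed

end

section \<open>Ambient fields as sections along the identity\<close>

sublocale smooth_atlas \<subseteq> self: smooth_mapping A A id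
  by unfold_locales (rule smooth_map_id)

context smooth_atlas
begin

lemma smooth_bilinear_connection:
  assumes "linear_connection A \<Gamma>" "d \<in> A"
  shows "smooth_bilinear (cmap d ` cdom d) (\<lambda>y. \<Gamma> d (cinv d y))"
  using assms open_image_cdom cinv_mem by (auto simp: smooth_bilinear_def linear_connection_def)

definition coord_field :: "('p, 'e) chart \<Rightarrow> ('p \<Rightarrow> 'e) \<Rightarrow> 'e \<Rightarrow> 'e" where
  "coord_field d X = (\<lambda>x. tcoord A d (cinv d x) (X (cinv d x)))"

lemma smooth_coord_field:
  assumes "smooth_field_on A U X" "d \<in> A"
  shows "smooth_on (cmap d ` (cdom d \<inter> U)) (coord_field d X)"
  using self.smooth_coord_section[of U X d d] assms
  by (auto simp: smooth_field_on_def coord_section_def coord_field_def elim!: smooth_on_subset)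

lemma tcoord_nabla:
  assumes conn: "linear_connection A \<Gamma>" and d: "d \<in> A" and U: "open U" "p \<in> U"
    and Y: "smooth_field_on A U Y" and p: "p \<in> cdom d"
  shows "tcoord A d p (nabla A \<Gamma> X Y p) =
    cd (\<lambda>y. \<Gamma> d (cinv d y)) (\<lambda>x. x) (coord_field d Y) (cmap d p) (tcoord A d p (X p))"
proof -
  have "cd C (coord_map d d id) V (cmap d p) = cd C (\<lambda>x. x) V (cmap d p)" for C V
    by (rule cd_cong[OF open_image_cdom[OF d]]) (use d p in \<open>auto simp: coord_map_def cmap_cinv\<close>)
  then show ?thesis
    using self.tcoord_cov_deriv[OF conn d d U Y[unfolded smooth_field_on_def] p, of "X p"] p
    by (simp add: nabla_def coord_section_def coord_field_def)
qed

text \<open>Shows that \<open>curvature\<close> is tensorial. The inner covariant derivative is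
  needed on a neighbourhood of \<open>p\<close> in the chart selected at \<open>p\<close>, although
  nearby points may select other charts; \<open>tcoord_nabla\<close> bridges this, and
  \<open>curv_along\<close> for the identity does the rest.\<close>

lemma curvature_eq_curv:
  assumes conn: "linear_connection A \<Gamma>" and U: "open U" "p \<in> U"
    and X: "smooth_field_on A U X" and Y: "smooth_field_on A U Y" and Z: "smooth_field_on A U Z"
  defines "d \<equiv> chart_at A p"
  shows "curvature A \<Gamma> X Y Z p = curv (\<lambda>y. \<Gamma> d (cinv d y)) (cmap d p) (X p) (Y p) (Z p)"
proof -
  have d: "d \<in> A" "p \<in> cdom d" by (simp_all add: d_def chart_at)
  define C where "C = (\<lambda>y. \<Gamma> d (cinv d y))"
  define W where "W = cmap d ` (cdom d \<inter> U)"
  have W: "open W" "cmap d p \<in> W" "W \<subseteq> cmap d ` cdom d"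
    using d U by (auto simp: W_def open_image)
  have C: "smooth_bilinear (cmap d ` cdom d) C"
    unfolding C_def by (rule smooth_bilinear_connection[OF conn d(1)])
  have at_p: "coord_field d V (cmap d p) = V p" for V
    using d by (simp add: coord_field_def cinv_cmap) (simp add: d_def)
  have diff: "differential A A id p v = v" for v
  proof -
    have "fd (coord_map d d id) (cmap d p) = fd (\<lambda>x. x) (cmap d p)"
      by (rule fd_cong_open[OF open_image_cdom[OF d(1)]]) (use d in \<open>auto simp: coord_map_def cmap_cinv\<close>)
    then show ?thesis by (simp add: self.differential_eq d_def)
  qed
  have nabla: "nabla A \<Gamma> X' V p = cd C (\<lambda>x. x) (coord_field d V) (cmap d p) (X' p)" for X' V
    using d diff[of "X' p"] at_p[of V]
    by (simp add: nabla_def cov_deriv_def Let_def d_def[symmetric] cd_def C_def cinv_cmap coord_field_def)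
  have nabla2: "nabla A \<Gamma> X' (nabla A \<Gamma> Y' Z) p =
      cd C (\<lambda>x. x) (\<lambda>y. cd C (\<lambda>x. x) (coord_field d Z) y (coord_field d Y' y)) (cmap d p) (X' p)" for X' Y'
  proof -
    have "coord_field d (nabla A \<Gamma> Y' Z) y = cd C (\<lambda>x. x) (coord_field d Z) y (coord_field d Y' y)"
      if y: "y \<in> W" for y
    proof -
      obtain p' where p': "y = cmap d p'" "p' \<in> cdom d" "p' \<in> U" using y by (auto simp: W_def)
      then show ?thesis
        using tcoord_nabla[OF conn d(1) U(1) p'(3) Z p'(2), of Y'] d
        by (simp add: coord_field_def cinv_cmap C_def)
    qed
    then show ?thesis unfolding nabla by (intro fun_cong[OF cd_cong[OF W(1,2)]] refl)
  qed
  have bracket: "lie_bracket A X Y p =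
      fd (coord_field d Y) (cmap d p) (X p) - fd (coord_field d X) (cmap d p) (Y p)"
    by (simp add: lie_bracket_def Let_def d_def coord_field_def)
  show ?thesis
    using curv_along[OF C _ W(1,2) smooth_on_ident[OF W(1)]
        smooth_coord_field[OF Z d(1), folded W_def] smooth_coord_field[OF X d(1), folded W_def]
        smooth_coord_field[OF Y d(1), folded W_def]] W(3)
    by (simp add: curvature_def nabla[of "lie_bracket A X Y" Z] nabla2 bracket at_p C_def[symmetric])
qed

end

section \<open>Kaehler manifolds and space forms in charts\<close>

context smooth_atlas
begin

lemma coord_field_cfield: "d \<in> A \<Longrightarrow> y \<in> cmap d ` cdom d \<Longrightarrow> coord_field d (cfield A d a) y = a"
  by (simp add: coord_field_def cinv_mem)

lemma dir_deriv_eq: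
  assumes "d \<in> A" "p \<in> cdom d" "smooth_on (cmap d ` cdom d) (\<lambda>y. \<phi> (cinv d y))"
  shows "dir_deriv A \<phi> p v = fd (\<lambda>y. \<phi> (cinv d y)) (cmap d p) (tcoord A d p v)"
proof -
  define e where "e = chart_at A p"
  have e: "e \<in> A" "p \<in> cdom e" by (simp_all add: e_def chart_at)
  have "((\<lambda>y. \<phi> (cinv d (transition e d y))) has_derivative
      (\<lambda>v. fd (\<lambda>y. \<phi> (cinv d y)) (cmap d p) (fd (transition e d) (cmap e p) v))) (at (cmap e p))"
  proof (rule has_derivative_compose[where f = "transition e d" and f' = "fd (transition e d) (cmap e p)"
        and g = "\<lambda>y. \<phi> (cinv d y)" and g' = "fd (\<lambda>y. \<phi> (cinv d y)) (cmap d p)"])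
    show "(transition e d has_derivative fd (transition e d) (cmap e p)) (at (cmap e p))"
      by (rule transition_has_derivative[OF e(1) assms(1) e(2) assms(2)])
    show "((\<lambda>y. \<phi> (cinv d y)) has_derivative fd (\<lambda>y. \<phi> (cinv d y)) (cmap d p)) (at (transition e d (cmap e p)))"
      using smooth_on_has_derivative[OF assms(3), of "cmap d p"] e assms(2)
      by (simp add: transition_def cinv_cmap)
  qed
  moreover have "fd (\<lambda>y. \<phi> (cinv e y)) (cmap e p) = fd (\<lambda>y. \<phi> (cinv d (transition e d y))) (cmap e p)"
    by (rule fd_cong_open[OF open_image[OF e(1) open_cdom[OF assms(1)]]])
      (use e assms in \<open>auto simp: transition_def cinv_cmap\<close>)
  ultimately show ?thesis
    by (simp add: dir_deriv_def o_def e_def[symmetric] fd_eqI tcoord_eq)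
qed

text \<open>In the selected chart the coordinates of these fields are first derivatives of a
  transition map, so the bracket is a difference of its mixed second derivatives.\<close>

lemma lie_bracket_cfield:
  assumes d: "d \<in> A" "p \<in> cdom d"
  shows "lie_bracket A (cfield A d a) (cfield A d b) p = 0"
proof -
  define e where "e = chart_at A p"
  have e: "e \<in> A" "p \<in> cdom e" by (simp_all add: e_def chart_at)
  have cf: "fd (coord_field e (cfield A d b)) (cmap e p) (cfield A d a p) =
      fd (\<lambda>z. fd (transition d e) z b) (cmap d p) a" for a b
  proof -
    have "((\<lambda>y. fd (transition d e) (transition e d y) b) has_derivative
      (\<lambda>v. fd (\<lambda>z. fd (transition d e) z b) (cmap d p) (fd (transition e d) (cmap e p) v))) (at (cmap e p))"
    proof (rule has_derivative_compose[where f = "transition e d" and f' = "fd (transition e d) (cmap e p)"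
        and g = "\<lambda>z. fd (transition d e) z b" and g' = "fd (\<lambda>z. fd (transition d e) z b) (cmap d p)"])
      show "(transition e d has_derivative fd (transition e d) (cmap e p)) (at (cmap e p))"
        by (rule transition_has_derivative[OF e(1) d(1) e(2) d(2)])
      show "((\<lambda>z. fd (transition d e) z b) has_derivative fd (\<lambda>z. fd (transition d e) z b) (cmap d p))
          (at (transition e d (cmap e p)))"
        using smooth_on_has_derivative[OF smooth_on_fd[OF smooth_transition[OF d(1) e(1)]], of "cmap d p"] e d
        by (simp add: transition_def cinv_cmap)
    qed
    moreover have "fd (coord_field e (cfield A d b)) (cmap e p) =
        fd (\<lambda>y. fd (transition d e) (transition e d y) b) (cmap e p)"
      by (rule fd_cong_open[OF open_image[OF e(1) open_cdom[OF d(1)]]])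
        (use e d in \<open>auto simp: transition_def[of e d] coord_field_def coord_section_cfield cinv_cmap\<close>)
    moreover have "fd (transition e d) (cmap e p) (cfield A d a p) = a"
      using tcoord_cfield[OF d, of a] by (simp add: tcoord_eq e_def)
    ultimately show ?thesis by (simp add: fd_eqI)
  qed
  have "lie_bracket A (cfield A d a) (cfield A d b) p =
      fd (coord_field e (cfield A d b)) (cmap e p) (cfield A d a p)
      - fd (coord_field e (cfield A d a)) (cmap e p) (cfield A d b p)"
    by (simp add: lie_bracket_def Let_def e_def coord_field_def)
  then show ?thesis
    using fd_commute[OF open_image[OF d(1) open_cdom[OF e(1)]] smooth_transition[OF d(1) e(1)], of "cmap d p" a b] d e
    by (simp add: cf)
qed

lemma tcoord_nabla_cfield:
  assumes conn: "linear_connection A \<Gamma>" and d: "d \<in> A" "p \<in> cdom d"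
    and Y: "smooth_field_on A (cdom d) Y"
  shows "tcoord A d p (nabla A \<Gamma> (cfield A d w) Y p) =
    fd (coord_field d Y) (cmap d p) w + \<Gamma> d p w (tcoord A d p (Y p))"
  using tcoord_nabla[OF conn d(1) open_cdom[OF d(1)] d(2) Y d(2), of "cfield A d w"] d
  by (simp add: cd_def cinv_cmap coord_field_def)

lemma tcoord_nabla_cfield_cfield:
  assumes conn: "linear_connection A \<Gamma>" and d: "d \<in> A" "p \<in> cdom d"
  shows "tcoord A d p (nabla A \<Gamma> (cfield A d w) (cfield A d a) p) = \<Gamma> d p w a"
  using tcoord_nabla_cfield[OF conn d smooth_field_cfield[OF d(1)], of w a] d
    fd_cong_open[OF open_image_cdom[OF d(1)], of "cmap d p" "coord_field d (cfield A d a)" "\<lambda>y. a"]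
  by (simp add: coord_field_cfield)

end

section \<open>Kaehler manifolds read in a chart\<close>

locale kaehler_manifold =
  fixes A :: "('p::{t2_space,second_countable_topology}, 'e::euclidean_space) chart set"
    and g :: "'p \<Rightarrow> 'e \<Rightarrow> 'e \<Rightarrow> real"
    and J :: "'p \<Rightarrow> 'e \<Rightarrow> 'e"
    and \<Gamma> :: "('p, 'e) connection"
  assumes kaehler: "indefinite_kaehler_manifold A g J \<Gamma>"

sublocale kaehler_manifold \<subseteq> smooth_atlas A
  using kaehler by unfold_locales (simp add: indefinite_kaehler_manifold_def)

context kaehler_manifold
begin

lemma connection: "linear_connection A \<Gamma>"
  using kaehler by (simp add: indefinite_kaehler_manifold_def levi_civita_def)

lemma
  shows bilinear_g: "bilinear (g p)" and g_commute: "g p v w = g p w v"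
    and nondegenerate_g: "nondegenerate_on (g p) UNIV"
    and smooth_fun_g: "open U \<Longrightarrow> smooth_field_on A U X \<Longrightarrow> smooth_field_on A U Y \<Longrightarrow>
        smooth_fun_on A U (\<lambda>p. g p (X p) (Y p))"
proof -
  obtain \<nu> where "semi_riemannian_metric A g \<nu>"
    using kaehler by (auto simp: indefinite_kaehler_manifold_def)
  then show "bilinear (g p)" "g p v w = g p w v" "nondegenerate_on (g p) UNIV"
    "open U \<Longrightarrow> smooth_field_on A U X \<Longrightarrow> smooth_field_on A U Y \<Longrightarrow> smooth_fun_on A U (\<lambda>p. g p (X p) (Y p))"
    by (simp_all add: semi_riemannian_metric_def)
qed

lemma
  shows linear_J: "linear (J p)" and J_J: "J p (J p v) = - v"
    and smooth_field_J: "open U \<Longrightarrow> smooth_field_on A U X \<Longrightarrow> smooth_field_on A U (\<lambda>p. J p (X p))"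
    and g_J: "g p (J p v) (J p w) = g p v w"
    and nabla_J: "open U \<Longrightarrow> smooth_field_on A U X \<Longrightarrow> smooth_field_on A U Y \<Longrightarrow> p \<in> U \<Longrightarrow>
        nabla A \<Gamma> X (\<lambda>p. J p (Y p)) p = J p (nabla A \<Gamma> X Y p)"
proof -
  have "\<forall>p. linear (J p) \<and> (\<forall>v. J p (J p v) = - v)"
    and sm: "\<forall>U X. open U \<longrightarrow> smooth_field_on A U X \<longrightarrow> smooth_field_on A U (\<lambda>p. J p (X p))"
    and "\<forall>p v w. g p (J p v) (J p w) = g p v w"
    and par: "\<forall>U X Y. open U \<longrightarrow> smooth_field_on A U X \<longrightarrow> smooth_field_on A U Y \<longrightarrow>
       (\<forall>p\<in>U. nabla A \<Gamma> X (\<lambda>p. J p (Y p)) p = J p (nabla A \<Gamma> X Y p))"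
    using kaehler unfolding indefinite_kaehler_manifold_def almost_complex_structure_def
    by - (elim conjE, assumption)+
  then show "linear (J p)" "J p (J p v) = - v" "g p (J p v) (J p w) = g p v w" by simp_all
  show "open U \<Longrightarrow> smooth_field_on A U X \<Longrightarrow> smooth_field_on A U (\<lambda>p. J p (X p))"
    by (rule sm[rule_format])
  show "open U \<Longrightarrow> smooth_field_on A U X \<Longrightarrow> smooth_field_on A U Y \<Longrightarrow> p \<in> U \<Longrightarrow>
        nabla A \<Gamma> X (\<lambda>p. J p (Y p)) p = J p (nabla A \<Gamma> X Y p)"
    by (rule par[rule_format])
qed

lemma
  assumes "open U" "smooth_field_on A U X" "smooth_field_on A U Y" "p \<in> U"
  shows torsion_free: "nabla A \<Gamma> X Y p - nabla A \<Gamma> Y X p = lie_bracket A X Y p"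
    and metric_connection: "smooth_field_on A U Z \<Longrightarrow>
      dir_deriv A (\<lambda>p. g p (Y p) (Z p)) p (X p)
        = g p (nabla A \<Gamma> X Y p) (Z p) + g p (Y p) (nabla A \<Gamma> X Z p)"
proof -
  have tor: "\<forall>U X Y. open U \<longrightarrow> smooth_field_on A U X \<longrightarrow> smooth_field_on A U Y \<longrightarrow>
        (\<forall>p\<in>U. nabla A \<Gamma> X Y p - nabla A \<Gamma> Y X p = lie_bracket A X Y p)"
    and met: "\<forall>U X Y Z. open U \<longrightarrow> smooth_field_on A U X \<longrightarrow> smooth_field_on A U Y \<longrightarrow> smooth_field_on A U Z \<longrightarrow>
        (\<forall>p\<in>U. dir_deriv A (\<lambda>p. g p (Y p) (Z p)) p (X p)
                = g p (nabla A \<Gamma> X Y p) (Z p) + g p (Y p) (nabla A \<Gamma> X Z p))"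
    using kaehler unfolding indefinite_kaehler_manifold_def levi_civita_def
    by - (elim conjE, assumption)+
  show "nabla A \<Gamma> X Y p - nabla A \<Gamma> Y X p = lie_bracket A X Y p"
    by (rule tor[rule_format, OF assms])
  show "dir_deriv A (\<lambda>p. g p (Y p) (Z p)) p (X p)
        = g p (nabla A \<Gamma> X Y p) (Z p) + g p (Y p) (nabla A \<Gamma> X Z p)" if "smooth_field_on A U Z"
    by (rule met[rule_format, OF assms(1-3) that assms(4)])
qed

text \<open>\<open>g p\<close> acts on coordinates in the chart selected at \<open>p\<close>, so it
  cannot be differentiated in \<open>p\<close> directly. Passing through \<open>cfield\<close>
  refers it to the fixed chart \<open>d\<close>; \<open>coord_J\<close> does the same for
  \<open>J\<close>.\<close>

definition coord_metric :: "('p, 'e) chart \<Rightarrow> 'e \<Rightarrow> 'e \<Rightarrow> 'e \<Rightarrow> real" where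
  "coord_metric d y a b = g (cinv d y) (cfield A d a (cinv d y)) (cfield A d b (cinv d y))"

definition coord_J :: "('p, 'e) chart \<Rightarrow> 'e \<Rightarrow> 'e \<Rightarrow> 'e" where
  "coord_J d y a = tcoord A d (cinv d y) (J (cinv d y) (cfield A d a (cinv d y)))"

lemma coord_metric_tcoord:
  "d \<in> A \<Longrightarrow> p \<in> cdom d \<Longrightarrow> coord_metric d (cmap d p) (tcoord A d p v) (tcoord A d p w) = g p v w"
  by (simp add: coord_metric_def cinv_cmap)

lemma bilinear_coord_metric: "d \<in> A \<Longrightarrow> y \<in> cmap d ` cdom d \<Longrightarrow> bilinear (coord_metric d y)"
  using bilinear_g[of "cinv d y"] linear_cfield[of d "cinv d y"] cinv_mem[of d y]
    linear_compose[of "\<lambda>a. cfield A d a (cinv d y)"]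
  unfolding bilinear_def coord_metric_def by (fastforce simp: o_def)

lemma smooth_bilinear_coord_metric:
  assumes d: "d \<in> A" shows "smooth_bilinear (cmap d ` cdom d) (coord_metric d)"
proof -
  have "smooth_on (cmap d ` cdom d) (\<lambda>y. coord_metric d y a b)" for a b
    using smooth_fun_g[OF open_cdom[OF d] smooth_field_cfield[OF d] smooth_field_cfield[OF d]] d
    unfolding smooth_fun_on_def coord_metric_def o_def by fastforce
  then show ?thesis
    using d by (simp add: smooth_bilinear_def open_image_cdom bilinear_coord_metric)
qed

lemma coord_metric_commute: "coord_metric d y a b = coord_metric d y b a"
  by (simp add: coord_metric_def g_commute)

lemma nondegenerate_coord_metric:
  assumes d: "d \<in> A" "y \<in> cmap d ` cdom d"
  shows "nondegenerate_on (coord_metric d y) UNIV"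
  unfolding nondegenerate_on_def
proof (intro ballI impI)
  fix a assume 0: "\<forall>b\<in>UNIV. coord_metric d y a b = 0"
  define p where "p = cinv d y"
  have p: "p \<in> cdom d" using cinv_mem[OF d] by (simp add: p_def)
  have "g p (cfield A d a p) v = 0" for v
    using 0 cfield_tcoord[OF d(1) p, of v] by (metis coord_metric_def p_def UNIV_I)
  then have "cfield A d a p = 0"
    using nondegenerate_g[of p] by (auto simp: nondegenerate_on_def)
  then show "a = 0"
    using tcoord_cfield[OF d(1) p, of a] linear_0[OF linear_tcoord[OF d(1) p]] by simp
qed

text \<open>Metric compatibility on coordinate fields, whose covariant derivatives are the
  Christoffel symbols.\<close>

lemma coord_metric_compatible:
  assumes d: "d \<in> A" and y: "y \<in> cmap d ` cdom d"
  shows "fd (\<lambda>z. coord_metric d z a b) y w =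
    coord_metric d y (\<Gamma> d (cinv d y) w a) b + coord_metric d y a (\<Gamma> d (cinv d y) w b)"
proof -
  define p where "p = cinv d y"
  have p: "p \<in> cdom d" "cmap d p = y" using cinv_mem[OF d y] cmap_cinv[OF d y] by (simp_all add: p_def)
  have nabla: "nabla A \<Gamma> (cfield A d w) (cfield A d a) p = cfield A d (\<Gamma> d p w a) p" for a
    using tcoord_nabla_cfield_cfield[OF connection d p(1), of w a] cfield_tcoord[OF d p(1)] by metis
  have "fd (\<lambda>z. coord_metric d z a b) y w =
      dir_deriv A (\<lambda>p. g p (cfield A d a p) (cfield A d b p)) p (cfield A d w p)"
    using dir_deriv_eq[OF d p(1), of "\<lambda>p. g p (cfield A d a p) (cfield A d b p)" "cfield A d w p"]
      smooth_bilinear_coord_metric[OF d] p d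
    by (simp add: smooth_bilinear_def coord_metric_def)
  also have "\<dots> = g p (cfield A d (\<Gamma> d p w a) p) (cfield A d b p) + g p (cfield A d a p) (cfield A d (\<Gamma> d p w b) p)"
    unfolding nabla[symmetric]
    by (rule metric_connection[OF open_cdom[OF d]]) (intro smooth_field_cfield d p)+
  finally show ?thesis by (simp add: coord_metric_def p_def)
qed

text \<open>Vanishing torsion on coordinate fields, whose bracket is zero.\<close>

lemma connection_symmetric:
  assumes d: "d \<in> A" "p \<in> cdom d"
  shows "\<Gamma> d p u v = \<Gamma> d p v u"
proof -
  have "nabla A \<Gamma> (cfield A d u) (cfield A d v) p = nabla A \<Gamma> (cfield A d v) (cfield A d u) p"
    using torsion_free[OF open_cdom[OF d(1)] smooth_field_cfield[OF d(1)] smooth_field_cfield[OF d(1)] d(2), of u v]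
      lie_bracket_cfield[OF d, of u v] by simp
  then show ?thesis
    using tcoord_nabla_cfield_cfield[OF connection d] by metis
qed

lemma linear_coord_J: "d \<in> A \<Longrightarrow> y \<in> cmap d ` cdom d \<Longrightarrow> linear (coord_J d y)"
  unfolding coord_J_def
  using linear_compose[OF linear_compose[OF linear_cfield linear_J] linear_tcoord] cinv_mem
  by (auto simp: o_def)

lemma coord_J_eq: "(\<lambda>y. coord_J d y a) = coord_field d (\<lambda>p. J p (cfield A d a p))"
  by (simp add: coord_field_def coord_J_def)

lemma smooth_coord_J: "d \<in> A \<Longrightarrow> smooth_on (cmap d ` cdom d) (\<lambda>y. coord_J d y a)"
  unfolding coord_J_eq
  using smooth_coord_field[OF smooth_field_J[OF open_cdom smooth_field_cfield]] by fastforce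

lemma coord_J_parallel:
  assumes d: "d \<in> A" and y: "y \<in> cmap d ` cdom d"
  shows "fd (\<lambda>z. coord_J d z a) y w + \<Gamma> d (cinv d y) w (coord_J d y a) = coord_J d y (\<Gamma> d (cinv d y) w a)"
proof -
  define p where "p = cinv d y"
  have p: "p \<in> cdom d" "cmap d p = y" using cinv_mem[OF d y] cmap_cinv[OF d y] by (simp_all add: p_def)
  have nabla: "nabla A \<Gamma> (cfield A d w) (cfield A d a) p = cfield A d (\<Gamma> d p w a) p"
    using tcoord_nabla_cfield_cfield[OF connection d p(1), of w a] cfield_tcoord[OF d p(1)] by metis
  have "fd (\<lambda>z. coord_J d z a) y w + \<Gamma> d p w (coord_J d y a) =
      tcoord A d p (nabla A \<Gamma> (cfield A d w) (\<lambda>p. J p (cfield A d a p)) p)"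
    using tcoord_nabla_cfield[OF connection d p(1)
        smooth_field_J[OF open_cdom[OF d] smooth_field_cfield[OF d]], of w a] p
    by (simp add: coord_J_eq) (simp add: coord_J_def p_def)
  also have "nabla A \<Gamma> (cfield A d w) (\<lambda>p. J p (cfield A d a p)) p = J p (cfield A d (\<Gamma> d p w a) p)"
    unfolding nabla[symmetric]
    by (rule nabla_J[OF open_cdom[OF d] smooth_field_cfield[OF d] smooth_field_cfield[OF d] p(1)])
  finally show ?thesis by (simp add: coord_J_def p_def)
qed

lemma kaehler_form_curv:
  defines "d p \<equiv> chart_at A p"
  defines "K p \<equiv> \<lambda>u v w z. g p (curv (\<lambda>y. \<Gamma> (d p) (cinv (d p) y)) (cmap (d p) p) u v w) z"
  shows "kaehler_form (J p) (K p)"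
proof -
  define e x Q C where "e = d p" and "x = cmap e p" and "Q = cmap e ` cdom e"
    and "C = (\<lambda>y. \<Gamma> e (cinv e y))"
  have e: "e \<in> A" "p \<in> cdom e" "x \<in> Q" by (simp_all add: e_def d_def chart_at x_def Q_def)
  have cinv: "cinv e x = p" using e by (simp add: x_def cinv_cmap)
  have C: "smooth_bilinear Q C"
    unfolding Q_def C_def by (rule smooth_bilinear_connection[OF connection e(1)])
  have Kp: "K p = (\<lambda>u v w z. g p (curv C x u v w) z)"
    by (simp add: K_def C_def x_def e_def)
  \<comment> \<open>At \<open>p\<close> itself the chart \<open>e\<close> is the selected one, so
    coordinate vectors and tangent vectors coincide.\<close>
  have at_p: "coord_metric e x = g p" "coord_J e x = J p"
    by (intro ext, simp add: coord_metric_def coord_J_def cinv, simp add: e_def d_def)+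
  have skew: "g p (curv C x u v a) b = - g p a (curv C x u v b)" for u v a b
  proof -
    have "coord_metric e x (curv C x u v a) b + coord_metric e x a (curv C x u v b) = 0"
      by (rule curv_skew_adjoint[OF C smooth_bilinear_coord_metric[OF e(1), folded Q_def] _ e(3)])
        (use coord_metric_compatible[OF e(1)] in \<open>simp add: Q_def C_def\<close>)
    then show ?thesis by (simp add: at_p)
  qed
  have bianchi: "curv C x u v w + curv C x v w u + curv C x w u v = 0" for u v w
    by (rule curv_bianchi[OF C e(3)]) (use e(1) connection_symmetric cinv_mem in \<open>auto simp: Q_def C_def\<close>)
  have commute: "curv C x u v (J p w) = J p (curv C x u v w)" for u v w
  proof -
    have "curv C x u v (coord_J e x w) = coord_J e x (curv C x u v w)"
      by (rule curv_commute[OF C _ _ _ e(3)])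
        (use e(1) linear_coord_J smooth_coord_J coord_J_parallel in \<open>auto simp: Q_def C_def\<close>)
    then show ?thesis by (simp add: at_p)
  qed
  note bil = bilinear_g[of p]
  have lin_g: "linear (\<lambda>v. g p v z)" "linear (g p v)" for v z
    using bil by (simp_all add: bilinear_def)
  note lin_curv = linear_curv[OF C e(3)]
  show ?thesis unfolding Kp
  proof (rule kaehler_form.intro)
    show "linear (\<lambda>u. g p (curv C x u v w) z)" for v w z
      using linear_compose[OF lin_curv(1) lin_g(1)] by (simp add: o_def)
    show "linear (\<lambda>v. g p (curv C x u v w) z)" for u w z
      using linear_compose[OF lin_curv(2) lin_g(1)] by (simp add: o_def)
    show "linear (\<lambda>w. g p (curv C x u v w) z)" for u v z
      using linear_compose[OF lin_curv(3) lin_g(1)] by (simp add: o_def)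
    show "linear (\<lambda>z. g p (curv C x u v w) z)" for u v w
      using lin_g(2) .
    show "g p (curv C x u v w) z = - g p (curv C x v u w) z" for u v w z
      by (subst curv_swap) (simp add: bilinear_lneg[OF bil])
    show "g p (curv C x u v w) z = - g p (curv C x u v z) w" for u v w z
      using skew g_commute by metis
    show "g p (curv C x u v w) z + g p (curv C x v w u) z + g p (curv C x w u v) z = 0" for u v w z
      using bianchi[of u v w] bilinear_lzero[OF bil, of z] by (simp flip: bilinear_ladd[OF bil])
    show "g p (curv C x u v (J p w)) (J p z) = g p (curv C x u v w) z" for u v w z
      by (simp add: commute g_J)
  qed (auto simp: linear_J J_J)
qed

text \<open>The hypothesis concerns a quotient formed with vector fields. A coordinate field extends
  \<open>u\<close>, and since \<open>u\<close> and \<open>J p u\<close> are orthogonal of equal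
  square, the denominator is the square of \<open>g p u u\<close>.\<close>

lemma space_form_curvature:
  assumes c: "constant_holomorphic_sectional_curvature A g J \<Gamma> c"
  defines "d p \<equiv> chart_at A p"
  shows "g p (curv (\<lambda>y. \<Gamma> (d p) (cinv (d p) y)) (cmap (d p) p) u (J p u) w) z =
    c / 4 * (g p (J p u) w * g p u z - g p u w * g p (J p u) z
      - g p u w * g p (J p u) z + g p (J p u) w * g p u z - 2 * g p u u * g p (J p w) z)"
proof (rule constant_holomorphic_curvature[OF _ bilinear_g g_commute g_J nondegenerate_g])
  show "kaehler_form (J p) (\<lambda>u v w z. g p (curv (\<lambda>y. \<Gamma> (d p) (cinv (d p) y)) (cmap (d p) p) u v w) z)"
    unfolding d_def by (rule kaehler_form_curv)
  fix u assume u: "g p u u \<noteq> 0"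
  define X where "X = cfield A (d p) u"
  have dp: "d p \<in> A" "p \<in> cdom (d p)" by (simp_all add: d_def chart_at)
  have X: "smooth_field_on A (cdom (d p)) X" "X p = u"
    using smooth_field_cfield[OF dp(1)] by (simp_all add: X_def) (simp add: d_def)
  note U = open_cdom[OF dp(1)]
  note JX = smooth_field_J[OF U X(1)]
  have "g p u (J p u) = 0"
  proof -
    have "g p u (J p u) = g p (J p u) (J p (J p u))" by (simp only: g_J)
    then show ?thesis using g_commute[of p u "J p u"] by (simp add: J_J bilinear_rneg[OF bilinear_g])
  qed
  moreover have "sectional_curvature A g \<Gamma> X (\<lambda>p. J p (X p)) p = c"
    using c U X dp(2) u unfolding constant_holomorphic_sectional_curvature_def by blast
  ultimately show "g p (curv (\<lambda>y. \<Gamma> (d p) (cinv (d p) y)) (cmap (d p) p) u (J p u) (J p u)) u = c * (g p u u)\<^sup>2"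
    using curvature_eq_curv[OF connection U dp(2) X(1) JX JX] u
    by (simp add: sectional_curvature_def X(2) g_J d_def field_simps power2_eq_square)
qed

end

section \<open>Lightlike submanifolds\<close>

context smooth_mapping
begin

lemma smooth_section_sum:
  assumes U: "open U" and I: "finite I" and s: "\<And>i. i \<in> I \<Longrightarrow> smooth_section_on B A f U (s i)"
  shows "smooth_section_on B A f U (\<lambda>q. \<Sum>i\<in>I. a i *\<^sub>R s i q)"
  unfolding smooth_section_on_def
proof (intro ballI)
  fix c d assume cd: "c \<in> B" "d \<in> A"
  define W where "W = cmap c ` (cdom c \<inter> U \<inter> f -` cdom d)"
  have W: "open W" unfolding W_def by (rule open_section_domain[OF U cd])
  have "tcoord A d (f (cinv c x)) (\<Sum>i\<in>I. a i *\<^sub>R s i (cinv c x))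
      = (\<Sum>i\<in>I. a i *\<^sub>R coord_section A c d f (s i) x)" if "x \<in> W" for x
    using that cd tgt.linear_tcoord[OF cd(2), of "f (cinv c x)"]
    by (auto simp: W_def coord_section_def src.cinv_cmap linear_sum linear_scale)
  moreover have "smooth_on W (\<lambda>x. \<Sum>i\<in>I. a i *\<^sub>R coord_section A c d f (s i) x)"
    using smooth_coord_section[OF s cd]
    by (intro smooth_on_sum W I smooth_on_scaleR) (simp add: W_def)
  ultimately show "smooth_on (cmap c ` (cdom c \<inter> U \<inter> f -` cdom d))
      (\<lambda>x. tcoord A d (f (cinv c x)) (\<Sum>i\<in>I. a i *\<^sub>R s i (cinv c x)))"
    unfolding W_def[symmetric] by (subst smooth_on_cong[OF W])
qed

lemma smooth_section_subset:
  "smooth_section_on B A f U V \<Longrightarrow> U' \<subseteq> U \<Longrightarrow> smooth_section_on B A f U' V"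
  unfolding smooth_section_on_def by (blast intro: smooth_on_subset)

lemma smooth_section_add:
  assumes "open U" "smooth_section_on B A f U V" "smooth_section_on B A f U V'"
  shows "smooth_section_on B A f U (\<lambda>q. V q + V' q)"
proof -
  have "smooth_section_on B A f U (\<lambda>q. \<Sum>i\<in>UNIV. 1 *\<^sub>R (if i then V else V') q)"
    by (rule smooth_section_sum[OF assms(1)]) (use assms(2,3) in auto)
  then show ?thesis by (simp add: UNIV_bool add.commute)
qed

lemma subbundle_subspace: "subbundle B A f E \<Longrightarrow> subspace (E q)"
  unfolding subbundle_def subbundle_rank_def local_frame_def by (metis subspace_span)

text \<open>Constant coefficients in a local frame extend a single vector to a section of the same
  bundle.\<close>

lemma subbundle_section:
  assumes "subbundle B A f E" "v \<in> E q"
  obtains U V where "open U" "q \<in> U" "smooth_section_on B A f U V" "V q = v" "\<And>q'. q' \<in> U \<Longrightarrow> V q' \<in> E q'"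
proof -
  obtain k U s where U: "open U" "q \<in> U" and s: "local_frame B A f U k s E"
    using assms(1) unfolding subbundle_def subbundle_rank_def by blast
  have "v \<in> span ((\<lambda>i. s i q) ` {..<k})" "inj_on (\<lambda>i. s i q) {..<k}"
    using s U assms(2) by (auto simp: local_frame_def)
  then obtain a where a: "v = (\<Sum>i<k. a (s i q) *\<^sub>R s i q)"
    by (auto simp: span_finite sum.reindex)
  show ?thesis
  proof (rule that[OF U])
    show "smooth_section_on B A f U (\<lambda>q'. \<Sum>i<k. a (s i q) *\<^sub>R s i q')"
      using s by (intro smooth_section_sum U) (auto simp: local_frame_def)
    show "(\<Sum>i<k. a (s i q) *\<^sub>R s i q') \<in> E q'" if "q' \<in> U" for q'
    proof -
      have "E q' = span ((\<lambda>i. s i q') ` {..<k})" using s that by (simp add: local_frame_def)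
      then show ?thesis by (auto intro!: span_sum span_scale intro: span_base)
    qed
  qed (rule a[symmetric])
qed

text \<open>Properness provides nonzero fibres of \<open>D2\<close> and \<open>D0\<close> at
  possibly different points; constant rank allows a common point to be used.\<close>

lemma subbundle_nonzero:
  assumes "subbundle B A f E" "E q \<noteq> {0}" shows "E q' \<noteq> {0}"
proof -
  obtain k where k: "subbundle_rank B A f k E" using assms(1) by (auto simp: subbundle_def)
  have "dim (E q) = k" for q
  proof -
    obtain U s where "q \<in> U" "local_frame B A f U k s E" using k unfolding subbundle_rank_def by blast
    then have s: "inj_on (\<lambda>i. s i q) {..<k}" "independent ((\<lambda>i. s i q) ` {..<k})"
      "span ((\<lambda>i. s i q) ` {..<k}) = E q"
      by (auto simp: local_frame_def)
    show ?thesis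
      using dim_span_eq_card_independent[OF s(2)] card_image[OF s(1)] by (simp add: s(3))
  qed
  then have "dim (E q') = dim (E q)" by simp
  moreover have "\<not> E q \<subseteq> {0}"
    using assms(2) subspace_0[OF subbundle_subspace[OF assms(1)], of q] by blast
  ultimately have "\<not> E q' \<subseteq> {0}" by (metis dim_eq_0)
  then show ?thesis by blast
qed

lemma smooth_section_differential:
  assumes U: "open U" and Y: "smooth_field_on B U Y"
  shows "smooth_section_on B A f U (\<lambda>q. differential B A f q (Y q))"
  unfolding smooth_section_on_def
proof (intro ballI)
  fix c d assume cd: "c \<in> B" "d \<in> A"
  define W where "W = cmap c ` (cdom c \<inter> U \<inter> f -` cdom d)"
  have W: "open W" unfolding W_def by (rule open_section_domain[OF U cd])
  have "tcoord A d (f (cinv c x)) (differential B A f (cinv c x) (Y (cinv c x)))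
      = fd (coord_map c d f) x (src.coord_field c Y x)" if "x \<in> W" for x
    using that cd by (auto simp: W_def tcoord_differential src.coord_field_def src.cinv_cmap)
  moreover have "smooth_on W (\<lambda>x. fd (coord_map c d f) x (src.coord_field c Y x))"
  proof (rule smooth_on_fd_app[OF W])
    show "smooth_on W (coord_map c d f)"
      by (rule smooth_on_subset[OF smooth_coord_map[OF cd]]) (auto simp: W_def chart_domain_def)
    show "smooth_on W (src.coord_field c Y)"
      by (rule smooth_on_subset[OF src.smooth_coord_field[OF Y cd(1)]]) (auto simp: W_def)
  qed
  ultimately show "smooth_on (cmap c ` (cdom c \<inter> U \<inter> f -` cdom d))
      (\<lambda>x. tcoord A d (f (cinv c x)) (differential B A f (cinv c x) (Y (cinv c x))))"
    unfolding W_def[symmetric] by (subst smooth_on_cong[OF W])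
qed

lemma range_fd_coord_map:
  assumes "c \<in> B" "d \<in> A" "q \<in> cdom c" "f q \<in> cdom d"
  shows "range (fd (coord_map c d f) (cmap c q)) = tcoord A d (f q) ` tangent_bundle B A f q"
proof -
  have "range (tcoord B c q) = UNIV" using src.tcoord_cfield[OF assms(1,3)] by (rule surjI)
  then show ?thesis
    by (auto simp: tangent_bundle_def tcoord_differential[OF assms] image_iff) (metis surjD)
qed

lemma subspace_tangent_bundle: "subspace (tangent_bundle B A f q)"
  unfolding tangent_bundle_def by (intro linear_subspace_image linear_differential subspace_UNIV)

end

section \<open>Lightlike submanifolds of a Kaehler manifold\<close>

locale lightlike_in_kaehler = kaehler_manifold A g J \<Gamma>
  for A :: "('p::{t2_space,second_countable_topology}, 'e::euclidean_space) chart set" and g J \<Gamma> +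
  fixes B :: "('q::{t2_space,second_countable_topology}, 'd::euclidean_space) chart set"
    and f :: "'q \<Rightarrow> 'p" and ST STp ltr :: "('q, 'e) vbundle"
  assumes lightlike: "lightlike_submanifold B A g f ST STp ltr"

sublocale lightlike_in_kaehler \<subseteq> smooth_mapping B A f
  by unfold_locales (use lightlike in \<open>auto simp: lightlike_submanifold_def immersed_submanifold_def\<close>)

context lightlike_in_kaehler
begin

lemma
  shows subbundle_ST: "subbundle B A f ST" and subbundle_STp: "subbundle B A f STp"
    and nondegenerate_ST: "nondegenerate_on (g (f q)) (ST q)"
    and nondegenerate_STp: "nondegenerate_on (g (f q)) (STp q)"
    and tangent_sum: "orth_direct_sum (g (f q)) (tangent_bundle B A f q) (ST q) (radical B A g f q)"
    and normal_sum: "orth_direct_sum (g (f q)) (normal_bundle B A g f q) (STp q) (radical B A g f q)"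
    and ltr_sum: "direct_sum (orth (g (f q)) (ST q + STp q)) (radical B A g f q) (ltr q)"
  using lightlike unfolding lightlike_submanifold_def by simp_all

lemma
  shows subbundle_ltr: "subbundle B A f ltr" and subbundle_radical: "subbundle B A f (radical B A g f)"
proof -
  obtain r where r: "subbundle_rank B A f r ltr"
    "\<forall>q. \<exists>U \<xi> N. open U \<and> q \<in> U \<and> local_frame B A f U r \<xi> (radical B A g f) \<and> local_frame B A f U r N ltr \<and>
             (\<forall>q'\<in>U. \<forall>i<r. \<forall>j<r.
                g (f q') (\<xi> i q') (N j q') = (if i = j then 1 else 0) \<and>
                g (f q') (N i q') (N j q') = 0)"
    using lightlike unfolding lightlike_submanifold_def by (elim conjE exE) simp
  show "subbundle B A f ltr" using r(1) by (auto simp: subbundle_def)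
  show "subbundle B A f (radical B A g f)"
    unfolding subbundle_def subbundle_rank_def using r(2) by meson
qed

lemma transversal_decomposition: "\<exists>!t. t \<in> ltr q + STp q \<and> v - t \<in> tangent_bundle B A f q"
  by (rule lightlike_transversal_decomposition[OF bilinear_g g_commute nondegenerate_g, of "ST q"])
    (use subbundle_ST subbundle_STp subbundle_ltr subspace_tangent_bundle nondegenerate_ST nondegenerate_STp
      tangent_sum[of q] normal_sum[of q] ltr_sum[of q]
      in \<open>auto simp: subbundle_subspace radical_def normal_bundle_def\<close>)

text \<open>The normal bundle comes without frames of its own, but it is the sum of
  \<open>STp\<close> and the radical, each of which has local frames.\<close>

lemma normal_section:
  assumes "n \<in> normal_bundle B A g f q"
  obtains U N where "open U" "q \<in> U" "smooth_section_on B A f U N" "N q = n"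
    "\<And>q'. q' \<in> U \<Longrightarrow> N q' \<in> normal_bundle B A g f q'"
proof -
  have sum: "normal_bundle B A g f q' = STp q' + radical B A g f q'" for q'
    using normal_sum[of q'] by (simp add: orth_direct_sum_def direct_sum_def)
  obtain s r where n: "n = s + r" "s \<in> STp q" "r \<in> radical B A g f q"
    using assms unfolding sum by (rule set_plus_elim)
  obtain U1 N1 where 1: "open U1" "q \<in> U1" "smooth_section_on B A f U1 N1" "N1 q = s"
    "\<And>q'. q' \<in> U1 \<Longrightarrow> N1 q' \<in> STp q'"
    using subbundle_section[where E = STp, OF subbundle_STp n(2)] by blast
  obtain U2 N2 where 2: "open U2" "q \<in> U2" "smooth_section_on B A f U2 N2" "N2 q = r"
    "\<And>q'. q' \<in> U2 \<Longrightarrow> N2 q' \<in> radical B A g f q'"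
    using subbundle_section[where E = "radical B A g f", OF subbundle_radical n(3)] by blast
  show ?thesis
  proof (rule that[of "U1 \<inter> U2" "\<lambda>q. N1 q + N2 q"])
    show "smooth_section_on B A f (U1 \<inter> U2) (\<lambda>q. N1 q + N2 q)"
      using 1 2 by (intro smooth_section_add) (auto intro: smooth_section_subset)
    show "N1 q' + N2 q' \<in> normal_bundle B A g f q'" if "q' \<in> U1 \<inter> U2" for q'
      unfolding sum using that 1(5) 2(5) by (intro set_plus_intro) auto
  qed (use 1 2 n in auto)
qed

text \<open>Umbilicity on coordinate fields of the submanifold, whose images under the differential
  have coordinates \<open>fd F y v\<close>. It becomes a condition on \<open>F\<close> modulo the
  range of its derivative, the form used by \<open>umbilical_radical_curvature\<close>.\<close>

lemma umbilical_cov_deriv: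
  assumes H: "\<And>U X Y q. open U \<Longrightarrow> smooth_field_on B U X \<Longrightarrow> smooth_field_on B U Y \<Longrightarrow> q \<in> U \<Longrightarrow>
      second_fundamental_form B A \<Gamma> f (\<lambda>q. ltr q + STp q) X Y q =
        g (f q) (differential B A f q (X q)) (differential B A f q (Y q)) *\<^sub>R H q"
    and cd: "c \<in> B" "d \<in> A" and q: "q \<in> cdom c" "f q \<in> cdom d"
  defines "F \<equiv> coord_map c d f" and "x \<equiv> cmap c q"
  shows "cd (\<lambda>y. \<Gamma> d (cinv d y)) F (\<lambda>y. fd F y v) x u
    - coord_metric d (F x) (fd F x u) (fd F x v) *\<^sub>R coord_section A c d f H x \<in> range (fd F x)"
proof -
  define X Y V where "X = cfield B c u" and "Y = cfield B c v" and "V = (\<lambda>q. differential B A f q (Y q))"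
  have X: "smooth_field_on B (cdom c) X" and Y: "smooth_field_on B (cdom c) Y"
    unfolding X_def Y_def by (rule src.smooth_field_cfield[OF cd(1)])+
  have V: "smooth_section_on B A f (cdom c) V"
    unfolding V_def by (rule smooth_section_differential[OF src.open_cdom[OF cd(1)] Y])
  have diff: "tcoord A d (f q) (differential B A f q (X q)) = fd F x u"
    "tcoord A d (f q) (differential B A f q (Y q)) = fd F x v"
    using cd q by (simp_all add: tcoord_differential X_def Y_def F_def x_def)
  have metric: "coord_metric d (F x) (fd F x u) (fd F x v) =
      g (f q) (differential B A f q (X q)) (differential B A f q (Y q))"
    using coord_metric_tcoord[OF cd(2) q(2), of "differential B A f q (X q)" "differential B A f q (Y q)"]
    unfolding diff using cd q by (simp add: F_def x_def coord_map_cmap)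
  define t where "t = second_fundamental_form B A \<Gamma> f (\<lambda>q. ltr q + STp q) X Y q"
  have "cov_deriv B A \<Gamma> f V q (X q) - t \<in> tangent_bundle B A f q"
    using theI'[OF transversal_decomposition[of q "cov_deriv B A \<Gamma> f V q (X q)"]]
    unfolding t_def second_fundamental_form_def V_def by blast
  then have "tcoord A d (f q) (cov_deriv B A \<Gamma> f V q (X q) - t) \<in> range (fd F x)"
    using range_fd_coord_map[OF cd q] by (simp add: F_def x_def)
  also have "tcoord A d (f q) (cov_deriv B A \<Gamma> f V q (X q) - t) =
      tcoord A d (f q) (cov_deriv B A \<Gamma> f V q (X q)) - tcoord A d (f q) t"
    by (rule linear_diff[OF linear_tcoord[OF cd(2) q(2)]])
  also have "tcoord A d (f q) (cov_deriv B A \<Gamma> f V q (X q)) =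
      cd (\<lambda>y. \<Gamma> d (cinv d y)) F (coord_section A c d f V) x u"
    using tcoord_cov_deriv[OF connection cd src.open_cdom[OF cd(1)] q(1) V q, of "X q"] cd q
    by (simp add: F_def x_def X_def)
  also have "cd (\<lambda>y. \<Gamma> d (cinv d y)) F (coord_section A c d f V) x =
      cd (\<lambda>y. \<Gamma> d (cinv d y)) F (\<lambda>y. fd F y v) x"
  proof (rule cd_cong[OF open_chart_domain[OF cd]])
    show "x \<in> chart_domain c d" using q by (auto simp: chart_domain_def x_def)
    show "coord_section A c d f V y = fd F y v" if "y \<in> chart_domain c d" for y
      using that cd
      by (auto simp: chart_domain_def coord_section_def V_def Y_def F_def tcoord_differential src.cinv_cmap)
  qed simp
  also have "t = g (f q) (differential B A f q (X q)) (differential B A f q (Y q)) *\<^sub>R H q"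
    unfolding t_def by (rule H[OF src.open_cdom[OF cd(1)] X Y q(1)])
  also have "tcoord A d (f q) \<dots> = coord_metric d (F x) (fd F x u) (fd F x v) *\<^sub>R coord_section A c d f H x"
    unfolding metric using cd q linear_scale[OF linear_tcoord[OF cd(2) q(2)]]
    by (simp add: x_def coord_section_def src.cinv_cmap)
  finally show ?thesis .
qed

lemma orth_coord_metric_iff:
  assumes cd: "c \<in> B" "d \<in> A" and q: "q \<in> cdom c" "f q \<in> cdom d"
  shows "tcoord A d (f q) n \<in> orth (coord_metric d (cmap d (f q))) (range (fd (coord_map c d f) (cmap c q)))
    \<longleftrightarrow> n \<in> normal_bundle B A g f q"
  unfolding range_fd_coord_map[OF assms] orth_def normal_bundle_def
  using coord_metric_tcoord[OF cd(2) q(2)] by simp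

text \<open>Since \<open>D\<close> is a subbundle of the radical, \<open>Z\<close> extends to a
  section that remains radical near \<open>q\<close>, which the coordinate argument differentiates
  twice. With the charts selected at \<open>q\<close> and \<open>f q\<close>, the coordinate
  identity is already the claim.\<close>

lemma radical_curvature:
  assumes umb: "totally_umbilical B A g \<Gamma> f STp ltr"
    and D: "subbundle B A f D" "\<And>q. D q \<subseteq> radical B A g f q"
    and Z: "Z \<in> D q" and n: "n \<in> normal_bundle B A g f q"
    and XY: "X \<in> tangent_bundle B A f q" "Y \<in> tangent_bundle B A f q"
  defines "d \<equiv> chart_at A (f q)"
  shows "g (f q) (curv (\<lambda>y. \<Gamma> d (cinv d y)) (cmap d (f q)) X Y Z) n = 0"
proof -
  obtain H where H: "\<forall>U X Y. open U \<longrightarrow> smooth_field_on B U X \<longrightarrow> smooth_field_on B U Y \<longrightarrow>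
      (\<forall>q\<in>U. second_fundamental_form B A \<Gamma> f (\<lambda>q. ltr q + STp q) X Y q =
        g (f q) (differential B A f q (X q)) (differential B A f q (Y q)) *\<^sub>R H q)"
    using umb unfolding totally_umbilical_def Let_def by (elim exE conjE)
  define c where "c = chart_at B q"
  have cd: "c \<in> B" "d \<in> A" "q \<in> cdom c" "f q \<in> cdom d"
    by (simp_all add: c_def d_def chart_at src.chart_at)
  obtain U V where U: "open U" "q \<in> U" and V: "smooth_section_on B A f U V" "V q = Z"
    and VD: "\<And>q'. q' \<in> U \<Longrightarrow> V q' \<in> D q'"
    using subbundle_section[where E = D, OF D(1) Z] by blast
  define W F x where "W = cmap c ` (cdom c \<inter> U \<inter> f -` cdom d)" and "F = coord_map c d f" and "x = cmap c q"
  have W: "open W" unfolding W_def by (rule open_section_domain[OF U(1) cd(1,2)])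
  have x: "x \<in> W" using cd U by (auto simp: W_def x_def)
  have F: "smooth_on W F" "F ` W \<subseteq> cmap d ` cdom d"
    using smooth_on_subset[OF smooth_coord_map[OF cd(1,2)], of W] coord_map_image[OF cd(1), of d]
    by (auto simp: W_def F_def chart_domain_def)
  have C: "smooth_bilinear (cmap d ` cdom d) (\<lambda>y. \<Gamma> d (cinv d y))"
    by (rule smooth_bilinear_connection[OF connection cd(2)])
  have Fx: "F x = cmap d (f q)" using cd by (simp add: F_def x_def coord_map_cmap)
  have at_q: "fd F x (tcoord B c q w) = differential B A f q w" for w
    using tcoord_differential[OF cd(1,2,3,4), of w] by (simp add: F_def x_def d_def)
  have metric_q: "coord_metric d (cmap d (f q)) v w = g (f q) v w" for v w
    using coord_metric_tcoord[OF cd(2,4), of v w] by (simp add: d_def)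
  obtain u v where uv: "X = differential B A f q u" "Y = differential B A f q v"
    using XY by (auto simp: tangent_bundle_def)
  have "coord_metric d (F x) (curv (\<lambda>y. \<Gamma> d (cinv d y)) (F x)
      (fd F x (tcoord B c q u)) (fd F x (tcoord B c q v)) (coord_section A c d f V x)) n = 0"
  proof (rule umbilical_radical_curvature[OF C smooth_bilinear_coord_metric[OF cd(2)] _ _ _ W F _ _ _ _ _ x])
    show "coord_metric d y a b = coord_metric d y b a" for y a b by (rule coord_metric_commute)
    show "nondegenerate_on (coord_metric d y) UNIV" if "y \<in> cmap d ` cdom d" for y
      by (rule nondegenerate_coord_metric[OF cd(2) that])
    show "fd (\<lambda>z. coord_metric d z a b) y w =
        coord_metric d y (\<Gamma> d (cinv d y) w a) b + coord_metric d y a (\<Gamma> d (cinv d y) w b)"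
      if "y \<in> cmap d ` cdom d" for y a b w
      by (rule coord_metric_compatible[OF cd(2) that])
    show "cd (\<lambda>y. \<Gamma> d (cinv d y)) F (\<lambda>y. fd F y v) y u
        - coord_metric d (F y) (fd F y u) (fd F y v) *\<^sub>R coord_section A c d f H y \<in> range (fd F y)"
      if "y \<in> W" for y u v
      using that umbilical_cov_deriv[OF H[rule_format] cd(1,2)] by (auto simp: W_def F_def)
    show "smooth_on W (coord_section A c d f V)"
      unfolding W_def by (rule smooth_coord_section[OF V(1) cd(1,2)])
    show "n \<in> orth (coord_metric d (F x)) (range (fd F x))"
      using orth_coord_metric_iff[OF cd, of n] n by (simp add: F_def x_def coord_map_cmap[OF cd(1,3)]) (simp add: d_def)
  next
    fix y assume "y \<in> W"
    then obtain q' where q': "y = cmap c q'" "q' \<in> cdom c" "q' \<in> U" "f q' \<in> cdom d" by (auto simp: W_def)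
    have Vy: "coord_section A c d f V y = tcoord A d (f q') (V q')"
      using q' cd by (simp add: coord_section_def src.cinv_cmap)
    have Fy: "F y = cmap d (f q')" using q' cd by (simp add: F_def coord_map_cmap)
    have rad: "V q' \<in> radical B A g f q'" using VD[OF q'(3)] D(2) by blast
    have range: "range (fd F y) = tcoord A d (f q') ` tangent_bundle B A f q'"
      using range_fd_coord_map[OF cd(1,2) q'(2,4)] by (simp add: F_def q'(1))
    show "coord_section A c d f V y \<in> range (fd F y)"
      using rad unfolding Vy range by (auto simp: radical_def)
    show "coord_metric d (F y) (fd F y v) (coord_section A c d f V y) = 0" for v
    proof -
      have "fd F y v \<in> tcoord A d (f q') ` tangent_bundle B A f q'" using range by blast
      then show ?thesis
        using rad g_commute cd(2) q'(4)
        by (auto simp: Vy Fy coord_metric_tcoord radical_def normal_bundle_def orth_def)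
    qed
    fix n assume n: "n \<in> orth (coord_metric d (F y)) (range (fd F y))"
    \<comment> \<open>The ambient vector with coordinates \<open>n\<close>, to which
      \<open>normal_section\<close> applies.\<close>
    define \<nu> where "\<nu> = cfield A d n (f q')"
    have \<nu>: "tcoord A d (f q') \<nu> = n" using cd(2) q'(4) by (simp add: \<nu>_def)
    have \<nu>_normal: "\<nu> \<in> normal_bundle B A g f q'"
      using orth_coord_metric_iff[OF cd(1,2) q'(2,4), of \<nu>] n by (simp add: \<nu> Fy[symmetric] F_def q'(1))
    obtain U' N where U': "open U'" "q' \<in> U'" and N: "smooth_section_on B A f U' N" "N q' = \<nu>"
      "\<And>q'. q' \<in> U' \<Longrightarrow> N q' \<in> normal_bundle B A g f q'"
      using normal_section[OF \<nu>_normal] by blast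
    define W' where "W' = cmap c ` (cdom c \<inter> (U \<inter> U') \<inter> f -` cdom d)"
    show "\<exists>W' N. open W' \<and> y \<in> W' \<and> W' \<subseteq> W \<and> smooth_on W' N \<and> N y = n \<and>
        (\<forall>z\<in>W'. N z \<in> orth (coord_metric d (F z)) (range (fd F z)))"
    proof (intro exI[of _ W'] exI[of _ "coord_section A c d f N"] conjI ballI)
      show "open W'" unfolding W'_def by (rule open_section_domain[OF open_Int[OF U(1) U'(1)] cd(1,2)])
      show "y \<in> W'" "W' \<subseteq> W" using q' U' by (auto simp: W'_def W_def)
      show "smooth_on W' (coord_section A c d f N)"
        unfolding W'_def by (rule smooth_coord_section[OF smooth_section_subset[OF N(1)] cd(1,2)]) simp
      show "coord_section A c d f N y = n"
        using q' cd by (simp add: coord_section_def src.cinv_cmap N(2) \<nu>)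
      fix z assume "z \<in> W'"
      then obtain r where r: "z = cmap c r" "r \<in> cdom c" "r \<in> U'" "f r \<in> cdom d" by (auto simp: W'_def)
      then show "coord_section A c d f N z \<in> orth (coord_metric d (F z)) (range (fd F z))"
        using orth_coord_metric_iff[OF cd(1,2) r(2,4), of "N r"] N(3)[OF r(3)] cd
        by (simp add: coord_section_def src.cinv_cmap F_def coord_map_cmap)
    qed
  qed
  moreover have "coord_section A c d f V x = Z"
    using cd V(2) by (simp add: coord_section_def x_def src.cinv_cmap) (simp add: d_def)
  ultimately show ?thesis by (simp add: metric_q at_q uv Fx)
qed

end

theorem theorem4p4:
  fixes A :: "('p::{t2_space,second_countable_topology}, 'e::euclidean_space) chart set"
    and g :: "'p \<Rightarrow> 'e \<Rightarrow> 'e \<Rightarrow> real"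
    and J :: "'p \<Rightarrow> 'e \<Rightarrow> 'e"
    and \<Gamma> :: "('p, 'e) connection"
    and c :: real
  assumes "indefinite_complex_space_form A g J \<Gamma> c"
    and "c \<noteq> 0"
  shows "\<not> (\<exists>(B :: ('q::{t2_space,second_countable_topology}, 'd::euclidean_space) chart set) f
            ST STp ltr D1 D2 D0 D' L1 L2 S.
            proper_STCR_lightlike_submanifold B A g J f ST STp ltr D1 D2 D0 D' L1 L2 S \<and>
            totally_umbilical B A g \<Gamma> f STp ltr)"
proof (intro notI, elim exE conjE)
  fix B :: "('q, 'd) chart set" and f ST STp ltr D1 D2 D0 D' L1 L2 S
  assume proper: "proper_STCR_lightlike_submanifold B A g J f ST STp ltr D1 D2 D0 D' L1 L2 S"
    and umb: "totally_umbilical B A g \<Gamma> f STp ltr"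
  have stcr: "STCR_lightlike_submanifold B A g J f ST STp ltr D1 D2 D0 D' L1 L2 S"
    and ne: "\<exists>q. D2 q \<noteq> {0}" "\<exists>q. D0 q \<noteq> {0}"
    using proper by (auto simp: proper_STCR_lightlike_submanifold_def)
  interpret lightlike_in_kaehler A g J \<Gamma> B f ST STp ltr
    by unfold_locales
      (use assms stcr in \<open>simp_all add: indefinite_complex_space_form_def STCR_lightlike_submanifold_def\<close>)
  have sub: "subbundle B A f D1" "subbundle B A f D2" "subbundle B A f D0" "subbundle B A f D'"
    using stcr by (auto simp: STCR_lightlike_submanifold_def)
  have pt: "direct_sum (radical B A g f q) (D1 q) (D2 q)" "J (f q) ` D2 q \<subseteq> STp q"
    "orth_direct_sum (g (f q)) (ST q) (J (f q) ` D1 q + D' q) (D0 q)"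
    "J (f q) ` D0 q = D0 q" "nondegenerate_on (g (f q)) (D0 q)" for q
    using stcr by (simp_all add: STCR_lightlike_submanifold_def Let_def)
  have D2: "D2 q \<subseteq> radical B A g f q" for q
    using direct_sum_subset(2)[OF pt(1)] subspace_0[OF subbundle_subspace[OF sub(1)]] .
  obtain q where "D2 q \<noteq> {0}" using ne(1) by blast
  then obtain Z where Z: "Z \<in> D2 q" "Z \<noteq> 0"
    using subspace_0[OF subbundle_subspace[OF sub(2)]] by blast
  have "D0 q \<noteq> {0}" using ne(2) subbundle_nonzero[OF sub(3)] by blast
  then obtain X where X: "X \<in> D0 q" "g (f q) X X \<noteq> 0"
    using nondegenerate_nonnull[OF bilinear_g g_commute subbundle_subspace[OF sub(3)] pt(5)] by blast
  \<comment> \<open>A summand of a \<open>direct_sum\<close> is contained in the sum because zero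
    belongs to the other summand.\<close>
  have "J (f q) 0 = 0" by (rule linear_0[OF linear_J])
  then have "0 \<in> J (f q) ` D1 q + D' q"
    using set_plus_intro[of 0 "J (f q) ` D1 q" 0 "D' q"]
      subspace_0[OF subbundle_subspace[OF sub(1)], of q] subspace_0[OF subbundle_subspace[OF sub(4)], of q]
    by force
  then have "D0 q \<subseteq> ST q"
    using direct_sum_subset(2) pt(3) unfolding orth_direct_sum_def by blast
  moreover have "ST q \<subseteq> tangent_bundle B A f q"
    using direct_sum_subset(1) tangent_sum[of q] subspace_0[OF subbundle_subspace[OF subbundle_radical]]
    unfolding orth_direct_sum_def by blast
  ultimately have D0: "D0 q \<subseteq> tangent_bundle B A f q" by blast
  have XT: "X \<in> tangent_bundle B A f q" "J (f q) X \<in> tangent_bundle B A f q"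
    using X(1) D0 pt(4)[of q] by blast+
  have "J (f q) Z \<noteq> 0"
    using J_J[of "f q" Z] linear_0[OF linear_J, of "f q"] Z(2) by auto
  then obtain n where n: "n \<in> STp q" "g (f q) (J (f q) Z) n \<noteq> 0"
    using nondegenerate_STp[of q] pt(2)[of q] Z(1) unfolding nondegenerate_on_def by blast
  have "STp q \<subseteq> normal_bundle B A g f q"
    using direct_sum_subset(1) normal_sum[of q] subspace_0[OF subbundle_subspace[OF subbundle_radical]]
    unfolding orth_direct_sum_def by blast
  then have nN: "n \<in> normal_bundle B A g f q" using n(1) by blast
  have XZ: "g (f q) X Z = 0" "g (f q) (J (f q) X) Z = 0"
    using Z(1) D2[of q] XT g_commute by (auto simp: radical_def normal_bundle_def orth_def)
  have "constant_holomorphic_sectional_curvature A g J \<Gamma> c"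
    using assms(1) by (simp add: indefinite_complex_space_form_def)
  \<comment> \<open>Both facts evaluate g(R(X, JX) Z, n): the second gives zero, while by
    \<open>XZ\<close> only the last term of the first survives.\<close>
  from space_form_curvature[OF this, of "f q" X Z n]
    radical_curvature[OF umb sub(2) D2 Z(1) nN XT]
  have "c / 4 * (- 2 * g (f q) X X * g (f q) (J (f q) Z) n) = 0"
    by (simp add: XZ)
  then show False using assms(2) X(2) n(2) by simp
qed

end
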